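(* Assume $(N-\lambda(N))/\sqrt{N}\to\beta$ as $N\to\infty$ for some $\beta>0$, and that $\bar{Q}_i^{d(N)}(0)$ converges in distribution to $\bar{Q}_i(0)$ in $\mathbb{R}$ as $N\to\infty$ (for each $i$). If $d(N)/(\sqrt{N}\log N)\to0$ as $N\to\infty$, then the diffusion limit of the JSQ$(d(N))$ scheme differs from that of the ordinary JSQ policy; that is, the sequence of processes $\{\bar{\mathbf{Q}}^{d(N)}(t)\}_{t\ge0}$ under the JSQ$(d(N))$ scheme does not converge weakly to the diffusion limit of the ordinary JSQ policy (with the same limiting initial condition).
   Context: Model: the $N$-th system has $N$ parallel identical single-server queues and one dispatcher. Tasks with independent unit-mean exponential service requirements arrive as a Poisson process of rate $\lambda(N)$. On arrival, a task is immediately assigned to a server with the shortest queue among $d(N)$ servers selected uniformly at random, $1\le d(N)\le N$ (the JSQ$(d(N))$ scheme; the ordinary JSQ policy assigns every task to a server with the shortest queue among all $N$ servers). Each server has buffer capacity $b$ (possibly infinite, including the task in service); a task assigned to a server with $b$ pending tasks is permanently discarded. $Q_i^{d(N)}(t)$ is the number of servers with queue length at least $i$ (including the task in service) at time $t$, $i=1,\dots,b$. The centered and scaled occupancy state is $\bar{\mathbf{Q}}^{d(N)}(t)=(\bar{Q}_1^{d(N)}(t),\dots,\bar{Q}_b^{d(N)}(t))$ with $\bar{Q}_1^{d(N)}(t)=-(N-Q_1^{d(N)}(t))/\sqrt{N}$ and $\bar{Q}_i^{d(N)}(t)=Q_i^{d(N)}(t)/\sqrt{N}$ for $i=2,\dots,b$.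 Diffusion limit of the ordinary JSQ policy: the weak limit (Skorohod $J_1$ topology) of the analogously scaled process under the ordinary JSQ policy. When $b\ge2$ and, for some $k\ge2$, $\bar{Q}_{k+1}^{N}(0)=0$ for all large $N$, it is given by $\bar Q_i\equiv0$ for $i\ge k+1$ and the unique solution (with $\bar Q_1\le 0$) of $\bar{Q}_1(t)=\bar{Q}_1(0)+\sqrt2 W(t)-\beta t+\int_0^t(-\bar{Q}_1(s)+\bar{Q}_2(s))ds-U_1(t)$, $\bar{Q}_2(t)=\bar{Q}_2(0)+U_1(t)-\int_0^t(\bar{Q}_2(s)-\bar{Q}_3(s))ds$, $\bar{Q}_i(t)=\bar{Q}_i(0)-\int_0^t(\bar{Q}_i(s)-\bar{Q}_{i+1}(s))ds$ for $i=3,\dots,k$, where $W$ is a standard Brownian motion and $U_1$ is the nondecreasing nonnegative c\`adl\`ag process with $\int_0^\infty\mathbf{1}_{[\bar{Q}_1(t)<0]}dU_1(t)=0$. *)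

theory Defs
  imports "HOL-Probability.Probability" "HOL-Library.Extended_Nat"
begin

section \<open>Weak convergence in the Skorohod $J_1$ topology\<close>

text \<open>
  Paths are functions on \<^typ>\<open>real\<close> of which only the restriction to $[0,\infty)$ matters:
  paths that agree on $[0,\infty)$ are topologically indistinguishable below.
\<close>

definition cadlag :: "(real \<Rightarrow> 'a::topological_space) set" where
  "cadlag = {x. \<forall>t\<ge>0. continuous (at_right t) x \<and> (t > 0 \<longrightarrow> (\<exists>l. (x \<longlongrightarrow> l) (at_left t)))}"

definition time_change :: "(real \<Rightarrow> real) \<Rightarrow> bool" where
  "time_change \<tau> \<longleftrightarrow> strict_mono_on {0..} \<tau> \<and> continuous_on {0..} \<tau> \<and> \<tau> ` {0..} = {0..}"

definition J1_converges :: "(nat \<Rightarrow> real \<Rightarrow> 'a::metric_space) \<Rightarrow> (real \<Rightarrow> 'a) \<Rightarrow> bool" where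
  "J1_converges xs x \<longleftrightarrow>
     (\<exists>\<tau>. (\<forall>n. time_change (\<tau> n))
        \<and> uniform_limit {0..} \<tau> (\<lambda>t. t) sequentially
        \<and> (\<forall>T\<ge>0. uniform_limit {0..T} (\<lambda>n t. xs n (\<tau> n t)) x sequentially))"

definition J1_open :: "(real \<Rightarrow> 'a::metric_space) set \<Rightarrow> bool" where
  "J1_open U \<longleftrightarrow> U \<subseteq> cadlag \<and>
     (\<forall>x\<in>U. \<forall>xs. range xs \<subseteq> cadlag \<longrightarrow> J1_converges xs x \<longrightarrow> (\<forall>\<^sub>F n in sequentially. xs n \<in> U))"

text \<open>
  The $J_1$ topology on $D([0,\infty))$ is metrizable and its convergent sequences are those of
  \<open>J1_converges\<close>; hence its open sets are the sequentially open ones.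
\<close>

definition skorohod_J1 :: "(real \<Rightarrow> 'a::metric_space) topology" where
  "skorohod_J1 = topology J1_open"

lemma istopology_J1_open: "istopology (J1_open :: (real \<Rightarrow> 'a::metric_space) set \<Rightarrow> bool)"
  unfolding istopology_def
proof (intro conjI allI impI)
  fix S T :: "(real \<Rightarrow> 'a) set"
  assume "J1_open S" "J1_open T"
  then show "J1_open (S \<inter> T)"
    unfolding J1_open_def by (auto intro: eventually_conj)
next
  fix K :: "(real \<Rightarrow> 'a) set set"
  assume K: "\<forall>U\<in>K. J1_open U"
  show "J1_open (\<Union>K)"
    unfolding J1_open_def
  proof (intro conjI ballI allI impI)
    show "\<Union>K \<subseteq> cadlag"
      using K unfolding J1_open_def by blast
  next
    fix x and xs :: "nat \<Rightarrow> real \<Rightarrow> 'a"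
    assume "x \<in> \<Union>K" and xs: "range xs \<subseteq> cadlag" "J1_converges xs x"
    then obtain U where U: "U \<in> K" "x \<in> U" by blast
    then have "\<forall>\<^sub>F n in sequentially. xs n \<in> U"
      using K xs unfolding J1_open_def by blast
    then show "\<forall>\<^sub>F n in sequentially. xs n \<in> \<Union>K"
      by (rule eventually_mono) (use U in blast)
  qed
qed

lemma openin_skorohod_J1: "openin skorohod_J1 U \<longleftrightarrow> J1_open U"
  unfolding skorohod_J1_def by (simp add: topology_inverse' istopology_J1_open)

lemma topspace_skorohod_J1: "topspace skorohod_J1 = cadlag"
proof -
  have "J1_open cadlag"
    unfolding J1_open_def by (auto simp: range_subsetD)
  then show ?thesis
    unfolding topspace_def openin_skorohod_J1 by (auto simp: J1_open_def)
qed

text \<open>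
  The processes may live on different probability spaces. Their paths need only be cadlag almost
  surely; the completion makes the behaviour on the exceptional null set irrelevant, including
  for measurability.
\<close>

definition weakly_converges_J1 ::
    "(nat \<Rightarrow> 'w measure) \<Rightarrow> (nat \<Rightarrow> 'w \<Rightarrow> real \<Rightarrow> 'a::metric_space)
       \<Rightarrow> 'v measure \<Rightarrow> ('v \<Rightarrow> real \<Rightarrow> 'a) \<Rightarrow> bool" where
  "weakly_converges_J1 M X P Y \<longleftrightarrow>
     (\<forall>F. continuous_map skorohod_J1 euclideanreal F \<and> bounded (F ` topspace skorohod_J1) \<longrightarrow>
        (\<lambda>N. \<integral>\<omega>. F (X N \<omega>) \<partial>completion (M N)) \<longlonglongrightarrow> (\<integral>\<omega>. F (Y \<omega>) \<partial>completion P))"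


section \<open>The JSQ(d) system\<close>

text \<open>
  Servers are \<open>0, \<dots>, N - 1\<close>. A sample point consists of the initial queue lengths, the service
  requirements of the initial tasks (indexed by server and position in the queue), and for every
  arriving task its interarrival time, its sampled set of servers, and its service requirement.
\<close>

type_synonym sample =
  "(nat \<Rightarrow> nat) \<times> (nat \<times> nat \<Rightarrow> real) \<times> (nat \<Rightarrow> real \<times> nat set \<times> real)"

definition exponential :: "real \<Rightarrow> real measure" where
  "exponential l = density lborel (exponential_density l)"

definition uniform_selection :: "nat \<Rightarrow> nat \<Rightarrow> nat set pmf" where
  "uniform_selection N d = pmf_of_set {S. S \<subseteq> {..<N} \<and> card S = d}"

text \<open>
  All primitives are independent. By memorylessness also the task in service at time 0 has a
  unit-mean exponential (remaining) requirement.
\<close>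

definition jsq_space :: "nat \<Rightarrow> real \<Rightarrow> nat \<Rightarrow> (nat \<Rightarrow> nat) pmf \<Rightarrow> sample measure" where
  "jsq_space N l d init =
     measure_pmf init
     \<Otimes>\<^sub>M (\<Pi>\<^sub>M p\<in>UNIV. exponential 1)
     \<Otimes>\<^sub>M (\<Pi>\<^sub>M j\<in>UNIV. exponential l \<Otimes>\<^sub>M measure_pmf (uniform_selection N d) \<Otimes>\<^sub>M exponential 1)"

definition arrival_time :: "sample \<Rightarrow> nat \<Rightarrow> real" where
  "arrival_time = (\<lambda>(x0, s0, task) j. \<Sum>i\<le>j. fst (task i))"

text \<open>
  Servers are first-come first-served, so a task's departure time is known as soon as it is
  assigned. The state of a server is the list of departure times of all tasks admitted so far, in
  order of admission; those still pending at time \<open>t\<close> have a departure time exceeding \<open>t\<close>.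
\<close>

definition pending :: "real list \<Rightarrow> real \<Rightarrow> nat" where
  "pending D t = length (filter (\<lambda>u. t < u) D)"

text \<open>\<open>arg_min_on\<close> breaks ties in an arbitrary, unspecified way.\<close>

definition assign_task ::
    "enat \<Rightarrow> real \<Rightarrow> nat set \<Rightarrow> real \<Rightarrow> (nat \<Rightarrow> real list) \<Rightarrow> (nat \<Rightarrow> real list)" where
  "assign_task b t S s D =
     (let n = arg_min_on (\<lambda>m. pending (D m) t) S;
          start = (if D n = [] then t else max t (last (D n)))
      in if enat (pending (D n) t) < b then D(n := D n @ [start + s]) else D)"

text \<open>\<open>schedule b \<omega> j\<close> is the state after the first \<open>j\<close> arrivals.\<close>

primrec schedule :: "enat \<Rightarrow> sample \<Rightarrow> nat \<Rightarrow> nat \<Rightarrow> real list" where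
  "schedule b \<omega> 0 =
     (case \<omega> of (x0, s0, task) \<Rightarrow> (\<lambda>n. map (\<lambda>k. \<Sum>i\<le>k. s0 (n, i)) [0..<x0 n]))"
| "schedule b \<omega> (Suc j) =
     (case \<omega> of (x0, s0, task) \<Rightarrow> case task j of (_, S, s) \<Rightarrow>
        assign_task b (arrival_time \<omega> j) S s (schedule b \<omega> j))"

definition queue_length :: "enat \<Rightarrow> sample \<Rightarrow> real \<Rightarrow> nat \<Rightarrow> nat" where
  "queue_length b \<omega> t n = pending (schedule b \<omega> (card {j. arrival_time \<omega> j \<le> t}) n) t"

definition occupancy :: "nat \<Rightarrow> (nat \<Rightarrow> nat) \<Rightarrow> nat \<Rightarrow> nat" where
  "occupancy N x i = card {n. n < N \<and> i \<le> x n}"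

text \<open>
  A state in $\mathbb{R}^b$ (or $\mathbb{R}^\infty$) is a function \<^typ>\<open>nat \<Rightarrow> real\<close> vanishing
  outside $\{1,\dots,b\}$, with the product topology. For \<open>i > b\<close> the occupancy is 0 automatically.
\<close>

definition scaled_occupancy :: "nat \<Rightarrow> (nat \<Rightarrow> nat) \<Rightarrow> nat \<Rightarrow> real" where
  "scaled_occupancy N x i =
     (if i = 0 then 0
      else if i = 1 then - ((real N - real (occupancy N x 1)) / sqrt (real N))
      else real (occupancy N x i) / sqrt (real N))"

definition scaled_process :: "nat \<Rightarrow> enat \<Rightarrow> sample \<Rightarrow> real \<Rightarrow> nat \<Rightarrow> real" where
  "scaled_process N b \<omega> t = scaled_occupancy N (queue_length b \<omega> t)"

text \<open>
  There are only countably many initial configurations, so a discrete distribution is no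
  restriction.
\<close>

definition initial_law :: "nat \<Rightarrow> enat \<Rightarrow> (nat \<Rightarrow> nat) pmf \<Rightarrow> bool" where
  "initial_law N b init \<longleftrightarrow>
     (\<forall>x\<in>set_pmf init. (\<forall>n<N. enat (x n) \<le> b) \<and> (\<forall>n\<ge>N. x n = 0))"


section \<open>The diffusion limit of the ordinary JSQ policy\<close>

definition cadlag_process :: "enat \<Rightarrow> 'v measure \<Rightarrow> ('v \<Rightarrow> real \<Rightarrow> nat \<Rightarrow> real) \<Rightarrow> bool" where
  "cadlag_process b P Y \<longleftrightarrow> prob_space P
     \<and> (\<forall>t\<ge>0. \<forall>i. (\<lambda>\<omega>. Y \<omega> t i) \<in> borel_measurable P)
     \<and> (\<forall>\<omega>\<in>space P. Y \<omega> \<in> cadlag \<and> (\<forall>t\<ge>0. \<forall>i. i = 0 \<or> b < enat i \<longrightarrow> Y \<omega> t i = 0))"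

definition initial_convergence ::
    "(nat \<Rightarrow> (nat \<Rightarrow> nat) pmf) \<Rightarrow> enat \<Rightarrow> 'v measure \<Rightarrow> ('v \<Rightarrow> real \<Rightarrow> nat \<Rightarrow> real) \<Rightarrow> bool" where
  "initial_convergence init b P Y \<longleftrightarrow>
     (\<forall>i. 1 \<le> i \<and> enat i \<le> b \<longrightarrow>
        weak_conv_m (\<lambda>N. distr (measure_pmf (init N)) borel (\<lambda>x. scaled_occupancy N x i))
                    (distr P borel (\<lambda>\<omega>. Y \<omega> 0 i)))"

definition standard_brownian_motion :: "'v measure \<Rightarrow> (real \<Rightarrow> 'v \<Rightarrow> real) \<Rightarrow> bool" where
  "standard_brownian_motion P W \<longleftrightarrow> prob_space P
     \<and> (\<forall>t\<ge>0. W t \<in> borel_measurable P)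
     \<and> (AE \<omega> in P. W 0 \<omega> = 0 \<and> continuous_on {0..} (\<lambda>t. W t \<omega>))
     \<and> (\<forall>s t. 0 \<le> s \<and> s < t \<longrightarrow>
          distributed P lborel (\<lambda>\<omega>. W t \<omega> - W s \<omega>) (normal_density 0 (sqrt (t - s))))
     \<and> (\<forall>ts. sorted ts \<and> set ts \<subseteq> {0..} \<longrightarrow>
          prob_space.indep_vars P (\<lambda>_. borel) (\<lambda>i \<omega>. W (ts ! Suc i) \<omega> - W (ts ! i) \<omega>)
            {..<length ts - 1})"

text \<open>
  The system of integral equations for given paths \<open>w\<close> of \<open>W\<close>, \<open>u\<close> of \<open>U\<^sub>1\<close> and \<open>y\<close> of the
  diffusion. The Stieltjes measure of \<open>u\<close> puts no mass on the negative half-line.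
\<close>

definition jsq_diffusion_equations ::
    "real \<Rightarrow> nat \<Rightarrow> (real \<Rightarrow> real) \<Rightarrow> (real \<Rightarrow> real) \<Rightarrow> (real \<Rightarrow> nat \<Rightarrow> real) \<Rightarrow> bool" where
  "jsq_diffusion_equations \<beta> k w u y \<longleftrightarrow>
     u \<in> cadlag \<and> mono_on {0..} u \<and> (\<forall>t\<ge>0. 0 \<le> u t)
     \<and> (\<integral>\<^sup>+ t. indicator {t. 0 \<le> t \<and> y t 1 < 0} t \<partial>interval_measure (\<lambda>t. u (max 0 t))) = 0
     \<and> (\<forall>t\<ge>0.
          y t 1 \<le> 0
          \<and> y t 1 = y 0 1 + sqrt 2 * w t - \<beta> * t + (LBINT s:{0..t}. - y s 1 + y s 2) - u t
          \<and> y t 2 = y 0 2 + u t - (LBINT s:{0..t}. y s 2 - y s 3)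
          \<and> (\<forall>i\<in>{3..k}. y t i = y 0 i - (LBINT s:{0..t}. y s i - y s (Suc i)))
          \<and> (\<forall>i>k. y t i = 0))"

definition jsq_diffusion ::
    "real \<Rightarrow> nat \<Rightarrow> 'v measure \<Rightarrow> ('v \<Rightarrow> real \<Rightarrow> nat \<Rightarrow> real) \<Rightarrow> bool" where
  "jsq_diffusion \<beta> k P Y \<longleftrightarrow>
     (\<exists>W U. standard_brownian_motion P W \<and> (\<forall>t\<ge>0. U t \<in> borel_measurable P)
        \<and> (AE \<omega> in P. jsq_diffusion_equations \<beta> k (\<lambda>t. W t \<omega>) (\<lambda>t. U t \<omega>) (Y \<omega>)))"

text \<open>
  The ordinary JSQ policy samples all servers, i.e. \<open>d = N\<close>. Its diffusion limit is the weak limit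
  of its scaled occupancy process. The second disjunct is the explicit form this limit is known to
  take in the stated case; listing it makes claims about the explicit diffusion independent of the
  convergence theorem for JSQ.
\<close>

definition jsq_diffusion_limit ::
    "enat \<Rightarrow> (nat \<Rightarrow> real) \<Rightarrow> real \<Rightarrow> (nat \<Rightarrow> (nat \<Rightarrow> nat) pmf)
       \<Rightarrow> 'v measure \<Rightarrow> ('v \<Rightarrow> real \<Rightarrow> nat \<Rightarrow> real) \<Rightarrow> bool" where
  "jsq_diffusion_limit b lam \<beta> init P Y \<longleftrightarrow>
     weakly_converges_J1 (\<lambda>N. jsq_space N (lam N) N (init N)) (\<lambda>N. scaled_process N b) P Y
     \<or> (2 \<le> b \<and>
        (\<exists>k\<ge>2. (\<forall>\<^sub>F N in sequentially. \<forall>x\<in>set_pmf (init N). scaled_occupancy N x (Suc k) = 0)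
               \<and> jsq_diffusion \<beta> k P Y))"

end

theory Submission
  imports Defs "HOL-Real_Asymp.Real_Asymp"
begin

text \<open>
  Let \<open>N\<close> be large, fix a level \<open>K\<close>, and watch the system only during the short window \<open>[0, T]\<close>
  with \<open>T = N powr (-1/4)\<close>. Suppose that during the whole window fewer than \<open>k\<close> servers are idle,
  where \<open>k\<close> is of order \<open>sqrt N\<close>; that is, the first centered coordinate stays above \<open>- K - 1\<close>.
  An arriving task samples only busy servers with probability at least about \<open>exp (- d k / N)\<close>, and
  since \<open>d\<close> is \<open>o(sqrt N log N)\<close> this is at least \<open>N powr (-1/16)\<close>. So among the roughly \<open>N T\<close>
  arrivals of the window, at least of the order of \<open>N powr (11/16)\<close> are sent to a server that is
  already busy.

  These arrivals are missing on the other side of the balance. Up to \<open>O(sqrt N)\<close> many exceptions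
  every server starts with exactly one task; about \<open>N T\<close> of these servers finish that task during
  the window, and each of them is idle afterwards unless a new task comes. It can come in two ways.
  A task that finds an idle server is counted once, and there are too few of those. A task that
  arrives while the first one is still being served \<^emph>\<open>rescues\<close> the server from becoming idle; but
  whether the residual service ends within the window is independent of the choice of the server, so
  the expected number of rescued servers is only \<open>O(N T\<^sup>2) = O(sqrt N)\<close>. All random counts involved
  fluctuate by at most \<open>N powr (5/8)\<close>. Hence at least of the order of \<open>N powr (11/16)\<close> servers, far more
  than \<open>k\<close>, are idle at time \<open>T\<close>: a contradiction.

  So with probability tending to 1 the first coordinate falls below \<open>- K - 1\<close> at some time before
  \<open>T\<close>, and \<open>T\<close> tends to 0. The \<open>J\<^sub>1\<close>-continuous functional \<open>early_descent K\<close> attains its minimum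
  \<open>-1\<close> exactly at the cadlag paths that start at or below \<open>- K - 1\<close>. A weak limit would therefore start
  below every level almost surely (\<open>not_weakly_converges_J1_if_descent\<close>), which is impossible for a
  real-valued process.

  The accounting is pathwise and is \<open>few_idle_bound\<close>; it takes the place of the Markov generator.
  The two probabilistic inputs, \<open>nn_integral_rescued_le\<close> and \<open>nn_integral_miss_weight_le\<close>, both
  come from resampling a single coordinate of a product measure. The parts are put together for fixed
  \<open>N\<close> in \<open>integral_early_descent_le\<close>.
\<close>


section \<open>Pathwise accounting of busy servers\<close>

definition sampled :: "sample \<Rightarrow> nat \<Rightarrow> nat set" where
  "sampled \<omega> j = fst (snd (snd (snd \<omega>) j))"

definition target :: "enat \<Rightarrow> sample \<Rightarrow> nat \<Rightarrow> nat" where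
  "target b \<omega> j =
     arg_min_on (\<lambda>m. pending (schedule b \<omega> j m) (arrival_time \<omega> j)) (sampled \<omega> j)"

definition idle_before :: "enat \<Rightarrow> nat \<Rightarrow> sample \<Rightarrow> nat \<Rightarrow> nat set" where
  "idle_before b N \<omega> j = {n. n < N \<and> pending (schedule b \<omega> j n) (arrival_time \<omega> j) = 0}"

definition hit :: "enat \<Rightarrow> nat \<Rightarrow> real \<Rightarrow> sample \<Rightarrow> nat \<Rightarrow> bool" where
  "hit b a T \<omega> n \<longleftrightarrow> (\<exists>j<a. arrival_time \<omega> j \<le> T \<and> target b \<omega> j = n)"

text \<open>
  Server \<open>n\<close> starts with a single task, which would leave it idle by time \<open>T\<close>, but the first
  assignment to \<open>n\<close> comes earlier. Only the first assignment matters: until then the backlog of \<open>n\<close>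
  consists of the initial task alone.
\<close>

definition rescued :: "enat \<Rightarrow> nat \<Rightarrow> real \<Rightarrow> sample \<Rightarrow> nat \<Rightarrow> bool" where
  "rescued b a T \<omega> n \<longleftrightarrow> fst \<omega> n = 1 \<and> fst (snd \<omega>) (n, 0) \<le> T
     \<and> (\<exists>j<a. target b \<omega> j = n \<and> (\<forall>i<j. target b \<omega> i \<noteq> n)
              \<and> arrival_time \<omega> j < fst (snd \<omega>) (n, 0))"

definition reset_service :: "nat \<Rightarrow> real \<Rightarrow> sample \<Rightarrow> sample" where
  "reset_service n v \<omega> = (fst \<omega>, (fst (snd \<omega>))((n, 0) := v), snd (snd \<omega>))"

lemma arrival_time_eq: "arrival_time \<omega> j = (\<Sum>i\<le>j. fst (snd (snd \<omega>) i))"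
  by (simp add: arrival_time_def split: prod.split)

lemma arrival_time_strict_mono:
  assumes "\<forall>j. 0 < fst (snd (snd \<omega>) j)"
  shows "strict_mono (arrival_time \<omega>)"
  using assms by (intro strict_monoI_Suc) (simp add: arrival_time_eq)

lemma arrival_time_pos:
  assumes "\<forall>j. 0 < fst (snd (snd \<omega>) j)"
  shows "0 < arrival_time \<omega> j"
  using assms by (auto simp: arrival_time_eq intro!: sum_pos)

lemma schedule_0: "schedule b \<omega> 0 n = map (\<lambda>k. \<Sum>i\<le>k. fst (snd \<omega>) (n, i)) [0..<fst \<omega> n]"
  by (simp split: prod.split)

lemma schedule_Suc:
  "schedule b \<omega> (Suc j) =
     (let D = schedule b \<omega> j; t = arrival_time \<omega> j; n = target b \<omega> j in
      if enat (pending (D n) t) < b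
      then D(n := D n @ [(if D n = [] then t else max t (last (D n))) + snd (snd (snd (snd \<omega>) j))])
      else D)"
  by (simp add: assign_task_def target_def sampled_def Let_def split: prod.split)

lemma schedule_Suc_other:
  "target b \<omega> j \<noteq> n \<Longrightarrow> schedule b \<omega> (Suc j) n = schedule b \<omega> j n"
  by (simp add: schedule_Suc Let_def del: schedule.simps)

lemma schedule_not_hit:
  "(\<forall>i<j. target b \<omega> i \<noteq> n) \<Longrightarrow> schedule b \<omega> j n = schedule b \<omega> 0 n"
  by (induction j) (auto simp: schedule_Suc_other simp del: schedule.simps)

lemma arrival_time_cong:
  "(\<And>i. i \<le> j \<Longrightarrow> fst (snd (snd \<omega>) i) = fst (snd (snd \<omega>') i)) \<Longrightarrow>
   arrival_time \<omega> j = arrival_time \<omega>' j"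
  by (simp add: arrival_time_eq)

lemma schedule_cong:
  assumes "fst \<omega> = fst \<omega>'" "fst (snd \<omega>) = fst (snd \<omega>')"
    and "\<And>i. i < j \<Longrightarrow> snd (snd \<omega>) i = snd (snd \<omega>') i"
  shows "schedule b \<omega> j = schedule b \<omega>' j"
  using assms(3)
proof (induction j)
  case 0
  show ?case using assms(1,2) by (intro ext) (simp only: schedule_0)
next
  case (Suc j)
  have "schedule b \<omega> j = schedule b \<omega>' j" using Suc by simp
  moreover have "arrival_time \<omega> j = arrival_time \<omega>' j"
    using Suc.prems by (intro arrival_time_cong) simp
  moreover have "snd (snd \<omega>) j = snd (snd \<omega>') j" using Suc.prems by simp
  ultimately show ?case
    by (simp only: schedule_Suc target_def sampled_def)
qed

lemma target_in_sampled:
  assumes "finite (sampled \<omega> j)" "sampled \<omega> j \<noteq> {}"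
  shows "target b \<omega> j \<in> sampled \<omega> j"
  unfolding target_def by (rule arg_min_if_finite(1)[OF assms])

lemma reset_service_simps [simp]:
  "fst (reset_service n v \<omega>) = fst \<omega>" "snd (snd (reset_service n v \<omega>)) = snd (snd \<omega>)"
  "fst (snd (reset_service n v \<omega>)) = (fst (snd \<omega>))((n, 0) := v)"
  "arrival_time (reset_service n v \<omega>) j = arrival_time \<omega> j"
  "sampled (reset_service n v \<omega>) j = sampled \<omega> j"
  by (simp_all add: reset_service_def arrival_time_eq sampled_def)

lemma schedule_0_single: "fst \<omega> n = 1 \<Longrightarrow> schedule b \<omega> 0 n = [fst (snd \<omega>) (n, 0)]"
  by (simp add: schedule_0 del: schedule.simps)

text \<open>
  Departure times beyond the current time influence the dispatcher only through their number. So
  as long as server \<open>n\<close> has received nothing and its single initial task is pending under both the old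
  and the new service requirement, the change is invisible to the rest of the system.
\<close>

lemma schedule_reset_service:
  assumes one: "fst \<omega> n = 1"
    and "\<forall>i<j. target b \<omega> i \<noteq> n"
    and "\<forall>i<j. arrival_time \<omega> i < fst (snd \<omega>) (n, 0) \<and> arrival_time \<omega> i < v"
  shows "schedule b (reset_service n v \<omega>) j = (schedule b \<omega> j)(n := [v])"
  using assms(2,3)
proof (induction j)
  case 0
  show ?case
    by (intro ext) (auto simp: schedule_0 one simp del: schedule.simps)
next
  case (Suc j)
  let ?w = "reset_service n v \<omega>" and ?D = "schedule b \<omega> j" and ?t = "arrival_time \<omega> j"
  have IH: "schedule b ?w j = ?D(n := [v])" by (rule Suc.IH) (use Suc.prems in auto)
  have "?D n = [fst (snd \<omega>) (n, 0)]"
    using Suc.prems(1) schedule_not_hit[of j b \<omega> n] schedule_0_single[OF one] by simp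
  then have "(\<lambda>m. pending ((?D(n := [v])) m) ?t) = (\<lambda>m. pending (?D m) ?t)"
    using Suc.prems(2) by (auto simp: pending_def)
  then have tgt: "target b ?w j = target b \<omega> j"
    by (simp add: target_def IH)
  have "target b \<omega> j \<noteq> n" using Suc.prems(1) by simp
  then show ?case
    by (auto simp: schedule_Suc IH tgt Let_def fun_upd_twist simp del: schedule.simps)
qed

lemma target_reset_service:
  assumes one: "fst \<omega> n = 1"
    and "\<forall>i<j. target b \<omega> i \<noteq> n"
    and t: "\<forall>i\<le>j. arrival_time \<omega> i < fst (snd \<omega>) (n, 0) \<and> arrival_time \<omega> i < v"
  shows "target b (reset_service n v \<omega>) j = target b \<omega> j"
proof -
  let ?D = "schedule b \<omega> j" and ?t = "arrival_time \<omega> j"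
  have "schedule b (reset_service n v \<omega>) j = ?D(n := [v])"
    using assms by (intro schedule_reset_service) auto
  moreover have "?D n = [fst (snd \<omega>) (n, 0)]"
    using assms(2) schedule_not_hit[of j b \<omega> n] schedule_0_single[OF one] by simp
  moreover from this have "(\<lambda>m. pending ((?D(n := [v])) m) ?t) = (\<lambda>m. pending (?D m) ?t)"
    using t by (auto simp: pending_def)
  ultimately show ?thesis by (simp add: target_def)
qed

text \<open>
  Together with \<open>hit_reset_service\<close> this decouples the event that server \<open>n\<close> is chosen from its
  initial service requirement: prolonging the latter beyond \<open>T\<close> leaves the first assignment to \<open>n\<close>
  where it was.
\<close>

lemma rescued_reset_service:
  assumes pos: "\<forall>j. 0 < fst (snd (snd \<omega>) j)" and r: "rescued b a T \<omega> n" and v: "T < v"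
  shows "hit b a T (reset_service n v \<omega>) n"
proof -
  obtain j where j: "j < a" "target b \<omega> j = n" "\<forall>i<j. target b \<omega> i \<noteq> n"
      "arrival_time \<omega> j < fst (snd \<omega>) (n, 0)" and T: "fst (snd \<omega>) (n, 0) \<le> T" "fst \<omega> n = 1"
    using r unfolding rescued_def by blast
  have "arrival_time \<omega> i \<le> arrival_time \<omega> j" if "i \<le> j" for i
    using arrival_time_strict_mono[OF pos] that by (simp add: strict_mono_less_eq)
  then have "\<forall>i\<le>j. arrival_time \<omega> i < fst (snd \<omega>) (n, 0) \<and> arrival_time \<omega> i < v"
    using j(4) T v by fastforce
  with j(3) T have "target b (reset_service n v \<omega>) j = target b \<omega> j"
    by (intro target_reset_service) auto
  then show ?thesis
    unfolding hit_def using j T by (intro exI[of _ j]) auto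
qed

lemma hit_reset_service:
  assumes pos: "\<forall>j. 0 < fst (snd (snd \<omega>) j)" and one: "fst \<omega> n = 1"
    and h: "hit b a T \<omega> n" and T: "T < fst (snd \<omega>) (n, 0)" "T < v"
  shows "hit b a T (reset_service n v \<omega>) n"
proof -
  obtain j' where j': "j' < a" "arrival_time \<omega> j' \<le> T" "target b \<omega> j' = n"
    using h unfolding hit_def by blast
  define j where "j = (LEAST j. target b \<omega> j = n)"
  have j: "target b \<omega> j = n" "j \<le> j'" "\<forall>i<j. target b \<omega> i \<noteq> n"
    unfolding j_def using j'(3) by (auto intro: LeastI Least_le dest: not_less_Least)
  have mono: "arrival_time \<omega> i \<le> arrival_time \<omega> j'" if "i \<le> j" for i
    using arrival_time_strict_mono[OF pos] that j(2) by (simp add: strict_mono_less_eq)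
  then have "\<forall>i\<le>j. arrival_time \<omega> i < fst (snd \<omega>) (n, 0) \<and> arrival_time \<omega> i < v"
    using j'(2) T by fastforce
  with j(3) have "target b (reset_service n v \<omega>) j = target b \<omega> j"
    by (intro target_reset_service one) auto
  then show ?thesis
    unfolding hit_def using j j' mono[of j] by (intro exI[of _ j]) auto
qed

lemma card_arrivals:
  assumes pos: "\<forall>j. 0 < fst (snd (snd \<omega>) j)" and T: "T < arrival_time \<omega> a"
  shows "{j. arrival_time \<omega> j \<le> T} = {..<card {j. arrival_time \<omega> j \<le> T}}"
proof -
  let ?S = "{j. arrival_time \<omega> j \<le> T}"
  note sm = arrival_time_strict_mono[OF pos]
  define A where "A = (LEAST j. T < arrival_time \<omega> j)"
  have "T < arrival_time \<omega> A" unfolding A_def using T by (rule LeastI)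
  then have "?S \<subseteq> {..<A}"
    using strict_mono_less[OF sm] by (auto intro: ccontr dest: order.strict_trans1)
  moreover have "{..<A} \<subseteq> ?S"
    unfolding A_def using not_less_Least by fastforce
  ultimately have "?S = {..<A}" by blast
  then show ?thesis by simp
qed

text \<open>
  The hypothesis on the window concerns the state just after an arrival, the dispatcher sees the
  state just before it. An assignment changes one server only, whence the \<open>Suc\<close>.
\<close>

lemma idle_before_le_idle_after:
  assumes pos: "\<forall>j. 0 < fst (snd (snd \<omega>) j)"
  shows "card (idle_before b N \<omega> j)
    \<le> Suc (card {n. n < N \<and> queue_length b \<omega> (arrival_time \<omega> j) n = 0})"
proof -
  note sm = arrival_time_strict_mono[OF pos]
  have "{i. arrival_time \<omega> i \<le> arrival_time \<omega> j} = {..j}"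
    using strict_mono_less_eq[OF sm] by auto
  then have q: "queue_length b \<omega> (arrival_time \<omega> j) n
      = pending (schedule b \<omega> (Suc j) n) (arrival_time \<omega> j)" for n
    by (simp add: queue_length_def)
  have "idle_before b N \<omega> j
      \<subseteq> insert (target b \<omega> j) {n. n < N \<and> queue_length b \<omega> (arrival_time \<omega> j) n = 0}"
    unfolding q idle_before_def
    by (auto simp: schedule_Suc_other simp del: schedule.simps)
  then have "card (idle_before b N \<omega> j)
      \<le> card (insert (target b \<omega> j) {n. n < N \<and> queue_length b \<omega> (arrival_time \<omega> j) n = 0})"
    by (intro card_mono) auto
  also have "\<dots> \<le> Suc (card {n. n < N \<and> queue_length b \<omega> (arrival_time \<omega> j) n = 0})"
    by (rule card_insert_le_m1) auto
  finally show ?thesis .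
qed

text \<open>
  A server that started with at most one task and is busy at \<open>T\<close> either still has its initial task
  or was assigned a task; consider the first one. If it found the server idle, the second to last set
  applies, and if it found the server busy, the server was rescued.
\<close>

lemma busy_servers_subset:
  assumes pos: "\<forall>j. 0 < fst (snd (snd \<omega>) j)"
    and S: "\<forall>j. sampled \<omega> j \<subseteq> {..<N} \<and> sampled \<omega> j \<noteq> {}"
    and ta: "T < arrival_time \<omega> a"
  defines "A \<equiv> card {j. arrival_time \<omega> j \<le> T}"
  shows "{n. n < N \<and> queue_length b \<omega> T n \<noteq> 0}
    \<subseteq> {n. n < N \<and> 2 \<le> fst \<omega> n} \<union> {n. n < N \<and> T < fst (snd \<omega>) (n, 0)}
      \<union> target b \<omega> ` {j. j < A \<and> target b \<omega> j \<in> idle_before b N \<omega> j}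
      \<union> {n. n < N \<and> rescued b a T \<omega> n}"
proof (rule subsetI, rule ccontr)
  fix n assume "n \<in> {n. n < N \<and> queue_length b \<omega> T n \<noteq> 0}" and "n \<notin> {n. n < N \<and> 2 \<le> fst \<omega> n}
      \<union> {n. n < N \<and> T < fst (snd \<omega>) (n, 0)}
      \<union> target b \<omega> ` {j. j < A \<and> target b \<omega> j \<in> idle_before b N \<omega> j}
      \<union> {n. n < N \<and> rescued b a T \<omega> n}"
  then have n: "n < N" and busy: "queue_length b \<omega> T n \<noteq> 0"
    and nr: "\<not> rescued b a T \<omega> n"
    and ni: "n \<notin> target b \<omega> ` {j. j < A \<and> target b \<omega> j \<in> idle_before b N \<omega> j}"
    and ns: "\<not> T < fst (snd \<omega>) (n, 0)" and two: "\<not> 2 \<le> fst \<omega> n"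
    by auto
  have arr: "{j. arrival_time \<omega> j \<le> T} = {..<A}"
    unfolding A_def by (rule card_arrivals[OF pos ta])
  have "A \<le> a" using arr ta by (metis lessThan_iff mem_Collect_eq not_le)
  from two consider "fst \<omega> n = 0" | "fst \<omega> n = 1" by linarith
  then have ini: "schedule b \<omega> 0 n = [] \<or>
      (fst \<omega> n = 1 \<and> schedule b \<omega> 0 n = [fst (snd \<omega>) (n, 0)])"
    by cases (simp_all add: schedule_0_single schedule_0 del: schedule.simps)
  have q: "queue_length b \<omega> T n = pending (schedule b \<omega> A n) T"
    by (simp add: queue_length_def A_def)
  show False
  proof (cases "\<exists>j<A. target b \<omega> j = n")
    case False
    then have "schedule b \<omega> A n = schedule b \<omega> 0 n" by (intro schedule_not_hit) auto
    with ini ns busy q show False by (auto simp: pending_def simp del: schedule.simps)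
  next
    case True
    define j where "j = (LEAST j. target b \<omega> j = n)"
    from True have j: "target b \<omega> j = n" "j < A" "\<forall>i<j. target b \<omega> i \<noteq> n"
      unfolding j_def by (auto intro: LeastI le_less_trans[OF Least_le] dest: not_less_Least)
    have sch: "schedule b \<omega> j n = schedule b \<omega> 0 n" by (intro schedule_not_hit j(3))
    have "n \<notin> idle_before b N \<omega> j" using ni j by blast
    then have "pending (schedule b \<omega> 0 n) (arrival_time \<omega> j) \<noteq> 0"
      using n sch by (simp add: idle_before_def del: schedule.simps)
    then have "fst \<omega> n = 1" "arrival_time \<omega> j < fst (snd \<omega>) (n, 0)"
      using ini by (auto simp: pending_def simp del: schedule.simps split: if_splits)
    then have "rescued b a T \<omega> n"
      unfolding rescued_def using j ns \<open>A \<le> a\<close> by (intro conjI exI[of _ j]) auto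
    with nr show False by simp
  qed
qed

text \<open>
  The balance described at the beginning. The number of assignments to idle servers is at most \<open>a\<close>
  minus the number of arrivals among the first \<open>m\<close> that sample no idle server. As \<open>a\<close> and the number of
  services exceeding \<open>T\<close> add up to about \<open>N\<close>, the second claim limits the number of such arrivals.
\<close>

lemma few_idle_bound:
  assumes pos: "\<forall>j. 0 < fst (snd (snd \<omega>) j)"
    and S: "\<forall>j. sampled \<omega> j \<subseteq> {..<N} \<and> sampled \<omega> j \<noteq> {}"
    and T: "0 \<le> T" and tm: "\<forall>j<m. arrival_time \<omega> j \<le> T" and ta: "T < arrival_time \<omega> a"
    and few: "\<forall>t. 0 \<le> t \<and> t \<le> T \<longrightarrow> card {n. n < N \<and> queue_length b \<omega> t n = 0} < k"
  shows "\<forall>j<m. card (idle_before b N \<omega> j) \<le> k"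
    and "N + card {j. j < m \<and> sampled \<omega> j \<inter> idle_before b N \<omega> j = {}}
      \<le> k + a + card {n. n < N \<and> 2 \<le> fst \<omega> n} + card {n. n < N \<and> T < fst (snd \<omega>) (n, 0)}
          + card {n. n < N \<and> rescued b a T \<omega> n}"
proof -
  show "\<forall>j<m. card (idle_before b N \<omega> j) \<le> k"
  proof (intro allI impI)
    fix j assume "j < m"
    have "card (idle_before b N \<omega> j)
        \<le> Suc (card {n. n < N \<and> queue_length b \<omega> (arrival_time \<omega> j) n = 0})"
      by (rule idle_before_le_idle_after[OF pos])
    also have "\<dots> \<le> k"
      using few tm \<open>j < m\<close> arrival_time_pos[OF pos, of j] by (intro Suc_leI) auto
    finally show "card (idle_before b N \<omega> j) \<le> k" .
  qed
  define A where "A = card {j. arrival_time \<omega> j \<le> T}"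
  have arr: "{j. arrival_time \<omega> j \<le> T} = {..<A}"
    unfolding A_def by (rule card_arrivals[OF pos ta])
  have Aa: "A \<le> a" using arr ta by (metis lessThan_iff mem_Collect_eq not_le)
  have mA: "m \<le> A" using arr tm by (metis lessThan_iff mem_Collect_eq not_le order.irrefl)
  let ?Z = "{j. j < m \<and> sampled \<omega> j \<inter> idle_before b N \<omega> j = {}}"
  let ?I = "{j. j < A \<and> target b \<omega> j \<in> idle_before b N \<omega> j}"
  have "target b \<omega> j \<in> sampled \<omega> j" for j
    using S by (intro target_in_sampled) (auto intro: finite_subset)
  then have "?I \<subseteq> {..<A} - ?Z" by blast
  then have "card ?I \<le> card ({..<A} - ?Z)" by (intro card_mono) auto
  also have "\<dots> = A - card ?Z" using mA by (subst card_Diff_subset) auto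
  finally have "card ?I \<le> A - card ?Z" .
  moreover have "card ?Z \<le> A" using mA card_mono[of "{..<A}" ?Z] by force
  ultimately have I: "card ?I + card ?Z \<le> a" using Aa by linarith
  have "N = card ({n. n < N \<and> queue_length b \<omega> T n \<noteq> 0} \<union> {n. n < N \<and> queue_length b \<omega> T n = 0})"
    by (subst card_lessThan[symmetric], rule arg_cong[where f = card]) auto
  also have "\<dots> \<le> card {n. n < N \<and> queue_length b \<omega> T n \<noteq> 0} + card {n. n < N \<and> queue_length b \<omega> T n = 0}"
    by (rule card_Un_le)
  also have "\<dots> \<le> card {n. n < N \<and> queue_length b \<omega> T n \<noteq> 0} + k"
    using few T by (simp add: less_imp_le)
  also have "card {n. n < N \<and> queue_length b \<omega> T n \<noteq> 0} \<le> card ({n. n < N \<and> 2 \<le> fst \<omega> n}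
      \<union> {n. n < N \<and> T < fst (snd \<omega>) (n, 0)} \<union> target b \<omega> ` ?I \<union> {n. n < N \<and> rescued b a T \<omega> n})"
    by (rule card_mono) (use busy_servers_subset[OF pos S ta, of b] in \<open>auto simp: A_def\<close>)
  also have "\<dots> \<le> card {n. n < N \<and> 2 \<le> fst \<omega> n} + card {n. n < N \<and> T < fst (snd \<omega>) (n, 0)}
      + card ?I + card {n. n < N \<and> rescued b a T \<omega> n}"
    by (intro order.trans[OF card_Un_le] add_mono card_image_le order.refl) auto
  finally show "N + card ?Z
      \<le> k + a + card {n. n < N \<and> 2 \<le> fst \<omega> n} + card {n. n < N \<and> T < fst (snd \<omega>) (n, 0)}
          + card {n. n < N \<and> rescued b a T \<omega> n}"
    using I by linarith
qed

section \<open>Measurability of the schedule\<close>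

lemma arg_min_on_cong:
  assumes "\<And>x. x \<in> S \<Longrightarrow> f x = g x"
  shows "arg_min_on f S = arg_min_on g S"
proof -
  have "is_arg_min f (\<lambda>x. x \<in> S) = is_arg_min g (\<lambda>x. x \<in> S)"
    using assms by (auto simp: is_arg_min_def fun_eq_iff)
  then show ?thesis by (simp add: arg_min_on_def arg_min_def)
qed

lemma measurable_map_upt:
  fixes f :: "'w \<Rightarrow> nat \<Rightarrow> nat"
  assumes f: "\<And>n. (\<lambda>w. f w n) \<in> M \<rightarrow>\<^sub>M count_space UNIV"
  shows "(\<lambda>w. map (f w) [0..<N]) \<in> M \<rightarrow>\<^sub>M count_space UNIV"
proof (induction N)
  case (Suc N)
  have "(\<lambda>w. l @ [f w N]) \<in> M \<rightarrow>\<^sub>M count_space UNIV" for l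
    by (rule measurable_compose[OF f]) simp
  from measurable_compose_countable[OF this Suc.IH] show ?case by simp
qed simp

text \<open>
  The tie-breaking rule is arbitrary, so measurability cannot come from an explicit formula. But on
  subsets of \<open>{..<N}\<close> the minimizer is a function of a list of \<open>N\<close> natural numbers, and such lists
  are countable.
\<close>

lemma measurable_arg_min_on:
  fixes f :: "'w \<Rightarrow> nat \<Rightarrow> nat" and S :: "'w \<Rightarrow> nat set"
  assumes f: "\<And>n. (\<lambda>w. f w n) \<in> M \<rightarrow>\<^sub>M count_space UNIV"
    and S: "S \<in> M \<rightarrow>\<^sub>M count_space (Pow {..<N})"
  shows "(\<lambda>w. arg_min_on (f w) (S w)) \<in> M \<rightarrow>\<^sub>M count_space UNIV"
proof (rule measurable_compose_countable'[OF _ S])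
  fix A :: "nat set" assume A: "A \<in> Pow {..<N}"
  have "arg_min_on (f w) A = arg_min_on (\<lambda>n. map (f w) [0..<N] ! n) A" for w
    using A by (intro arg_min_on_cong) auto
  moreover have "(\<lambda>w. arg_min_on (\<lambda>n. map (f w) [0..<N] ! n) A) \<in> M \<rightarrow>\<^sub>M count_space UNIV"
    by (rule measurable_compose[OF measurable_map_upt[OF f]]) simp
  ultimately show "(\<lambda>w. arg_min_on (f w) A) \<in> M \<rightarrow>\<^sub>M count_space UNIV" by simp
qed (auto intro: countable_finite)

text \<open>
  The only features of a backlog that the dynamics use. With this predicate no \<open>\<sigma>\<close>-algebra on lists
  is needed; pending counts are measurable jointly in the sample and the time because they are evaluated
  at random arrival times.
\<close>

definition measurable_backlog :: "'w measure \<Rightarrow> ('w \<Rightarrow> real list) \<Rightarrow> bool" where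
  "measurable_backlog M D \<longleftrightarrow>
     (\<lambda>p. pending (D (fst p)) (snd p)) \<in> M \<Otimes>\<^sub>M borel \<rightarrow>\<^sub>M count_space UNIV
     \<and> Measurable.pred M (\<lambda>w. D w = [])
     \<and> (\<lambda>w. last (D w)) \<in> borel_measurable M"

lemma measurable_backlog_pending:
  assumes "measurable_backlog M D" and "f \<in> borel_measurable M"
  shows "(\<lambda>w. pending (D w) (f w)) \<in> M \<rightarrow>\<^sub>M count_space UNIV"
proof -
  have "(\<lambda>w. (w, f w)) \<in> M \<rightarrow>\<^sub>M M \<Otimes>\<^sub>M borel" using assms(2) by measurable
  from measurable_compose[OF this, of "\<lambda>p. pending (D (fst p)) (snd p)"] assms(1)
  show ?thesis by (simp add: measurable_backlog_def)
qed

lemma measurable_backlog_Nil: "measurable_backlog M (\<lambda>w. [])"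
  by (simp add: measurable_backlog_def pending_def)

lemma measurable_backlog_snoc:
  assumes D: "measurable_backlog M D" and v[measurable]: "v \<in> borel_measurable M"
  shows "measurable_backlog M (\<lambda>w. D w @ [v w])"
proof -
  have [measurable]: "(\<lambda>p. pending (D (fst p)) (snd p)) \<in> M \<Otimes>\<^sub>M borel \<rightarrow>\<^sub>M count_space UNIV"
    using D by (simp add: measurable_backlog_def)
  have "(\<lambda>p. pending (D (fst p) @ [v (fst p)]) (snd p))
      = (\<lambda>p. pending (D (fst p)) (snd p) + (if snd p < v (fst p) then 1 else 0))"
    by (auto simp: pending_def)
  also have "\<dots> \<in> M \<Otimes>\<^sub>M borel \<rightarrow>\<^sub>M count_space UNIV"
    by measurable
  finally show ?thesis
    unfolding measurable_backlog_def using v by simp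
qed

lemma measurable_backlog_if:
  assumes P[measurable]: "Measurable.pred M P"
    and D: "measurable_backlog M D" and E: "measurable_backlog M E"
  shows "measurable_backlog M (\<lambda>w. if P w then D w else E w)"
proof -
  have [measurable]:
    "(\<lambda>p. pending (D (fst p)) (snd p)) \<in> M \<Otimes>\<^sub>M borel \<rightarrow>\<^sub>M count_space UNIV"
    "(\<lambda>p. pending (E (fst p)) (snd p)) \<in> M \<Otimes>\<^sub>M borel \<rightarrow>\<^sub>M count_space UNIV"
    "Measurable.pred M (\<lambda>w. D w = [])" "Measurable.pred M (\<lambda>w. E w = [])"
    "(\<lambda>w. last (D w)) \<in> borel_measurable M" "(\<lambda>w. last (E w)) \<in> borel_measurable M"
    using D E by (simp_all add: measurable_backlog_def)
  have *: "(\<lambda>p. pending (if P (fst p) then D (fst p) else E (fst p)) (snd p))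
      = (\<lambda>p. if P (fst p) then pending (D (fst p)) (snd p) else pending (E (fst p)) (snd p))"
    "(\<lambda>w. (if P w then D w else E w) = []) = (\<lambda>w. if P w then D w = [] else E w = [])"
    "(\<lambda>w. last (if P w then D w else E w)) = (\<lambda>w. if P w then last (D w) else last (E w))"
    by auto
  show ?thesis
    unfolding measurable_backlog_def
  proof (intro conjI)
    show "(\<lambda>p. pending (if P (fst p) then D (fst p) else E (fst p)) (snd p))
        \<in> M \<Otimes>\<^sub>M borel \<rightarrow>\<^sub>M count_space UNIV"
      unfolding *(1) by measurable
    show "Measurable.pred M (\<lambda>w. (if P w then D w else E w) = [])"
      unfolding *(2) by measurable
    show "(\<lambda>w. last (if P w then D w else E w)) \<in> borel_measurable M"
      unfolding *(3) by measurable
  qed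
qed

lemma measurable_backlog_countable:
  fixes D :: "'i::countable \<Rightarrow> 'w \<Rightarrow> real list"
  assumes D: "\<And>i. measurable_backlog M (D i)" and g[measurable]: "g \<in> M \<rightarrow>\<^sub>M count_space UNIV"
  shows "measurable_backlog M (\<lambda>w. D (g w) w)"
proof -
  have [measurable]:
    "\<And>i. (\<lambda>p. pending (D i (fst p)) (snd p)) \<in> M \<Otimes>\<^sub>M borel \<rightarrow>\<^sub>M count_space UNIV"
    "\<And>i. Measurable.pred M (\<lambda>w. D i w = [])"
    "\<And>i. (\<lambda>w. last (D i w)) \<in> borel_measurable M"
    using D by (simp_all add: measurable_backlog_def)
  show ?thesis
    unfolding measurable_backlog_def
  proof (intro conjI)
    show "(\<lambda>p. pending (D (g (fst p)) (fst p)) (snd p)) \<in> M \<Otimes>\<^sub>M borel \<rightarrow>\<^sub>M count_space UNIV"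
      by (rule measurable_compose_countable[where g = "\<lambda>p. g (fst p)"]) measurable
    show "Measurable.pred M (\<lambda>w. D (g w) w = [])"
      by (rule measurable_compose_countable[where g = g]) measurable
    show "(\<lambda>w. last (D (g w) w)) \<in> borel_measurable M"
      by (rule measurable_compose_countable[where g = g]) measurable
  qed
qed

text \<open>
  The schedule is needed as a function of all primitives and as a function of some of them with the
  others fixed; \<open>f\<close> covers both. Sampled sets are confined to the finite set \<open>Pow {..<N}\<close> since
  evaluating an expression at a random element of an uncountable discrete space need not be measurable.
\<close>

locale measurable_sample =
  fixes M :: "'w measure" and N :: nat and f :: "'w \<Rightarrow> sample"
  assumes initial: "\<And>n. (\<lambda>w. fst (f w) n) \<in> M \<rightarrow>\<^sub>M count_space UNIV"
    and initial_service: "\<And>p. (\<lambda>w. fst (snd (f w)) p) \<in> borel_measurable M"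
    and interarrival: "\<And>j. (\<lambda>w. fst (snd (snd (f w)) j)) \<in> borel_measurable M"
    and selection: "\<And>j. (\<lambda>w. sampled (f w) j) \<in> M \<rightarrow>\<^sub>M count_space (Pow {..<N})"
    and service: "\<And>j. (\<lambda>w. snd (snd (snd (snd (f w)) j))) \<in> borel_measurable M"
begin

lemma arrival_time_measurable: "(\<lambda>w. arrival_time (f w) j) \<in> borel_measurable M"
  unfolding arrival_time_eq using interarrival by (intro borel_measurable_sum) auto

lemma target_measurable:
  assumes "\<And>n. measurable_backlog M (\<lambda>w. schedule b (f w) j n)"
  shows "(\<lambda>w. target b (f w) j) \<in> M \<rightarrow>\<^sub>M count_space UNIV"
  unfolding target_def
  by (intro measurable_arg_min_on[where N = N] measurable_backlog_pending assms
      arrival_time_measurable selection)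

lemma schedule_measurable: "measurable_backlog M (\<lambda>w. schedule b (f w) j n)"
proof (induction j arbitrary: n)
  case 0
  have "measurable_backlog M (\<lambda>w. map (\<lambda>k. \<Sum>i\<le>k. fst (snd (f w)) (n, i)) [0..<m])" for m
    by (induction m)
      (auto intro!: measurable_backlog_Nil measurable_backlog_snoc borel_measurable_sum initial_service)
  then show ?case
    unfolding schedule_0 by (rule measurable_backlog_countable[OF _ initial])
next
  case (Suc j)
  let ?D = "\<lambda>n w. schedule b (f w) j n" and ?t = "\<lambda>w. arrival_time (f w) j"
  note t = arrival_time_measurable[of j]
  have tgt[measurable]: "(\<lambda>w. target b (f w) j) \<in> M \<rightarrow>\<^sub>M count_space UNIV"
    by (rule target_measurable[OF Suc.IH])
  have pend[measurable]: "(\<lambda>w. pending (?D n w) (?t w)) \<in> M \<rightarrow>\<^sub>M count_space UNIV" for n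
    by (rule measurable_backlog_pending[OF Suc.IH t])
  have [measurable]: "Measurable.pred M (\<lambda>w. ?D n w = [])" "(\<lambda>w. last (?D n w)) \<in> borel_measurable M" for n
    using Suc.IH[of n] by (simp_all add: measurable_backlog_def)
  note [measurable] = t service
  have "schedule b (f w) (Suc j) n =
     (if target b (f w) j = n \<and> enat (pending (?D n w) (?t w)) < b
      then ?D n w @ [(if ?D n w = [] then ?t w else max (?t w) (last (?D n w)))
             + snd (snd (snd (snd (f w)) j))]
      else ?D n w)" for w
    by (auto simp: schedule_Suc Let_def simp del: schedule.simps)
  moreover have "measurable_backlog M (\<lambda>w.
     if target b (f w) j = n \<and> enat (pending (?D n w) (?t w)) < b
      then ?D n w @ [(if ?D n w = [] then ?t w else max (?t w) (last (?D n w)))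
             + snd (snd (snd (snd (f w)) j))]
      else ?D n w)"
    by (intro measurable_backlog_if measurable_backlog_snoc Suc.IH) measurable
  ultimately show ?case by (simp del: schedule.simps)
qed

lemma pending_schedule_measurable:
  "g \<in> borel_measurable M \<Longrightarrow> (\<lambda>w. pending (schedule b (f w) j n) (g w)) \<in> M \<rightarrow>\<^sub>M count_space UNIV"
  by (rule measurable_backlog_pending[OF schedule_measurable])

lemmas target_measurable' = target_measurable[OF schedule_measurable]

lemma queue_length_measurable: "(\<lambda>w. queue_length b (f w) t n) \<in> M \<rightarrow>\<^sub>M count_space UNIV"
proof -
  note [measurable] = arrival_time_measurable
  have "(\<lambda>w. card {j. arrival_time (f w) j \<le> t}) \<in> M \<rightarrow>\<^sub>M count_space UNIV"
    by measurable
  then show ?thesis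
    unfolding queue_length_def
    by (rule measurable_compose_countable[rotated]) (intro pending_schedule_measurable, simp)
qed

lemma idle_before_measurable:
  "(\<lambda>w. idle_before b N (f w) j) \<in> M \<rightarrow>\<^sub>M count_space (Pow {..<N})"
proof (rule measurable_count_space_eq2[THEN iffD2], simp, safe)
  fix A assume "A \<subseteq> {..<N}"
  note [measurable] = pending_schedule_measurable[OF arrival_time_measurable]
  have "(\<lambda>w. idle_before b N (f w) j) -` {A} \<inter> space M
      = {w \<in> space M. \<forall>n\<in>UNIV. n \<in> A \<longleftrightarrow> n < N \<and> pending (schedule b (f w) j n) (arrival_time (f w) j) = 0}"
    by (auto simp: idle_before_def simp del: schedule.simps)
  also have "\<dots> \<in> sets M" by measurable
  finally show "(\<lambda>w. idle_before b N (f w) j) -` {A} \<inter> space M \<in> sets M" .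
qed (auto simp: idle_before_def)

lemma hit_measurable: "Measurable.pred M (\<lambda>w. hit b a T (f w) n)"
proof -
  note [measurable] = arrival_time_measurable target_measurable'
  show ?thesis unfolding hit_def by measurable
qed

lemma rescued_measurable: "Measurable.pred M (\<lambda>w. rescued b a T (f w) n)"
proof -
  note [measurable] = arrival_time_measurable target_measurable' initial initial_service
  show ?thesis unfolding rescued_def by measurable
qed

end

section \<open>The probability space of the primitives\<close>

lemma prob_space_exponential: "0 < l \<Longrightarrow> prob_space (exponential l)"
  unfolding exponential_def by (rule prob_space_exponential_density)

lemma sets_exponential [measurable_cong, simp]: "sets (exponential l) = sets borel"
  by (simp add: exponential_def)

lemma space_exponential [simp]: "space (exponential l) = UNIV"
  by (simp add: exponential_def)

definition service_space :: "(nat \<times> nat \<Rightarrow> real) measure" where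
  "service_space = (\<Pi>\<^sub>M p\<in>UNIV. exponential 1)"

definition task_law :: "nat \<Rightarrow> real \<Rightarrow> nat \<Rightarrow> (real \<times> nat set \<times> real) measure" where
  "task_law N l d =
     exponential l \<Otimes>\<^sub>M measure_pmf (uniform_selection N d) \<Otimes>\<^sub>M exponential 1"

definition task_space :: "nat \<Rightarrow> real \<Rightarrow> nat \<Rightarrow> (nat \<Rightarrow> real \<times> nat set \<times> real) measure" where
  "task_space N l d = (\<Pi>\<^sub>M j\<in>UNIV. task_law N l d)"

lemma jsq_space_eq:
  "jsq_space N l d init = measure_pmf init \<Otimes>\<^sub>M service_space \<Otimes>\<^sub>M task_space N l d"
  by (simp add: jsq_space_def service_space_def task_space_def task_law_def)

lemma prob_space_service: "prob_space service_space"
  unfolding service_space_def by (intro prob_space_PiM prob_space_exponential) simp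

lemma prob_space_task_law: "0 < l \<Longrightarrow> prob_space (task_law N l d)"
  unfolding task_law_def
  by (intro prob_space_pair prob_space_exponential prob_space_measure_pmf) auto

lemma prob_space_task: "0 < l \<Longrightarrow> prob_space (task_space N l d)"
  unfolding task_space_def by (intro prob_space_PiM prob_space_task_law)

lemma prob_space_jsq: "0 < l \<Longrightarrow> prob_space (jsq_space N l d init)"
  unfolding jsq_space_eq
  by (intro prob_space_pair prob_space_service prob_space_task prob_space_measure_pmf)

lemma space_task_law [simp]: "space (task_law N l d) = UNIV"
  by (simp add: task_law_def space_pair_measure)

lemma space_service [simp]: "space service_space = UNIV"
  by (simp add: service_space_def space_PiM)

lemma space_task [simp]: "space (task_space N l d) = UNIV"
  by (simp add: task_space_def space_PiM)

lemma space_jsq [simp]: "space (jsq_space N l d init) = UNIV"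
  by (simp add: jsq_space_eq space_pair_measure)

lemma service_component [measurable]: "(\<lambda>s. s p) \<in> borel_measurable service_space"
  unfolding service_space_def
  by (rule measurable_compose[OF measurable_component_singleton[of p]]) auto

lemma task_component: "(\<lambda>w. w j) \<in> task_space N l d \<rightarrow>\<^sub>M task_law N l d"
  unfolding task_space_def by simp

lemma interarrival_component [measurable]: "(\<lambda>w. fst (w j)) \<in> borel_measurable (task_space N l d)"
  by (rule measurable_compose[OF task_component]) (simp add: task_law_def)

lemma selection_component [measurable]:
  "(\<lambda>w. fst (snd (w j))) \<in> task_space N l d \<rightarrow>\<^sub>M count_space UNIV"
  by (rule measurable_compose[OF task_component]) (simp add: task_law_def, measurable)

lemma task_service_component [measurable]:
  "(\<lambda>w. snd (snd (w j))) \<in> borel_measurable (task_space N l d)"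
  by (rule measurable_compose[OF task_component]) (simp add: task_law_def)

text \<open>
  Under \<open>jsq_space\<close> the sampled sets are contained in \<open>{..<N}\<close> only almost surely. Cutting them
  off makes \<open>measurable_sample\<close> applicable and changes the sample on a null set only.
\<close>

definition clean :: "nat \<Rightarrow> sample \<Rightarrow> sample" where
  "clean N \<omega> = (fst \<omega>, fst (snd \<omega>), \<lambda>j. (fst (snd (snd \<omega>) j),
     fst (snd (snd (snd \<omega>) j)) \<inter> {..<N}, snd (snd (snd (snd \<omega>) j))))"

lemma clean_simps [simp]:
  "fst (clean N \<omega>) = fst \<omega>" "fst (snd (clean N \<omega>)) = fst (snd \<omega>)"
  "fst (snd (snd (clean N \<omega>)) j) = fst (snd (snd \<omega>) j)"
  "snd (snd (snd (snd (clean N \<omega>)) j)) = snd (snd (snd (snd \<omega>) j))"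
  "sampled (clean N \<omega>) j = sampled \<omega> j \<inter> {..<N}"
  by (simp_all add: clean_def sampled_def)

lemma measurable_sample_clean:
  assumes "\<And>n. (\<lambda>w. fst (f w) n) \<in> M \<rightarrow>\<^sub>M count_space UNIV"
    and "(\<lambda>w. fst (snd (f w))) \<in> M \<rightarrow>\<^sub>M service_space"
    and task: "(\<lambda>w. snd (snd (f w))) \<in> M \<rightarrow>\<^sub>M task_space N' l d"
  shows "measurable_sample M N (\<lambda>w. clean N (f w))"
proof
  fix j
  show "(\<lambda>w. sampled (clean N (f w)) j) \<in> M \<rightarrow>\<^sub>M count_space (Pow {..<N})"
    unfolding clean_simps unfolding sampled_def
    by (rule measurable_compose[OF task measurable_compose[OF selection_component]]) auto
  show "(\<lambda>w. fst (snd (snd (clean N (f w))) j)) \<in> borel_measurable M"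
    using measurable_compose[OF task interarrival_component] by simp
  show "(\<lambda>w. snd (snd (snd (snd (clean N (f w))) j))) \<in> borel_measurable M"
    using measurable_compose[OF task task_service_component] by simp
next
  fix p
  show "(\<lambda>w. fst (snd (clean N (f w))) p) \<in> borel_measurable M"
    using measurable_compose[OF assms(2) service_component] by simp
qed (use assms(1) in simp)

lemma measurable_sample_jsq: "measurable_sample (jsq_space N' l d init) N (clean N)"
proof -
  have "(\<lambda>\<omega>. fst \<omega> n) \<in> jsq_space N' l d init \<rightarrow>\<^sub>M count_space UNIV" for n
    unfolding jsq_space_eq
    by (rule measurable_compose[OF measurable_fst]) simp
  moreover have "(\<lambda>\<omega>. fst (snd \<omega>)) \<in> jsq_space N' l d init \<rightarrow>\<^sub>M service_space"
    "(\<lambda>\<omega>. snd (snd \<omega>)) \<in> jsq_space N' l d init \<rightarrow>\<^sub>M task_space N' l d"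
    unfolding jsq_space_eq by measurable
  ultimately have "measurable_sample (jsq_space N' l d init) N (\<lambda>\<omega>. clean N \<omega>)"
    by (rule measurable_sample_clean)
  then show ?thesis by simp
qed

text \<open>
  This bound and \<open>nn_integral_jsq_le_service\<close> allow a random quantity to be estimated with all but
  one group of primitives fixed.
\<close>

lemma nn_integral_jsq_le_task:
  assumes f: "f \<in> borel_measurable (jsq_space N l d init)" and l: "0 < l"
    and bound: "\<And>x0 s0. (\<integral>\<^sup>+ task. f (x0, s0, task) \<partial>task_space N l d) \<le> c"
  shows "(\<integral>\<^sup>+ \<omega>. f \<omega> \<partial>jsq_space N l d init) \<le> c"
proof -
  interpret S: prob_space service_space by (rule prob_space_service)
  interpret T: prob_space "task_space N l d" by (rule prob_space_task[OF l])
  interpret ST: pair_prob_space service_space "task_space N l d" ..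
  have f': "f \<in> borel_measurable (measure_pmf init \<Otimes>\<^sub>M service_space \<Otimes>\<^sub>M task_space N l d)"
    using f by (simp add: jsq_space_eq)
  have fx: "(\<lambda>p. f (x0, p)) \<in> borel_measurable (service_space \<Otimes>\<^sub>M task_space N l d)" for x0
    by (rule measurable_compose[OF measurable_Pair1' f']) simp
  have "(\<integral>\<^sup>+ \<omega>. f \<omega> \<partial>jsq_space N l d init)
      = (\<integral>\<^sup>+ x0. \<integral>\<^sup>+ p. f (x0, p) \<partial>(service_space \<Otimes>\<^sub>M task_space N l d) \<partial>measure_pmf init)"
    unfolding jsq_space_eq by (rule ST.P.nn_integral_fst[symmetric, OF f'])
  also have "\<dots> = (\<integral>\<^sup>+ x0. \<integral>\<^sup>+ s0. \<integral>\<^sup>+ task. f (x0, s0, task) \<partial>task_space N l d \<partial>service_space \<partial>measure_pmf init)"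
    by (intro nn_integral_cong T.nn_integral_fst[symmetric] fx)
  also have "\<dots> \<le> (\<integral>\<^sup>+ x0. \<integral>\<^sup>+ s0. c \<partial>service_space \<partial>measure_pmf init)"
    by (intro nn_integral_mono bound)
  also have "\<dots> = c"
    by (simp add: S.emeasure_space_1 measure_pmf.emeasure_space_1 del: space_service)
  finally show ?thesis .
qed

lemma nn_integral_jsq_le_service:
  assumes f: "f \<in> borel_measurable (jsq_space N l d init)" and l: "0 < l"
    and bound: "\<And>x0. AE task in task_space N l d. (\<integral>\<^sup>+ s0. f (x0, s0, task) \<partial>service_space) \<le> c"
  shows "(\<integral>\<^sup>+ \<omega>. f \<omega> \<partial>jsq_space N l d init) \<le> c"
proof -
  interpret S: prob_space service_space by (rule prob_space_service)
  interpret T: prob_space "task_space N l d" by (rule prob_space_task[OF l])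
  interpret ST: pair_prob_space service_space "task_space N l d" ..
  have f': "f \<in> borel_measurable (measure_pmf init \<Otimes>\<^sub>M service_space \<Otimes>\<^sub>M task_space N l d)"
    using f by (simp add: jsq_space_eq)
  have fx: "(\<lambda>p. f (x0, p)) \<in> borel_measurable (service_space \<Otimes>\<^sub>M task_space N l d)" for x0
    by (rule measurable_compose[OF measurable_Pair1' f']) simp
  have "(\<integral>\<^sup>+ \<omega>. f \<omega> \<partial>jsq_space N l d init)
      = (\<integral>\<^sup>+ x0. \<integral>\<^sup>+ p. f (x0, p) \<partial>(service_space \<Otimes>\<^sub>M task_space N l d) \<partial>measure_pmf init)"
    unfolding jsq_space_eq by (rule ST.P.nn_integral_fst[symmetric, OF f'])
  also have "\<dots> = (\<integral>\<^sup>+ x0. \<integral>\<^sup>+ task. \<integral>\<^sup>+ s0. f (x0, s0, task) \<partial>service_space \<partial>task_space N l d \<partial>measure_pmf init)"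
    by (intro nn_integral_cong ST.nn_integral_snd[symmetric]) (simp add: fx)
  also have "\<dots> \<le> (\<integral>\<^sup>+ x0. \<integral>\<^sup>+ task. c \<partial>task_space N l d \<partial>measure_pmf init)"
    by (intro nn_integral_mono nn_integral_mono_AE bound)
  also have "\<dots> = c"
    by (simp add: T.emeasure_space_1 measure_pmf.emeasure_space_1 del: space_task)
  finally show ?thesis .
qed

lemma AE_exponential_pos: "0 < l \<Longrightarrow> AE x in exponential l. 0 < x"
proof -
  assume "0 < l"
  have "AE x in lborel. x \<noteq> (0::real)" by (rule AE_lborel_singleton)
  then show ?thesis
    unfolding exponential_def
    by (subst AE_density) (auto simp: exponential_density_def elim!: eventually_mono)
qed

lemma AE_interarrival_pos:
  assumes l: "0 < l"
  shows "AE w in task_space N l d. \<forall>j. 0 < fst (w j)"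
proof (subst AE_all_countable, rule allI)
  fix j
  interpret U: prob_space "measure_pmf (uniform_selection N d) \<Otimes>\<^sub>M exponential 1"
    by (intro prob_space_pair prob_space_measure_pmf prob_space_exponential) simp
  have *: "distr (task_law N l d) (exponential l) fst = exponential l"
    unfolding task_law_def by (rule U.distr_pair_fst)
  have "AE x in distr (task_law N l d) (exponential l) fst. 0 < x"
    unfolding * by (rule AE_exponential_pos[OF l])
  then have "AE x in task_law N l d. 0 < fst x"
    by (rule AE_distrD[rotated]) (simp add: task_law_def)
  then show "AE w in task_space N l d. 0 < fst (w j)"
    unfolding task_space_def by (intro AE_PiM_component prob_space_task_law l) auto
qed

lemma set_uniform_selection:
  assumes "d \<le> N"
  shows "set_pmf (uniform_selection N d) = {S. S \<subseteq> {..<N} \<and> card S = d}"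
proof -
  have "\<exists>S. S \<subseteq> {..<N} \<and> card S = d"
    using assms by (intro exI[of _ "{..<d}"]) auto
  then show ?thesis
    unfolding uniform_selection_def by (intro set_pmf_of_set) auto
qed

lemma AE_selection:
  assumes l: "0 < l" and d: "1 \<le> d" "d \<le> N"
  shows "AE w in task_space N l d. \<forall>j. fst (snd (w j)) \<subseteq> {..<N} \<and> fst (snd (w j)) \<noteq> {}"
proof (subst AE_all_countable, rule allI)
  fix j
  let ?U = "measure_pmf (uniform_selection N d)"
  interpret E: prob_space "exponential 1" by (rule prob_space_exponential) simp
  interpret L: prob_space "exponential l" by (rule prob_space_exponential[OF l])
  interpret P: pair_prob_space "exponential l" "?U \<Otimes>\<^sub>M exponential 1"
    by (intro pair_prob_space.intro pair_sigma_finite.intro prob_space_imp_sigma_finite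
        prob_space_pair prob_space_measure_pmf E.prob_space_axioms L.prob_space_axioms)
  have "AE S in ?U. S \<subseteq> {..<N} \<and> S \<noteq> {}"
    using d by (auto simp: AE_measure_pmf_iff set_uniform_selection)
  then have 1: "AE x in ?U \<Otimes>\<^sub>M exponential 1. fst x \<subseteq> {..<N} \<and> fst x \<noteq> {}"
    by (intro AE_distrD[of fst _ ?U "\<lambda>S. S \<subseteq> {..<N} \<and> S \<noteq> {}"])
      (simp, subst E.distr_pair_fst)
  have "AE x in task_law N l d. fst (snd x) \<subseteq> {..<N} \<and> fst (snd x) \<noteq> {}"
    unfolding task_law_def
  proof (rule P.AE_pair_measure)
    show "{x \<in> space (exponential l \<Otimes>\<^sub>M ?U \<Otimes>\<^sub>M exponential 1). fst (snd x) \<subseteq> {..<N} \<and> fst (snd x) \<noteq> {}}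
        \<in> sets (exponential l \<Otimes>\<^sub>M ?U \<Otimes>\<^sub>M exponential 1)"
      by (rule measurable_sets_Collect[of "\<lambda>x. fst (snd x)" _ "count_space UNIV"])
        (auto intro!: measurable_compose[OF measurable_snd])
  qed (use 1 in auto)
  then show "AE w in task_space N l d. fst (snd (w j)) \<subseteq> {..<N} \<and> fst (snd (w j)) \<noteq> {}"
    unfolding task_space_def by (intro AE_PiM_component prob_space_task_law l) auto
qed

lemma AE_jsqI:
  assumes l: "0 < l" and T: "AE w in task_space N l d. P w"
  shows "AE \<omega> in jsq_space N l d init. P (snd (snd \<omega>))"
proof -
  interpret T: prob_space "task_space N l d" by (rule prob_space_task[OF l])
  obtain A where A: "{w. \<not> P w} \<subseteq> A" "A \<in> sets (task_space N l d)" "emeasure (task_space N l d) A = 0"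
    using T by (auto elim!: AE_E)
  let ?B = "{\<omega> \<in> space (jsq_space N l d init). snd (snd \<omega>) \<in> A}"
  have B: "?B \<in> sets (jsq_space N l d init)"
    using A(2) unfolding jsq_space_eq by measurable
  have "emeasure (jsq_space N l d init) ?B = (\<integral>\<^sup>+ \<omega>. indicator ?B \<omega> \<partial>jsq_space N l d init)"
    using B by (rule nn_integral_indicator[symmetric])
  also have "\<dots> \<le> 0"
  proof (rule nn_integral_jsq_le_task[OF _ l])
    fix x0 s0
    have "(\<integral>\<^sup>+ w. indicator ?B (x0, s0, w) \<partial>task_space N l d)
        = (\<integral>\<^sup>+ w. indicator A w \<partial>task_space N l d)"
      by (intro nn_integral_cong) (simp add: indicator_def)
    then show "(\<integral>\<^sup>+ w. indicator ?B (x0, s0, w) \<partial>task_space N l d) \<le> 0"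
      using A by simp
  qed (use B in measurable)
  finally show ?thesis
    using A(1) by (intro AE_I[OF _ _ B]) auto
qed

section \<open>Resampling a coordinate and the number of rescued servers\<close>

text \<open>
  Replacing one coordinate by an independent copy preserves a product measure.
\<close>

lemma nn_integral_PiM_resample:
  assumes M: "\<And>i. prob_space (M i)" and f: "f \<in> borel_measurable (PiM UNIV M)"
  shows "(\<integral>\<^sup>+ w. f w \<partial>PiM UNIV M) = (\<integral>\<^sup>+ w. \<integral>\<^sup>+ x. f (w(i := x)) \<partial>M i \<partial>PiM UNIV M)"
proof -
  interpret Mi: prob_space "M i" by (rule M)
  interpret PM: prob_space "PiM UNIV M" by (intro prob_space_PiM M)
  interpret pair_prob_space "M i" "PiM UNIV M" ..
  let ?u = "\<lambda>(x, w). w(i := x)"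
  have u: "?u \<in> M i \<Otimes>\<^sub>M PiM UNIV M \<rightarrow>\<^sub>M PiM UNIV M"
    unfolding split_beta by (rule measurable_fun_upd[where J = UNIV]) auto
  have "distr (M i \<Otimes>\<^sub>M PiM UNIV M) (PiM UNIV M) ?u = PiM UNIV M"
    using distr_pair_PiM_eq_PiM[of UNIV M i] M by simp
  moreover have "nn_integral (distr (M i \<Otimes>\<^sub>M PiM UNIV M) (PiM UNIV M) ?u) f
      = (\<integral>\<^sup>+ p. f (?u p) \<partial>(M i \<Otimes>\<^sub>M PiM UNIV M))"
    by (rule nn_integral_distr[OF u]) (use f in simp)
  ultimately have "(\<integral>\<^sup>+ w. f w \<partial>PiM UNIV M) = (\<integral>\<^sup>+ p. f (?u p) \<partial>(M i \<Otimes>\<^sub>M PiM UNIV M))"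
    by simp
  also have "\<dots> = (\<integral>\<^sup>+ w. \<integral>\<^sup>+ x. f (?u (x, w)) \<partial>M i \<partial>PiM UNIV M)"
    by (rule nn_integral_snd[symmetric]) (use measurable_compose[OF u f] in \<open>simp add: split_beta'\<close>)
  finally show ?thesis by simp
qed

lemma measure_PiM_resample:
  assumes M: "\<And>i. prob_space (M i)" and A: "A \<in> sets (M i)"
    and Q: "Measurable.pred (PiM UNIV M) Q" and inv: "\<And>w x. Q (w(i := x)) \<longleftrightarrow> Q w"
  shows "measure (PiM UNIV M) {w \<in> space (PiM UNIV M). w i \<in> A \<and> Q w}
    = measure (M i) A * measure (PiM UNIV M) {w \<in> space (PiM UNIV M). Q w}"
proof -
  interpret Mi: prob_space "M i" by (rule M)
  interpret PM: prob_space "PiM UNIV M" by (intro prob_space_PiM M)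
  let ?E = "{w \<in> space (PiM UNIV M). w i \<in> A \<and> Q w}"
  let ?F = "{w \<in> space (PiM UNIV M). Q w}"
  have F: "?F \<in> sets (PiM UNIV M)" using Q by simp
  have E: "?E \<in> sets (PiM UNIV M)"
    using Q measurable_sets_Collect[OF measurable_component_singleton[of i UNIV M] ] A
    by (simp add: sets.sets_Collect_conj)
  have "emeasure (PiM UNIV M) ?E = (\<integral>\<^sup>+ w. indicator ?E w \<partial>PiM UNIV M)"
    using E by simp
  also have "\<dots> = (\<integral>\<^sup>+ w. \<integral>\<^sup>+ x. indicator ?E (w(i := x)) \<partial>M i \<partial>PiM UNIV M)"
    by (intro nn_integral_PiM_resample M) (use E in simp)
  also have "\<dots> = (\<integral>\<^sup>+ w. \<integral>\<^sup>+ x. indicator A x * indicator ?F w \<partial>M i \<partial>PiM UNIV M)"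
    by (intro nn_integral_cong) (auto simp: indicator_def inv space_PiM PiE_iff)
  also have "\<dots> = emeasure (M i) A * emeasure (PiM UNIV M) ?F"
    using A F by (simp add: nn_integral_multc nn_integral_cmult)
  finally show ?thesis
    by (simp add: PM.emeasure_eq_measure Mi.emeasure_eq_measure flip: ennreal_mult)
qed

lemma measure_exponential_tails:
  assumes "0 \<le> T"
  shows "measure (exponential 1) {T<..} = exp (- T)"
    and "measure (exponential 1) {..T} = 1 - exp (- T)"
proof -
  interpret E: prob_space "exponential 1" by (rule prob_space_exponential) simp
  have D: "distributed (exponential 1) lborel (\<lambda>x. x) (exponential_density 1)"
    unfolding distributed_def exponential_def
    by (auto simp: distr_id2 intro!: measurable_ident_sets)
  show "measure (exponential 1) {T<..} = exp (- T)"
    using E.exponential_distributedD_gt[OF D assms] by (simp add: greaterThan_def)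
  show "measure (exponential 1) {..T} = 1 - exp (- T)"
    using E.exponential_distributedD_le[OF D assms] by (simp add: atMost_def)
qed

lemma measurable_sample_service:
  assumes "\<And>j. sampled (x0, s0, task) j \<subseteq> {..<N}"
    and g: "g \<in> service_space \<rightarrow>\<^sub>M service_space"
  shows "measurable_sample service_space N (\<lambda>s. (x0, g s, task))"
proof
  fix j show "(\<lambda>s. sampled (x0, g s, task) j) \<in> service_space \<rightarrow>\<^sub>M count_space (Pow {..<N})"
    using assms(1) by (simp add: sampled_def)
next
  fix p show "(\<lambda>s. fst (snd (x0, g s, task)) p) \<in> borel_measurable service_space"
    using measurable_compose[OF g service_component] by simp
qed auto

text \<open>
  Reset the initial service of server \<open>n\<close> to \<open>T + 1\<close>, and let \<open>H\<close> be the event that the server is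
  then hit before \<open>T\<close>. It is independent of the original requirement, so being rescued has probability at
  most \<open>(1 - exp (- T)) * P H\<close>. In the same way \<open>exp (- T) * P H\<close>, the probability of \<open>H\<close> together with a
  requirement exceeding \<open>T\<close>, is at most the probability of a hit in the original system.
\<close>

lemma measure_rescued_le_hit:
  assumes pos: "\<forall>j. 0 < fst (task j)" and S: "\<forall>j. fst (snd (task j)) \<subseteq> {..<N}" and T: "0 \<le> T"
  shows "measure service_space {s. rescued b a T (x0, s, task) n}
    \<le> (exp T - 1) * measure service_space {s. hit b a T (x0, s, task) n}"
proof (cases "x0 n = 1")
  case False
  then show ?thesis
    using T by (simp add: rescued_def)
next
  case one: True
  interpret B: prob_space service_space by (rule prob_space_service)
  let ?r = "\<lambda>s. s((n, 0) := T + 1)"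
  let ?H = "\<lambda>s. hit b a T (x0, ?r s, task) n"
  have r: "?r \<in> service_space \<rightarrow>\<^sub>M service_space"
    unfolding service_space_def by (rule measurable_fun_upd[where J = UNIV]) auto
  interpret h: measurable_sample service_space N "\<lambda>s. (x0, s, task)"
    by (rule measurable_sample_service) (use S in \<open>auto simp: sampled_def\<close>)
  interpret hr: measurable_sample service_space N "\<lambda>s. (x0, ?r s, task)"
    by (rule measurable_sample_service[OF _ r]) (use S in \<open>auto simp: sampled_def\<close>)
  note [measurable] = h.hit_measurable[of b a T n] h.rescued_measurable[of b a T n] hr.hit_measurable[of b a T n]
  have split: "measure service_space {s. s (n, 0) \<in> A \<and> ?H s}
      = measure (exponential 1) A * measure service_space {s. ?H s}" if "A \<in> sets borel" for A
    using measure_PiM_resample[of "\<lambda>_. exponential 1" A "(n, 0)" ?H] that hr.hit_measurable[of b a T n]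
    by (simp add: prob_space_exponential space_PiM flip: service_space_def)
  have rs: "reset_service n (T + 1) (x0, s, task) = (x0, ?r s, task)" for s
    by (simp add: reset_service_def)
  have "measure service_space {s. rescued b a T (x0, s, task) n}
      \<le> measure service_space {s. s (n, 0) \<in> {..T} \<and> ?H s}"
  proof (rule B.finite_measure_mono)
    show "{s. rescued b a T (x0, s, task) n} \<subseteq> {s. s (n, 0) \<in> {..T} \<and> ?H s}"
      using rescued_reset_service[of "(x0, _, task)" b a T n "T + 1"] pos
      by (auto simp: rs) (simp add: rescued_def)
    have "{s \<in> space service_space. s (n, 0) \<in> {..T} \<and> ?H s} \<in> sets service_space" by measurable
    then show "{s. s (n, 0) \<in> {..T} \<and> ?H s} \<in> sets service_space" by simp
  qed
  also have "\<dots> = (1 - exp (- T)) * measure service_space {s. ?H s}"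
    by (simp only: split[of "{..T}"] measure_exponential_tails[OF T] atMost_borel)
  \<comment> \<open>The factor \<open>exp (- T)\<close> is now read as the probability of a requirement exceeding \<open>T\<close>.\<close>
  also have "\<dots> = (exp T - 1) * (exp (- T) * measure service_space {s. ?H s})"
    by (simp add: algebra_simps exp_minus)
  also have "exp (- T) * measure service_space {s. ?H s}
      = measure service_space {s. s (n, 0) \<in> {T<..} \<and> ?H s}"
    by (simp only: split[of "{T<..}"] measure_exponential_tails[OF T] greaterThan_borel)
  also have "\<dots> \<le> measure service_space {s. hit b a T (x0, s, task) n}"
  proof (rule B.finite_measure_mono)
    show "{s. s (n, 0) \<in> {T<..} \<and> ?H s} \<subseteq> {s. hit b a T (x0, s, task) n}"
    proof (rule subsetI)
      fix s assume "s \<in> {s. s (n, 0) \<in> {T<..} \<and> ?H s}"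
      then have s: "T < s (n, 0)" "?H s" by simp_all
      have "hit b a T (reset_service n (s (n, 0)) (x0, ?r s, task)) n"
        using s by (intro hit_reset_service) (simp_all add: pos one)
      then show "s \<in> {s. hit b a T (x0, s, task) n}" by (simp add: reset_service_def)
    qed
    have "{s \<in> space service_space. hit b a T (x0, s, task) n} \<in> sets service_space" by measurable
    then show "{s. hit b a T (x0, s, task) n} \<in> sets service_space" by simp
  qed
  finally show ?thesis using T by (simp add: mult_left_mono)
qed

text \<open>
  Trivial, but essential for the rescued servers: summed over all servers, the hit probabilities do
  not exceed \<open>a\<close>, however unevenly the tie-breaking rule treats the servers.
\<close>

lemma card_hit_le: "card {n. n < N \<and> hit b a T \<omega> n} \<le> a"
proof -
  have "{n. n < N \<and> hit b a T \<omega> n} \<subseteq> target b \<omega> ` {..<a}"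
    by (auto simp: hit_def)
  then have "card {n. n < N \<and> hit b a T \<omega> n} \<le> card (target b \<omega> ` {..<a})"
    by (intro card_mono) auto
  also have "\<dots> \<le> a" using card_image_le[of "{..<a}" "target b \<omega>"] by simp
  finally show ?thesis .
qed

lemma nn_integral_card_pred:
  fixes P :: "'w \<Rightarrow> nat \<Rightarrow> bool"
  assumes [measurable]: "\<And>n. Measurable.pred M (\<lambda>w. P w n)"
  shows "(\<integral>\<^sup>+ w. ennreal (real (card {n. n < N \<and> P w n})) \<partial>M)
    = (\<Sum>n<N. emeasure M {w \<in> space M. P w n})"
proof -
  have c: "ennreal (real (card {n. n < N \<and> P w n})) = (\<Sum>n<N. of_bool (P w n))" for w
  proof -
    have "(\<Sum>n<N. of_bool (P w n) :: ennreal) = of_nat (card ({..<N} \<inter> {n. P w n}))"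
      by (rule sum_of_bool_eq) auto
    also have "{..<N} \<inter> {n. P w n} = {n. n < N \<and> P w n}" by auto
    finally show ?thesis by (simp add: ennreal_of_nat_eq_real_of_nat)
  qed
  have "(\<integral>\<^sup>+ w. ennreal (real (card {n. n < N \<and> P w n})) \<partial>M) = (\<Sum>n<N. \<integral>\<^sup>+ w. of_bool (P w n) \<partial>M)"
    unfolding c by (rule nn_integral_sum) measurable
  moreover have "(\<integral>\<^sup>+ w. of_bool (P w n) \<partial>M) = emeasure M {w \<in> space M. P w n}" for n
  proof -
    have "(\<integral>\<^sup>+ w. of_bool (P w n) \<partial>M) = (\<integral>\<^sup>+ w. indicator {w \<in> space M. P w n} w \<partial>M)"
      by (intro nn_integral_cong) (simp add: indicator_def)
    also have "\<dots> = emeasure M {w \<in> space M. P w n}"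
      by (rule nn_integral_indicator) measurable
    finally show ?thesis .
  qed
  ultimately show ?thesis by simp
qed

lemma nn_integral_rescued_le:
  assumes pos: "\<forall>j. 0 < fst (task j)" and S: "\<forall>j. fst (snd (task j)) \<subseteq> {..<N}" and T: "0 \<le> T"
  shows "(\<integral>\<^sup>+ s. ennreal (real (card {n. n < N \<and> rescued b a T (x0, s, task) n})) \<partial>service_space)
    \<le> ennreal ((exp T - 1) * real a)"
proof -
  interpret B: prob_space service_space by (rule prob_space_service)
  interpret h: measurable_sample service_space N "\<lambda>s. (x0, s, task)"
    by (rule measurable_sample_service) (use S in \<open>auto simp: sampled_def\<close>)
  have "(\<integral>\<^sup>+ s. ennreal (real (card {n. n < N \<and> rescued b a T (x0, s, task) n})) \<partial>service_space)
      = (\<Sum>n<N. emeasure service_space {s. rescued b a T (x0, s, task) n})"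
    by (subst nn_integral_card_pred) (simp_all add: h.rescued_measurable)
  also have "\<dots> \<le> (\<Sum>n<N. ennreal (exp T - 1) * emeasure service_space {s. hit b a T (x0, s, task) n})"
    using measure_rescued_le_hit[OF assms, of b a x0] T
    by (intro sum_mono) (simp add: B.emeasure_eq_measure flip: ennreal_mult)
  also have "\<dots> = ennreal (exp T - 1) * (\<Sum>n<N. emeasure service_space {s. hit b a T (x0, s, task) n})"
    by (simp add: sum_distrib_left)
  also have "(\<Sum>n<N. emeasure service_space {s. hit b a T (x0, s, task) n})
      = (\<integral>\<^sup>+ s. ennreal (real (card {n. n < N \<and> hit b a T (x0, s, task) n})) \<partial>service_space)"
    by (subst nn_integral_card_pred) (simp_all add: h.hit_measurable)
  also have "\<dots> \<le> (\<integral>\<^sup>+ s. ennreal (real a) \<partial>service_space)"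
    by (intro nn_integral_mono ennreal_leI) (simp add: card_hit_le)
  also have "\<dots> = ennreal (real a)"
    by (simp add: B.emeasure_space_1 del: space_service)
  finally show ?thesis
    using T by (simp add: ennreal_mult mult_left_mono)
qed

section \<open>Arrivals that sample no idle server\<close>

text \<open>
  The product of these factors is an exponential functional of the number of arrivals missing all
  idle servers, killed as soon as more than \<open>k\<close> servers are idle. Given the past, the \<open>i\<close>-th factor has
  mean at most \<open>1 - p / 2\<close>, where \<open>p\<close> is a lower bound for the probability of a miss.
\<close>

definition miss_factor :: "enat \<Rightarrow> nat \<Rightarrow> nat \<Rightarrow> sample \<Rightarrow> nat \<Rightarrow> real" where
  "miss_factor b N k \<omega> i =
     (if card (idle_before b N \<omega> i) \<le> k
      then if sampled \<omega> i \<inter> idle_before b N \<omega> i = {} then 1 / 2 else 1 else 0)"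

definition miss_weight :: "enat \<Rightarrow> nat \<Rightarrow> nat \<Rightarrow> sample \<Rightarrow> nat \<Rightarrow> real" where
  "miss_weight b N k \<omega> j = (\<Prod>i<j. miss_factor b N k \<omega> i)"

lemma miss_factor_nonneg: "0 \<le> miss_factor b N k \<omega> i"
  by (simp add: miss_factor_def)

lemma miss_weight_nonneg: "0 \<le> miss_weight b N k \<omega> j"
  by (simp add: miss_weight_def prod_nonneg miss_factor_nonneg)

lemma miss_weight_Suc: "miss_weight b N k \<omega> (Suc j) = miss_weight b N k \<omega> j * miss_factor b N k \<omega> j"
  by (simp add: miss_weight_def)

lemma miss_weight_eq_power:
  assumes "\<forall>j<m. card (idle_before b N \<omega> j) \<le> k"
  shows "miss_weight b N k \<omega> m
    = (1 / 2) ^ card {j. j < m \<and> sampled \<omega> j \<inter> idle_before b N \<omega> j = {}}"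
  using assms
proof (induction m)
  case 0
  then show ?case by (simp add: miss_weight_def)
next
  case (Suc m)
  let ?P = "\<lambda>j. sampled \<omega> j \<inter> idle_before b N \<omega> j = {}"
  have "{j. j < Suc m \<and> ?P j} = (if ?P m then insert m {j. j < m \<and> ?P j} else {j. j < m \<and> ?P j})"
    by (auto simp: less_Suc_eq)
  then have "card {j. j < Suc m \<and> ?P j} = (if ?P m then Suc (card {j. j < m \<and> ?P j}) else card {j. j < m \<and> ?P j})"
    by simp
  then show ?case
    using Suc by (simp add: miss_weight_Suc miss_factor_def)
qed

lemma idle_before_cong:
  assumes "fst \<omega> = fst \<omega>'" "fst (snd \<omega>) = fst (snd \<omega>')"
    and "\<And>i. i < j \<Longrightarrow> snd (snd \<omega>) i = snd (snd \<omega>') i"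
    and "fst (snd (snd \<omega>) j) = fst (snd (snd \<omega>') j)"
  shows "idle_before b N \<omega> j = idle_before b N \<omega>' j"
proof -
  have "schedule b \<omega> j = schedule b \<omega>' j" by (rule schedule_cong[OF assms(1-3)])
  moreover have "arrival_time \<omega> j = arrival_time \<omega>' j"
    using assms(3,4) by (intro arrival_time_cong) (metis le_neq_implies_less)
  ultimately show ?thesis by (simp add: idle_before_def)
qed

lemma miss_weight_cong:
  assumes "fst \<omega> = fst \<omega>'" "fst (snd \<omega>) = fst (snd \<omega>')"
    and "\<And>i. i < j \<Longrightarrow> snd (snd \<omega>) i = snd (snd \<omega>') i"
  shows "miss_weight b N k \<omega> j = miss_weight b N k \<omega>' j"
proof -
  have "idle_before b N \<omega> i = idle_before b N \<omega>' i" if "i < j" for i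
    by (rule idle_before_cong) (use assms that in auto)
  moreover have "sampled \<omega> i = sampled \<omega>' i" if "i < j" for i
    using assms(3)[OF that] by (simp add: sampled_def)
  ultimately show ?thesis
    unfolding miss_weight_def miss_factor_def by (intro prod.cong) simp_all
qed

lemma (in measurable_sample) miss_weight_measurable:
  "(\<lambda>w. miss_weight b N k (f w) j) \<in> borel_measurable M"
proof -
  have [measurable]: "Measurable.pred M (\<lambda>w. n \<in> sampled (f w) i)" for n i
    by (rule measurable_compose[OF selection]) simp
  have [measurable]: "Measurable.pred M (\<lambda>w. n \<in> idle_before b N (f w) i)" for n i
    by (rule measurable_compose[OF idle_before_measurable]) simp
  have [measurable]: "(\<lambda>w. card (idle_before b N (f w) i)) \<in> M \<rightarrow>\<^sub>M count_space UNIV" for i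
    by (rule measurable_compose[OF idle_before_measurable]) simp
  have *: "(sampled (f w) i \<inter> idle_before b N (f w) i = {})
      = (\<forall>n. \<not> (n \<in> sampled (f w) i \<and> n \<in> idle_before b N (f w) i))" for w i
    by auto
  show ?thesis
    unfolding miss_weight_def miss_factor_def * by measurable
qed

lemma nn_integral_miss_factor_le:
  assumes "\<And>I. I \<subseteq> {..<N} \<Longrightarrow> card I \<le> k \<Longrightarrow> p \<le> measure (measure_pmf U) {S. S \<inter> I = {}}"
    and "p \<le> 1" "I \<subseteq> {..<N}"
  shows "(\<integral>\<^sup>+ S. ennreal (if card I \<le> k then if (S \<inter> {..<N}) \<inter> I = {} then 1 / 2 else 1 else 0) \<partial>measure_pmf U)
    \<le> ennreal (1 - p / 2)"
proof (cases "card I \<le> k")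
  case True
  have "(S \<inter> {..<N}) \<inter> I = S \<inter> I" for S using assms(3) by auto
  then have "(\<integral>\<^sup>+ S. ennreal (if card I \<le> k then if (S \<inter> {..<N}) \<inter> I = {} then 1 / 2 else 1 else 0) \<partial>measure_pmf U)
      = (\<integral>\<^sup>+ S. ennreal (1 - 1 / 2 * indicator {S. S \<inter> I = {}} S) \<partial>measure_pmf U)"
    using True by (intro nn_integral_cong) (simp add: indicator_def)
  also have "\<dots> = ennreal (\<integral> S. 1 - 1 / 2 * indicator {S. S \<inter> I = {}} S \<partial>measure_pmf U)"
    by (intro nn_integral_eq_integral measure_pmf.integrable_const_bound[where B = 1])
      (auto simp: indicator_def)
  also have "(\<integral> S. 1 - 1 / 2 * indicator {S. S \<inter> I = {}} S \<partial>measure_pmf U)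
      = 1 - 1 / 2 * measure (measure_pmf U) {S. S \<inter> I = {}}"
    by (subst Bochner_Integration.integral_diff)
      (simp_all add: integrable_real_indicator measure_pmf.emeasure_eq_measure)
  also have "ennreal \<dots> \<le> ennreal (1 - p / 2)"
    using assms(1)[OF assms(3) True] by (intro ennreal_leI) simp
  finally show ?thesis .
qed simp

text \<open>
  The \<open>j\<close>-th sampled set is independent of the state in which it is used: resample the \<open>j\<close>-th task
  and integrate over its sampled set before its interarrival time.
\<close>

lemma nn_integral_miss_weight_le:
  assumes l: "0 < l"
    and p: "\<And>I. I \<subseteq> {..<N} \<Longrightarrow> card I \<le> k \<Longrightarrow>
        p \<le> measure (measure_pmf (uniform_selection N d)) {S. S \<inter> I = {}}"
    and p1: "p \<le> 1"
  shows "(\<integral>\<^sup>+ w. ennreal (miss_weight b N k (clean N (x0, s0, w)) j) \<partial>task_space N l d)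
    \<le> ennreal ((1 - p / 2) ^ j)"
proof (induction j)
  case 0
  interpret T: prob_space "task_space N l d" by (rule prob_space_task[OF l])
  show ?case by (simp add: miss_weight_def T.emeasure_space_1 del: space_task)
next
  case (Suc j)
  let ?F = "task_law N l d" and ?U = "measure_pmf (uniform_selection N d)"
  let ?W = "\<lambda>j w. miss_weight b N k (clean N (x0, s0, w)) j"
  interpret F: prob_space ?F by (rule prob_space_task_law[OF l])
  interpret E: prob_space "exponential 1" by (rule prob_space_exponential) simp
  interpret L: prob_space "exponential l" by (rule prob_space_exponential[OF l])
  interpret UE: pair_prob_space ?U "exponential 1"
    by (intro pair_prob_space.intro pair_sigma_finite.intro prob_space_imp_sigma_finite
        prob_space_measure_pmf E.prob_space_axioms)
  have ms: "measurable_sample (task_space N l d) N (\<lambda>w. clean N (x0, s0, w))"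
    by (rule measurable_sample_clean[where N' = N and l = l and d = d]) (auto simp: service_space_def space_PiM)
  have Wm: "(\<lambda>w. ennreal (?W j w)) \<in> borel_measurable (task_space N l d)" for j
    using measurable_sample.miss_weight_measurable[OF ms] by simp
  have step: "(\<integral>\<^sup>+ x. ennreal (?W (Suc j) (w(j := x))) \<partial>?F) \<le> ennreal (?W j w) * ennreal (1 - p / 2)" for w
  proof -
    \<comment> \<open>The set of idle servers at the \<open>j\<close>-th arrival depends on the \<open>j\<close>-th task only through its interarrival time \<open>a\<close>; the empty set and 0 are placeholders.\<close>
    define I where "I a = idle_before b N (clean N (x0, s0, w(j := (a, {}, 0)))) j" for a
    define G where "G a S = ennreal (?W j w) *
        ennreal (if card (I a) \<le> k then if (S \<inter> {..<N}) \<inter> I a = {} then 1 / 2 else 1 else 0)" for a S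
    have IN: "I a \<subseteq> {..<N}" for a by (auto simp: I_def idle_before_def)
    have W: "ennreal (?W (Suc j) (w(j := x))) = G (fst x) (fst (snd x))" for x
    proof -
      have "?W j (w(j := x)) = ?W j w"
        by (rule miss_weight_cong) (auto simp: clean_def)
      moreover have "idle_before b N (clean N (x0, s0, w(j := x))) j = I (fst x)"
        unfolding I_def by (rule idle_before_cong) (auto simp: clean_def)
      moreover have "sampled (clean N (x0, s0, w(j := x))) j = fst (snd x) \<inter> {..<N}"
        unfolding clean_simps by (simp add: sampled_def)
      ultimately show ?thesis
        by (simp add: miss_weight_Suc G_def miss_factor_def ennreal_mult miss_weight_nonneg
            del: clean_simps)
    qed
    have upd: "(\<lambda>x. w(j := x)) \<in> ?F \<rightarrow>\<^sub>M task_space N l d"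
      unfolding task_space_def
      by (rule measurable_fun_upd[where J = UNIV]) (auto simp: space_PiM)
    have "(\<lambda>x. ennreal (?W (Suc j) (w(j := x)))) \<in> borel_measurable ?F"
      by (rule measurable_compose[OF upd Wm])
    then have Gm: "(\<lambda>x. G (fst x) (fst (snd x))) \<in> borel_measurable (exponential l \<Otimes>\<^sub>M ?U \<Otimes>\<^sub>M exponential 1)"
      by (simp add: W task_law_def)
    have Gm2: "(\<lambda>y. G a (fst y)) \<in> borel_measurable (?U \<Otimes>\<^sub>M exponential 1)" for a
      using measurable_compose[OF measurable_Pair1' Gm, of a] by simp
    have "(\<integral>\<^sup>+ x. ennreal (?W (Suc j) (w(j := x))) \<partial>?F)
        = (\<integral>\<^sup>+ a. \<integral>\<^sup>+ y. G a (fst y) \<partial>(?U \<Otimes>\<^sub>M exponential 1) \<partial>exponential l)"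
      unfolding W task_law_def by (subst UE.P.nn_integral_fst[symmetric, OF Gm]) simp
    also have "\<dots> = (\<integral>\<^sup>+ a. \<integral>\<^sup>+ S. G a S \<partial>?U \<partial>exponential l)"
      by (intro nn_integral_cong, subst E.nn_integral_fst[symmetric, OF Gm2])
        (simp add: E.emeasure_space_1 del: space_exponential)
    also have "\<dots> \<le> (\<integral>\<^sup>+ a. ennreal (?W j w) * ennreal (1 - p / 2) \<partial>exponential l)"
      unfolding G_def
      by (intro nn_integral_mono, subst nn_integral_cmult)
        (auto intro!: mult_left_mono nn_integral_miss_factor_le[OF p p1 IN])
    also have "\<dots> = ennreal (?W j w) * ennreal (1 - p / 2)"
      by (simp add: L.emeasure_space_1 del: space_exponential)
    finally show ?thesis .
  qed
  have "(\<integral>\<^sup>+ w. ennreal (?W (Suc j) w) \<partial>task_space N l d)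
      = (\<integral>\<^sup>+ w. \<integral>\<^sup>+ x. ennreal (?W (Suc j) (w(j := x))) \<partial>?F \<partial>task_space N l d)"
    unfolding task_space_def
    by (rule nn_integral_PiM_resample) (use Wm F.prob_space_axioms in \<open>auto simp: task_space_def\<close>)
  also have "\<dots> \<le> (\<integral>\<^sup>+ w. ennreal (?W j w) * ennreal (1 - p / 2) \<partial>task_space N l d)"
    by (intro nn_integral_mono step)
  also have "\<dots> = (\<integral>\<^sup>+ w. ennreal (?W j w) \<partial>task_space N l d) * ennreal (1 - p / 2)"
    by (intro nn_integral_multc Wm)
  also have "\<dots> \<le> ennreal ((1 - p / 2) ^ j) * ennreal (1 - p / 2)"
    by (intro mult_right_mono Suc.IH) simp
  also have "\<dots> = ennreal ((1 - p / 2) ^ Suc j)"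
    using p1 by (simp add: mult.commute flip: ennreal_mult)
  finally show ?case .
qed

text \<open>
  Markov's inequality for \<open>miss_weight\<close>; by \<open>miss_weight_eq_power\<close> the event says that at most \<open>z\<close>
  of the first \<open>m\<close> arrivals miss while never more than \<open>k\<close> servers are idle.
\<close>

lemma measure_few_misses_le:
  assumes l: "0 < l"
    and p: "\<And>I. I \<subseteq> {..<N} \<Longrightarrow> card I \<le> k \<Longrightarrow>
        p \<le> measure (measure_pmf (uniform_selection N d)) {S. S \<inter> I = {}}"
    and p1: "p \<le> 1"
  shows "measure (jsq_space N l d init)
      {\<omega>. 2 powr (- z) \<le> miss_weight b N k (clean N \<omega>) m} \<le> 2 powr z * (1 - p / 2) ^ m"
proof -
  interpret M: prob_space "jsq_space N l d init" by (rule prob_space_jsq[OF l])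
  interpret measurable_sample "jsq_space N l d init" N "clean N" by (rule measurable_sample_jsq)
  let ?E = "{\<omega>. 2 powr (- z) \<le> miss_weight b N k (clean N \<omega>) m}"
  note [measurable] = miss_weight_measurable
  have "{\<omega> \<in> space (jsq_space N l d init). 2 powr (- z) \<le> miss_weight b N k (clean N \<omega>) m}
      \<in> sets (jsq_space N l d init)" by measurable
  then have E: "?E \<in> sets (jsq_space N l d init)" by simp
  have "emeasure (jsq_space N l d init) ?E = (\<integral>\<^sup>+ \<omega>. indicator ?E \<omega> \<partial>jsq_space N l d init)"
    using E by simp
  also have "\<dots> \<le> (\<integral>\<^sup>+ \<omega>. ennreal (2 powr z) * ennreal (miss_weight b N k (clean N \<omega>) m) \<partial>jsq_space N l d init)"
  proof (intro nn_integral_mono)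
    fix \<omega>
    show "indicator ?E \<omega> \<le> ennreal (2 powr z) * ennreal (miss_weight b N k (clean N \<omega>) m)"
    proof (cases "\<omega> \<in> ?E")
      case True
      have "1 = 2 powr z * 2 powr (- z)" by (simp flip: powr_add)
      also have "\<dots> \<le> 2 powr z * miss_weight b N k (clean N \<omega>) m"
        using True by (intro mult_left_mono) auto
      finally show ?thesis
        using True by (simp add: miss_weight_nonneg flip: ennreal_mult)
    qed simp
  qed
  also have "\<dots> = ennreal (2 powr z) * (\<integral>\<^sup>+ \<omega>. ennreal (miss_weight b N k (clean N \<omega>) m) \<partial>jsq_space N l d init)"
    by (intro nn_integral_cmult) measurable
  also have "\<dots> \<le> ennreal (2 powr z) * ennreal ((1 - p / 2) ^ m)"
    by (intro mult_left_mono nn_integral_jsq_le_task[OF _ l] nn_integral_miss_weight_le[OF l p p1])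
      measurable
  also have "\<dots> = ennreal (2 powr z * (1 - p / 2) ^ m)"
    using p1 by (simp add: ennreal_mult)
  finally show ?thesis
    using p1 by (simp add: M.emeasure_eq_measure)
qed

text \<open>
  Passing from \<open>n\<close> to \<open>n - 1\<close> multiplies \<open>n choose d\<close> by \<open>1 - d / n\<close>, and \<open>n \<ge> N - k\<close> throughout.
\<close>

lemma binomial_ratio_ge:
  fixes N d k i :: nat
  assumes "i \<le> k" "d + k \<le> N" "k < N"
  shows "(1 - real d / real (N - k)) ^ i * real (N choose d) \<le> real ((N - i) choose d)"
  using assms(1)
proof (induction i)
  case (Suc i)
  define n where "n = N - i"
  have n: "N - Suc i = n - 1" "N - k \<le> n" "d \<le> n" "0 < n" "d + 1 \<le> n \<or> d = 0 \<or> n = d"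
    using Suc.prems assms(2,3) by (auto simp: n_def)
  have q: "0 \<le> 1 - real d / real (N - k)" using assms by simp
  have le: "real d / real n \<le> real d / real (N - k)"
    using n assms(3) by (intro divide_left_mono) auto
  have "(n - d) * (n choose d) = n * ((n - 1) choose d)"
    by (rule binomial_absorb_comp)
  then have "real (n - d) * real (n choose d) = real n * real ((n - 1) choose d)"
    by (metis of_nat_mult)
  then have "real ((n - 1) choose d) = (1 - real d / real n) * real (n choose d)"
    using n by (simp add: field_simps of_nat_diff)
  also have "\<dots> \<ge> (1 - real d / real (N - k)) * real (n choose d)"
    using le by (intro mult_right_mono) auto
  also have "(1 - real d / real (N - k)) * real (n choose d)
      \<ge> (1 - real d / real (N - k)) * ((1 - real d / real (N - k)) ^ i * real (N choose d))"
    using Suc q by (intro mult_left_mono) (auto simp: n_def)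
  finally show ?case by (simp add: n(1) mult.assoc)
qed simp

lemma uniform_selection_avoids:
  assumes "d + k \<le> N" "k < N" and I: "I \<subseteq> {..<N}" "card I \<le> k"
  shows "(1 - real d / real (N - k)) ^ k
    \<le> measure (measure_pmf (uniform_selection N d)) {S. S \<inter> I = {}}"
proof -
  let ?A = "{S. S \<subseteq> {..<N} \<and> card S = d}"
  have cA: "card ?A = N choose d" by (simp add: n_subsets)
  have pos: "0 < N choose d" using assms by simp
  then have fA: "finite ?A" "?A \<noteq> {}" using cA by (metis card_ge_0_finite, metis card.empty less_irrefl)
  have q: "0 \<le> 1 - real d / real (N - k)" "1 - real d / real (N - k) \<le> 1" using assms by auto
  have "?A \<inter> {S. S \<inter> I = {}} = {S. S \<subseteq> {..<N} - I \<and> card S = d}" by auto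
  then have "card (?A \<inter> {S. S \<inter> I = {}}) = (N - card I) choose d"
    using I by (simp add: n_subsets card_Diff_subset finite_subset[OF I(1)])
  then have "measure (measure_pmf (uniform_selection N d)) {S. S \<inter> I = {}}
      = real ((N - card I) choose d) / real (N choose d)"
    unfolding uniform_selection_def by (simp add: measure_pmf_of_set[OF fA(2,1)] cA)
  moreover have "(1 - real d / real (N - k)) ^ card I \<le> real ((N - card I) choose d) / real (N choose d)"
    using binomial_ratio_ge[OF I(2) assms(1,2)] pos by (simp add: pos_le_divide_eq)
  moreover have "(1 - real d / real (N - k)) ^ k \<le> (1 - real d / real (N - k)) ^ card I"
    using I(2) q by (intro power_decreasing)
  ultimately show ?thesis by linarith
qed

section \<open>Concentration of arrivals and services\<close>

lemma indep_vars_PiM_coordinates: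
  assumes M: "\<And>i. prob_space (M i)"
  shows "prob_space.indep_vars (PiM UNIV M) M (\<lambda>i w. w i) UNIV"
proof -
  interpret P: prob_space "PiM UNIV M" by (intro prob_space_PiM M)
  have "(\<Pi>\<^sub>M i\<in>UNIV. distr (PiM UNIV M) (M i) (\<lambda>w. w i)) = PiM UNIV M"
    by (intro PiM_cong refl distr_PiM_component M) auto
  then show ?thesis
    by (subst P.indep_vars_iff_distr_eq_PiM') (simp_all add: restrict_def distr_id2)
qed

lemma interarrival_distributed:
  assumes l: "0 < l"
  shows "distributed (task_space N l d) lborel (\<lambda>w. fst (w j)) (exponential_density l)"
proof -
  interpret U: prob_space "measure_pmf (uniform_selection N d) \<Otimes>\<^sub>M exponential 1"
    by (intro prob_space_pair prob_space_measure_pmf prob_space_exponential) simp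
  have 1: "distr (task_space N l d) (task_law N l d) (\<lambda>w. w j) = task_law N l d"
    unfolding task_space_def by (intro distr_PiM_component prob_space_task_law l) auto
  have 2: "distr (task_law N l d) (exponential l) fst = exponential l"
    unfolding task_law_def by (rule U.distr_pair_fst)
  have fst: "fst \<in> task_law N l d \<rightarrow>\<^sub>M exponential l" by (simp add: task_law_def)
  have "distr (task_space N l d) lborel (\<lambda>w. fst (w j))
      = distr (task_space N l d) (exponential l) (fst \<circ> (\<lambda>w. w j))"
    by (intro distr_cong) auto
  also have "\<dots> = distr (distr (task_space N l d) (task_law N l d) (\<lambda>w. w j)) (exponential l) fst"
    by (intro distr_distr[symmetric] task_component fst)
  also have "\<dots> = exponential l" unfolding 1 2 ..
  finally show ?thesis
    unfolding distributed_def by (simp add: exponential_def)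
qed

lemma arrival_time_distributed:
  assumes l: "0 < l"
  shows "distributed (task_space N l d) lborel (\<lambda>w. \<Sum>i\<le>j. fst (w i)) (erlang_density j l)"
proof -
  interpret T: prob_space "task_space N l d" by (rule prob_space_task[OF l])
  have "T.indep_vars (\<lambda>_. task_law N l d) (\<lambda>i w. w i) UNIV"
    unfolding task_space_def by (intro indep_vars_PiM_coordinates prob_space_task_law l)
  then have "T.indep_vars (\<lambda>_. borel) (\<lambda>i w. fst (w i)) UNIV"
    by (rule T.indep_vars_compose2) (simp add: task_law_def)
  then have "T.indep_vars (\<lambda>_. borel) (\<lambda>i w. fst (w i)) {..j}"
    by (rule T.indep_vars_subset) simp
  from T.exponential_distributed_sum[OF _ _ l interarrival_distributed[OF l] this]
  show ?thesis by simp
qed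

lemma measure_jsq_le_task:
  assumes E: "{w. P w} \<in> sets (task_space N l d)" and l: "0 < l"
    and c: "measure (task_space N l d) {w. P w} \<le> c"
  shows "measure (jsq_space N l d init) {\<omega>. P (snd (snd \<omega>))} \<le> c"
proof -
  interpret M: prob_space "jsq_space N l d init" by (rule prob_space_jsq[OF l])
  interpret T: prob_space "task_space N l d" by (rule prob_space_task[OF l])
  have "(\<lambda>\<omega>. snd (snd \<omega>)) \<in> jsq_space N l d init \<rightarrow>\<^sub>M task_space N l d"
    unfolding jsq_space_eq by measurable
  from measurable_sets[OF this E] have E': "{\<omega>. P (snd (snd \<omega>))} \<in> sets (jsq_space N l d init)"
    by (simp add: vimage_def)
  have "emeasure (jsq_space N l d init) {\<omega>. P (snd (snd \<omega>))}
      = (\<integral>\<^sup>+ \<omega>. indicator {\<omega>. P (snd (snd \<omega>))} \<omega> \<partial>jsq_space N l d init)"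
    using E' by simp
  also have "\<dots> \<le> ennreal c"
  proof (rule nn_integral_jsq_le_task[OF _ l])
    fix x0 s0
    have "(\<integral>\<^sup>+ w. indicator {\<omega>. P (snd (snd \<omega>))} (x0, s0, w) \<partial>task_space N l d)
        = (\<integral>\<^sup>+ w. indicator {w. P w} w \<partial>task_space N l d)"
      by (intro nn_integral_cong) (simp add: indicator_def)
    also have "\<dots> \<le> ennreal c" using E c by (simp add: T.emeasure_eq_measure ennreal_leI)
    finally show "(\<integral>\<^sup>+ w. indicator {\<omega>. P (snd (snd \<omega>))} (x0, s0, w) \<partial>task_space N l d) \<le> ennreal c" .
  qed (use E' in simp)
  finally show ?thesis
    using order.trans[OF measure_nonneg c] by (simp add: M.emeasure_eq_measure)
qed

lemma measure_jsq_le_service: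
  assumes E: "{s. P s} \<in> sets service_space" and l: "0 < l"
    and c: "measure service_space {s. P s} \<le> c"
  shows "measure (jsq_space N l d init) {\<omega>. P (fst (snd \<omega>))} \<le> c"
proof -
  interpret M: prob_space "jsq_space N l d init" by (rule prob_space_jsq[OF l])
  interpret S: prob_space service_space by (rule prob_space_service)
  have "(\<lambda>\<omega>. fst (snd \<omega>)) \<in> jsq_space N l d init \<rightarrow>\<^sub>M service_space"
    unfolding jsq_space_eq by measurable
  from measurable_sets[OF this E] have E': "{\<omega>. P (fst (snd \<omega>))} \<in> sets (jsq_space N l d init)"
    by (simp add: vimage_def)
  have "emeasure (jsq_space N l d init) {\<omega>. P (fst (snd \<omega>))}
      = (\<integral>\<^sup>+ \<omega>. indicator {\<omega>. P (fst (snd \<omega>))} \<omega> \<partial>jsq_space N l d init)"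
    using E' by simp
  also have "\<dots> \<le> ennreal c"
  proof (rule nn_integral_jsq_le_service[OF _ l AE_I2])
    fix x0 w
    have "(\<integral>\<^sup>+ s. indicator {\<omega>. P (fst (snd \<omega>))} (x0, s, w) \<partial>service_space)
        = (\<integral>\<^sup>+ s. indicator {s. P s} s \<partial>service_space)"
      by (intro nn_integral_cong) (simp add: indicator_def)
    also have "\<dots> \<le> ennreal c" using E c by (simp add: S.emeasure_eq_measure ennreal_leI)
    finally show "(\<integral>\<^sup>+ s. indicator {\<omega>. P (fst (snd \<omega>))} (x0, s, w) \<partial>service_space) \<le> ennreal c" .
  qed (use E' in simp)
  finally show ?thesis
    using order.trans[OF measure_nonneg c] by (simp add: M.emeasure_eq_measure)
qed

lemma measure_jsq_initial:
  assumes l: "0 < l"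
  shows "measure (jsq_space N l d init) {\<omega>. P (fst \<omega>)} = measure (measure_pmf init) {x. P x}"
proof -
  interpret R: prob_space "service_space \<Otimes>\<^sub>M task_space N l d"
    by (intro prob_space_pair prob_space_service prob_space_task l)
  have "measure (measure_pmf init) {x. P x}
      = measure (distr (jsq_space N l d init) (measure_pmf init) fst) {x. P x}"
    unfolding jsq_space_eq by (subst R.distr_pair_fst) simp
  also have "\<dots> = measure (jsq_space N l d init) (fst -` {x. P x} \<inter> space (jsq_space N l d init))"
    by (rule measure_distr) (simp_all add: jsq_space_eq)
  finally show ?thesis by (simp add: vimage_def)
qed

lemma arrival_time_deviation:
  assumes l: "0 < l" and c: "0 < c"
  shows "measure (jsq_space N l d init)
      {\<omega>. c \<le> \<bar>arrival_time \<omega> j - real (Suc j) / l\<bar>} \<le> real (Suc j) / (l * c)\<^sup>2"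
proof -
  interpret T: prob_space "task_space N l d" by (rule prob_space_task[OF l])
  let ?X = "\<lambda>w. \<Sum>i\<le>j. fst (w i)"
  note D = arrival_time_distributed[OF l, of N d j]
  have mean: "T.expectation ?X = real (Suc j) / l"
    using T.erlang_ith_moment[OF l D, of 1] by (simp add: fact_reduce)
  have var: "T.variance ?X = real (Suc j) / l\<^sup>2"
    using T.erlang_distributed_variance[OF l D] by simp
  have "T.prob {w \<in> space (task_space N l d). c \<le> \<bar>?X w - T.expectation ?X\<bar>} \<le> T.variance ?X / c\<^sup>2"
    by (rule T.Chebyshev_inequality[OF _ T.erlang_ith_moment_integrable[OF l D] c]) measurable
  then have "T.prob {w. c \<le> \<bar>?X w - real (Suc j) / l\<bar>} \<le> real (Suc j) / (l * c)\<^sup>2"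
    unfolding var unfolding mean by (simp add: power_mult_distrib)
  moreover have "{w \<in> space (task_space N l d). c \<le> \<bar>?X w - real (Suc j) / l\<bar>} \<in> sets (task_space N l d)"
    by measurable
  ultimately show ?thesis
    unfolding arrival_time_eq by (intro measure_jsq_le_task l) simp_all
qed

text \<open>
  By Chebyshev's inequality \<open>P (arrival_time j \<le> t) \<le> 4 / (j + 1)\<close> once \<open>t\<close> is below half the
  mean of the \<open>j\<close>-th arrival time.
\<close>

lemma arrivals_unbounded:
  assumes l: "0 < l"
  shows "AE \<omega> in jsq_space N l d init. \<forall>t. \<exists>j. t < arrival_time \<omega> j"
proof -
  interpret M: prob_space "jsq_space N l d init" by (rule prob_space_jsq[OF l])
  interpret measurable_sample "jsq_space N l d init" N "clean N" by (rule measurable_sample_jsq)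
  have at: "arrival_time (clean N \<omega>) j = arrival_time \<omega> j" for \<omega> j
    by (simp add: arrival_time_eq)
  have [measurable]: "(\<lambda>\<omega>. arrival_time \<omega> j) \<in> borel_measurable (jsq_space N l d init)" for j
    using arrival_time_measurable[of j] by (simp add: at)
  have "AE \<omega> in jsq_space N l d init. \<exists>j. real t < arrival_time \<omega> j" for t :: nat
  proof -
    let ?B = "{\<omega>. \<forall>j. arrival_time \<omega> j \<le> real t}"
    have "{\<omega> \<in> space (jsq_space N l d init). \<forall>j. arrival_time \<omega> j \<le> real t} \<in> sets (jsq_space N l d init)"
      by measurable
    then have B: "?B \<in> sets (jsq_space N l d init)" by simp
    have "M.prob ?B \<le> 4 / real (Suc j)" if j: "2 * l * real t \<le> real j" for j
    proof -
      let ?c = "real (Suc j) / (2 * l)"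
      have c: "0 < ?c" using l by simp
      have tc: "real t \<le> ?c" using j l by (simp add: field_simps)
      have "{\<omega> \<in> space (jsq_space N l d init). ?c \<le> \<bar>arrival_time \<omega> j - real (Suc j) / l\<bar>} \<in> M.events"
        by measurable
      then have "M.prob ?B \<le> M.prob {\<omega>. ?c \<le> \<bar>arrival_time \<omega> j - real (Suc j) / l\<bar>}"
      proof (intro M.finite_measure_mono)
        show "?B \<subseteq> {\<omega>. ?c \<le> \<bar>arrival_time \<omega> j - real (Suc j) / l\<bar>}"
        proof safe
          fix \<omega> assume "\<forall>j. arrival_time \<omega> j \<le> real t"
          then have "arrival_time \<omega> j \<le> ?c" using tc order.trans by blast
          moreover have "real (Suc j) / l = ?c + ?c" using l by (simp add: field_simps)
          ultimately show "?c \<le> \<bar>arrival_time \<omega> j - real (Suc j) / l\<bar>" by linarith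
        qed
      qed simp
      also have "\<dots> \<le> real (Suc j) / (l * ?c)\<^sup>2"
        by (rule arrival_time_deviation[OF l c])
      also have "\<dots> = 4 / real (Suc j)"
      proof -
        have "l * ?c = real (Suc j) / 2" using l by simp
        moreover have "q / (q / 2)\<^sup>2 = 4 / q" if "0 < q" for q :: real
          using that by (simp add: power2_eq_square field_simps)
        ultimately show ?thesis by (simp only: of_nat_0_less_iff zero_less_Suc)
      qed
      finally show ?thesis .
    qed
    then have "eventually (\<lambda>j. M.prob ?B \<le> 4 / real (Suc j)) sequentially"
      by (intro eventually_sequentiallyI[of "nat \<lceil>2 * l * real t\<rceil>"]) (simp add: nat_ceiling_le_eq)
    moreover have "(\<lambda>j. 4 / real (Suc j)) \<longlonglongrightarrow> 0" by real_asymp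
    ultimately have "M.prob ?B \<le> 0"
      using tendsto_lowerbound[OF _ _ trivial_limit_sequentially] by blast
    then have "emeasure (jsq_space N l d init) ?B = 0"
      using measure_nonneg[of "jsq_space N l d init" ?B]
      by (simp add: M.emeasure_eq_measure)
    with B show ?thesis
      by (intro AE_I[of _ _ ?B]) (auto simp: not_less)
  qed
  then have "AE \<omega> in jsq_space N l d init. \<forall>t::nat. \<exists>j. real t < arrival_time \<omega> j"
    by (subst AE_all_countable) simp
  then show ?thesis
  proof (rule eventually_mono, intro allI)
    fix \<omega> and t :: real assume *: "\<forall>t::nat. \<exists>j. real t < arrival_time \<omega> j"
    obtain m :: nat where "t < real m" using reals_Archimedean2 by blast
    then show "\<exists>j. t < arrival_time \<omega> j" using * by (meson order.strict_trans)
  qed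
qed

text \<open>
  Hoeffding's inequality for the number of initial services that exceed \<open>T\<close>, independent events of
  probability \<open>exp (- T)\<close> each.
\<close>

lemma long_services_deviation:
  assumes l: "0 < l" and T: "0 \<le> T" and c: "0 \<le> c" and N: "0 < N"
  shows "measure (jsq_space N' l d init)
      {\<omega>. real N * exp (- T) + c \<le> real (card {n. n < N \<and> T < fst (snd \<omega>) (n, 0)})}
    \<le> exp (- 2 * c\<^sup>2 / real N)"
proof -
  interpret S: prob_space service_space by (rule prob_space_service)
  let ?I = "(\<lambda>n. (n, 0 :: nat)) ` {..<N}"
  let ?X = "\<lambda>p s. of_bool (T < s p) :: real"
  have "S.indep_vars (\<lambda>_. exponential 1) (\<lambda>p s. s p) UNIV"
    unfolding service_space_def by (intro indep_vars_PiM_coordinates prob_space_exponential) simp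
  then have "S.indep_vars (\<lambda>_. borel) ?X UNIV"
    by (rule S.indep_vars_compose2) simp
  then have ind: "S.indep_vars (\<lambda>_. borel) ?X ?I"
    by (rule S.indep_vars_subset) simp
  interpret H: Hoeffding_ineq service_space ?I ?X "\<lambda>_. 0" "\<lambda>_. 1" "\<Sum>p\<in>?I. S.expectation (?X p)"
    by unfold_locales (auto simp: ind)
  have mean: "S.expectation (?X p) = exp (- T)" for p
  proof -
    have "S.expectation (?X p) = S.expectation (indicator {s. T < s p})"
      by (intro Bochner_Integration.integral_cong) (auto simp: indicator_def)
    also have "\<dots> = S.prob {s \<in> space service_space. s p \<in> {T<..} \<and> True}" by simp
    also have "\<dots> = measure (exponential 1) {T<..}"
      using measure_PiM_resample[of "\<lambda>_. exponential 1" "{T<..}" p "\<lambda>_. True"]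
        S.prob_space by (simp add: prob_space_exponential flip: service_space_def)
    finally show ?thesis by (simp add: measure_exponential_tails[OF T])
  qed
  have inj: "inj_on (\<lambda>n. (n, 0 :: nat)) A" for A :: "nat set" by (simp add: inj_on_def)
  have cI: "card ?I = N" by (simp add: card_image inj)
  have sum: "(\<Sum>p\<in>?I. ?X p s) = real (card {n. n < N \<and> T < s (n, 0)})" for s
  proof -
    have "(\<Sum>p\<in>?I. ?X p s) = (\<Sum>n<N. of_bool (T < s (n, 0)))"
      by (subst sum.reindex[OF inj]) simp
    also have "\<dots> = of_nat (card ({..<N} \<inter> {n. T < s (n, 0)}))"
      by (rule sum_of_bool_eq) auto
    also have "{..<N} \<inter> {n. T < s (n, 0)} = {n. n < N \<and> T < s (n, 0)}" by auto
    finally show ?thesis by simp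
  qed
  have "S.prob {s \<in> space service_space. (\<Sum>p\<in>?I. ?X p s) \<ge> real N * exp (- T) + c}
      \<le> exp (- 2 * c\<^sup>2 / real N)"
    using H.Hoeffding_ineq_ge[OF c] N by (simp add: mean cI)
  then have "S.prob {s. real N * exp (- T) + c \<le> real (card {n. n < N \<and> T < s (n, 0)})}
      \<le> exp (- 2 * c\<^sup>2 / real N)"
    unfolding sum by simp
  moreover have "{s \<in> space service_space. real N * exp (- T) + c \<le> (\<Sum>p\<in>?I. ?X p s)} \<in> sets service_space"
    by measurable
  ultimately show ?thesis
    unfolding sum by (intro measure_jsq_le_service l) simp_all
qed

section \<open>A Skorohod-continuous functional detecting an early descent\<close>

definition clamp_below :: "real \<Rightarrow> real \<Rightarrow> real" where
  "clamp_below K v = max (- 1) (min 0 (v + K))"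

text \<open>
  The summand \<open>s\<close> makes early times cheap: the value is close to \<open>-1\<close> only if the path gets close to
  \<open>- K - 1\<close> or below soon after 0. Unlike an infimum over a fixed time interval, which is discontinuous
  at paths jumping at the right end point, this infimum over all times is \<open>J\<^sub>1\<close>-continuous.
\<close>

definition early_descent :: "real \<Rightarrow> (real \<Rightarrow> nat \<Rightarrow> real) \<Rightarrow> real" where
  "early_descent K x = (INF s\<in>{0..}. clamp_below K (x s 1) + s)"

lemma clamp_below_bounds: "- 1 \<le> clamp_below K v" "clamp_below K v \<le> 0"
  by (auto simp: clamp_below_def)

lemma clamp_below_lipschitz: "\<bar>clamp_below K v - clamp_below K w\<bar> \<le> \<bar>v - w\<bar>"
  by (auto simp: clamp_below_def max_def min_def)

lemma bdd_below_early_descent: "bdd_below ((\<lambda>s. clamp_below K (x s 1) + s) ` {0..})"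
proof (rule bdd_belowI2[of _ "- 1"])
  fix s :: real assume "s \<in> {0..}"
  then show "- 1 \<le> clamp_below K (x s 1) + s"
    using clamp_below_bounds(1)[of K "x s 1"] by simp
qed

lemma early_descent_le: "0 \<le> s \<Longrightarrow> early_descent K x \<le> clamp_below K (x s 1) + s"
  unfolding early_descent_def by (rule cINF_lower[OF bdd_below_early_descent]) simp

lemma early_descent_ge:
  "(\<And>s. 0 \<le> s \<Longrightarrow> c \<le> clamp_below K (x s 1) + s) \<Longrightarrow> c \<le> early_descent K x"
  unfolding early_descent_def by (rule cINF_greatest) auto

lemma early_descent_bounds: "- 1 \<le> early_descent K x" "early_descent K x \<le> 0"
proof -
  show "- 1 \<le> early_descent K x"
  proof (rule early_descent_ge)
    fix s :: real assume "0 \<le> s"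
    then show "- 1 \<le> clamp_below K (x s 1) + s"
      using clamp_below_bounds(1)[of K "x s 1"] by linarith
  qed
  show "early_descent K x \<le> 0"
    using early_descent_le[of 0 K x] clamp_below_bounds(2)[of K "x 0 1"] by linarith
qed

lemma dist_coordinate_le:
  fixes x y :: "'i::countable \<Rightarrow> 'a::metric_space"
  shows "(1 / 2) ^ to_nat i * min (dist (x i) (y i)) 1 \<le> dist x y"
proof -
  have s: "summable (\<lambda>n. (1/2)^n * min (dist (x (from_nat n)) (y (from_nat n))) 1)"
    by (rule summable_comparison_test'[of "\<lambda>n. (1/2)^n"]) (auto simp: summable_geometric_iff)
  show ?thesis
    unfolding dist_fun_def using sum_le_suminf[OF s, of "{to_nat i}"] by auto
qed

lemma dist_coordinate_less:
  fixes x y :: "'i::countable \<Rightarrow> 'a::metric_space"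
  assumes "dist x y < (1 / 2) ^ to_nat i * e" "e \<le> 1"
  shows "dist (x i) (y i) < e"
proof -
  have "(1 / 2) ^ to_nat i * min (dist (x i) (y i)) 1 < (1 / 2) ^ to_nat i * e"
    using dist_coordinate_le[of i x y] assms(1) by linarith
  then have "min (dist (x i) (y i)) 1 < e" by (simp add: mult_less_cancel_left_pos)
  then show ?thesis using assms(2) by linarith
qed

text \<open>
  Since the value is nonpositive and the clamped term at least \<open>-1\<close>, only times up to 1 matter, up
  to 2 after a time change.
\<close>

lemma early_descent_near:
  assumes onto: "\<tau> ` {0..} = {0..}" and e: "e < 1"
    and tau: "\<And>s. 0 \<le> s \<Longrightarrow> \<bar>\<tau> s - s\<bar> < e"
    and near: "\<And>s. 0 \<le> s \<Longrightarrow> s \<le> 2 \<Longrightarrow> \<bar>y (\<tau> s) 1 - x s 1\<bar> < e"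
  shows "\<bar>early_descent K y - early_descent K x\<bar> \<le> 2 * e"
proof -
  have tau0: "0 \<le> \<tau> s" if "0 \<le> s" for s using onto that by auto
  have e0: "0 < e" using tau[of 0] by linarith
  have lip: "\<bar>clamp_below K (y (\<tau> s) 1) - clamp_below K (x s 1)\<bar> < e" if "0 \<le> s" "s \<le> 2" for s
    using clamp_below_lipschitz near[OF that] by (rule order.strict_trans1)
  have "early_descent K y - 2 * e \<le> early_descent K x"
  proof (rule early_descent_ge)
    fix s :: real assume s: "0 \<le> s"
    show "early_descent K y - 2 * e \<le> clamp_below K (x s 1) + s"
    proof (cases "s \<le> 2")
      case True
      then show ?thesis
        using early_descent_le[OF tau0[OF s], of K y] lip[OF s True] tau[OF s] by linarith
    next
      case False
      then show ?thesis
        using early_descent_bounds(2)[of K y] clamp_below_bounds(1)[of K "x s 1"] e0 by linarith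
    qed
  qed
  moreover have "early_descent K x - 2 * e \<le> early_descent K y"
  proof (rule early_descent_ge)
    fix r :: real assume "0 \<le> r"
    then have "r \<in> \<tau> ` {0..}" using onto by simp
    then obtain s where s: "0 \<le> s" "r = \<tau> s" by auto
    show "early_descent K x - 2 * e \<le> clamp_below K (y r 1) + r"
    proof (cases "s \<le> 2")
      case True
      then show ?thesis
        unfolding s(2)
        using early_descent_le[OF s(1), of K x] lip[OF s(1) True] tau[OF s(1)] by linarith
    next
      case False
      then show ?thesis
        using early_descent_bounds(2)[of K x] clamp_below_bounds(1)[of K "y r 1"] tau[OF s(1)] s(2) e e0
        by linarith
    qed
  qed
  ultimately show ?thesis by linarith
qed

lemma early_descent_J1_continuous:
  assumes "J1_converges xs x"
  shows "(\<lambda>n. early_descent K (xs n)) \<longlonglongrightarrow> early_descent K x"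
proof (rule tendstoI)
  fix r :: real assume r: "0 < r"
  obtain \<tau> where tc: "\<And>n. time_change (\<tau> n)"
    and ul: "uniform_limit {0..} \<tau> (\<lambda>t. t) sequentially"
    and ux: "\<forall>T\<ge>0. uniform_limit {0..T} (\<lambda>n t. xs n (\<tau> n t)) x sequentially"
    using assms unfolding J1_converges_def by blast
  define e where "e = min (1 / 2) (r / 3)"
  have e: "0 < e" "e < 1" "2 * e < r" using r by (auto simp: e_def)
  have 1: "\<forall>\<^sub>F n in sequentially. \<forall>s\<in>{0..}. dist (\<tau> n s) s < e"
    using uniform_limitD[OF ul e(1)] .
  have "uniform_limit {0..2} (\<lambda>n t. xs n (\<tau> n t)) x sequentially" using ux by simp
  then have 2: "\<forall>\<^sub>F n in sequentially. \<forall>s\<in>{0..2}. dist (xs n (\<tau> n s)) (x s) < (1 / 2) ^ to_nat (1::nat) * e"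
    by (rule uniform_limitD) (use e in simp)
  from 1 2 show "\<forall>\<^sub>F n in sequentially. dist (early_descent K (xs n)) (early_descent K x) < r"
  proof eventually_elim
    case (elim n)
    have "\<bar>early_descent K (xs n) - early_descent K x\<bar> \<le> 2 * e"
    proof (rule early_descent_near[where \<tau> = "\<tau> n"])
      show "\<tau> n ` {0..} = {0..}" using tc[of n] by (simp add: time_change_def)
      show "\<bar>\<tau> n s - s\<bar> < e" if "0 \<le> s" for s using elim(1) that by (auto simp: dist_real_def)
      show "\<bar>xs n (\<tau> n s) 1 - x s 1\<bar> < e" if "0 \<le> s" "s \<le> 2" for s
        using dist_coordinate_less[of "xs n (\<tau> n s)" "x s" 1 e] elim(2) that e(2)
        by (auto simp: dist_real_def)
    qed (rule e(2))
    then show ?case using e(3) by (simp add: dist_real_def)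
  qed
qed

lemma continuous_map_early_descent: "continuous_map skorohod_J1 euclideanreal (early_descent K)"
  unfolding continuous_map_def
proof (intro conjI allI impI)
  fix U :: "real set" assume "openin euclideanreal U"
  then have U: "open U" by simp
  show "openin skorohod_J1 {x \<in> topspace skorohod_J1. early_descent K x \<in> U}"
    unfolding openin_skorohod_J1 topspace_skorohod_J1 J1_open_def
  proof (intro conjI ballI allI impI)
    fix x and xs :: "nat \<Rightarrow> real \<Rightarrow> nat \<Rightarrow> real"
    assume x: "x \<in> {x \<in> cadlag. early_descent K x \<in> U}" and xs: "range xs \<subseteq> cadlag" "J1_converges xs x"
    have "\<forall>\<^sub>F n in sequentially. early_descent K (xs n) \<in> U"
      using topological_tendstoD[OF early_descent_J1_continuous[OF xs(2)] U] x by simp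
    then show "\<forall>\<^sub>F n in sequentially. xs n \<in> {x \<in> cadlag. early_descent K x \<in> U}"
      by (rule eventually_mono) (use xs(1) in auto)
  qed auto
qed auto

text \<open>
  If the path started above \<open>- K - 1\<close>, right-continuity would keep the clamped term away from \<open>-1\<close>
  for a while, and afterwards the summand \<open>s\<close> is bounded away from 0.
\<close>

lemma early_descent_minimal:
  assumes x: "x \<in> cadlag" and G: "early_descent K x \<le> - 1"
  shows "x 0 1 \<le> - K - 1"
proof (rule ccontr)
  assume "\<not> x 0 1 \<le> - K - 1"
  then have gap: "- 1 < clamp_below K (x 0 1)" by (auto simp: clamp_below_def)
  define h where "h = (clamp_below K (x 0 1) + 1) / 2"
  have h: "0 < h" "- 1 + h < clamp_below K (x 0 1)" using gap by (auto simp: h_def field_simps)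
  have "(x \<longlongrightarrow> x 0) (at_right 0)"
    using x by (auto simp: cadlag_def continuous_within)
  moreover have "continuous_on UNIV (\<lambda>f :: nat \<Rightarrow> real. f 1)"
    by (rule continuous_on_product_coordinates)
  then have "isCont (\<lambda>f :: nat \<Rightarrow> real. f 1) (x 0)"
    by (rule continuous_on_interior) simp
  ultimately have "((\<lambda>s. x s 1) \<longlongrightarrow> x 0 1) (at_right 0)"
    by (rule isCont_tendsto_compose[rotated])
  then have "((\<lambda>s. clamp_below K (x s 1)) \<longlongrightarrow> clamp_below K (x 0 1)) (at_right 0)"
    unfolding clamp_below_def by (intro tendsto_intros)
  then have "\<forall>\<^sub>F s in at_right 0. - 1 + h < clamp_below K (x s 1)"
    using h(2) by (rule order_tendstoD)
  then obtain \<delta> where \<delta>: "0 < \<delta>" "\<And>s. 0 < s \<Longrightarrow> s < \<delta> \<Longrightarrow> - 1 + h < clamp_below K (x s 1)"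
    unfolding eventually_at_right_field by blast
  have "- 1 + min h \<delta> \<le> early_descent K x"
  proof (rule early_descent_ge)
    fix s :: real assume s: "0 \<le> s"
    consider "s = 0" | "0 < s" "s < \<delta>" | "\<delta> \<le> s" using s by linarith
    then show "- 1 + min h \<delta> \<le> clamp_below K (x s 1) + s"
    proof cases
      case 1
      then show ?thesis using h(2) by simp
    next
      case 2
      then show ?thesis using \<delta>(2)[of s] by linarith
    next
      case 3
      then show ?thesis using clamp_below_bounds(1)[of K "x s 1"] by linarith
    qed
  qed
  with G h(1) \<delta>(1) show False by (simp add: min_def split: if_splits)
qed

text \<open>
  Weak convergence would give \<open>early_descent K\<close> the mean \<open>-1\<close>, its minimum, under the limit, for
  every \<open>K\<close>. Measurability of the functional along \<open>Y\<close> comes for free: the Bochner integral of a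
  nonintegrable function is 0, so a value of at most \<open>-1\<close> entails integrability.
\<close>

lemma not_weakly_converges_J1_if_descent:
  fixes Y :: "'v \<Rightarrow> real \<Rightarrow> nat \<Rightarrow> real"
  assumes P: "prob_space P" and Y: "\<And>\<omega>. \<omega> \<in> space P \<Longrightarrow> Y \<omega> \<in> cadlag"
    and descent: "\<And>K \<eta>. 0 < \<eta> \<Longrightarrow>
      \<forall>\<^sub>F N in sequentially. (\<integral>\<omega>. early_descent K (X N \<omega>) \<partial>completion (M N)) \<le> - 1 + \<eta>"
  shows "\<not> weakly_converges_J1 M X P Y"
proof
  assume weak: "weakly_converges_J1 M X P Y"
  interpret P: prob_space P by (rule P)
  interpret C: prob_space "completion P"
    by (rule prob_spaceI) (simp add: P.emeasure_space_1)
  have "AE \<omega> in P. Y \<omega> 0 1 \<le> - real K - 1" for K :: nat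
  proof -
    let ?g = "\<lambda>\<omega>. early_descent (real K) (Y \<omega>)"
    have nonneg: "0 \<le> ?g \<omega> + 1" for \<omega>
      using early_descent_bounds(1)[of "real K" "Y \<omega>"] by linarith
    have "bounded (early_descent (real K) ` topspace skorohod_J1)"
    proof (rule boundedI[of _ 1])
      fix v assume "v \<in> early_descent (real K) ` topspace skorohod_J1"
      then obtain x where "v = early_descent (real K) x" by blast
      then show "norm v \<le> 1" using early_descent_bounds[of "real K" x] by simp
    qed
    then have lim: "(\<lambda>N. \<integral>\<omega>. early_descent (real K) (X N \<omega>) \<partial>completion (M N))
        \<longlonglongrightarrow> (\<integral>\<omega>. ?g \<omega> \<partial>completion P)"
      using weak continuous_map_early_descent unfolding weakly_converges_J1_def by blast
    have le: "(\<integral>\<omega>. ?g \<omega> \<partial>completion P) \<le> - 1"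
    proof (rule field_le_epsilon)
      fix \<eta> :: real assume "0 < \<eta>"
      from tendsto_upperbound[OF lim descent[OF this]]
      show "(\<integral>\<omega>. ?g \<omega> \<partial>completion P) \<le> - 1 + \<eta>" by simp
    qed
    then have int: "integrable (completion P) ?g"
      using not_integrable_integral_eq[of "completion P" ?g] by fastforce
    then have int1: "integrable (completion P) (\<lambda>\<omega>. ?g \<omega> + 1)" by simp
    have "(\<integral>\<omega>. ?g \<omega> + 1 \<partial>completion P) = (\<integral>\<omega>. ?g \<omega> \<partial>completion P) + 1"
      using int C.prob_space by (subst Bochner_Integration.integral_add) simp_all
    moreover have "0 \<le> (\<integral>\<omega>. ?g \<omega> + 1 \<partial>completion P)"
      by (intro integral_nonneg_AE AE_I2 nonneg)
    ultimately have "(\<integral>\<omega>. ?g \<omega> + 1 \<partial>completion P) = 0" using le by linarith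
    moreover have "AE \<omega> in completion P. 0 \<le> ?g \<omega> + 1"
      by (intro AE_I2 nonneg)
    ultimately have "AE \<omega> in completion P. ?g \<omega> + 1 = 0"
      using integral_nonneg_eq_0_iff_AE[OF int1] by simp
    then have "AE \<omega> in P. ?g \<omega> + 1 = 0" by (simp add: AE_completion_iff)
    then show ?thesis
    proof (rule AE_mp, intro AE_I2 impI)
      fix \<omega> assume "\<omega> \<in> space P" "?g \<omega> + 1 = 0"
      then show "Y \<omega> 0 1 \<le> - real K - 1" by (intro early_descent_minimal Y) linarith+
    qed
  qed
  then have "AE \<omega> in P. \<forall>K::nat. Y \<omega> 0 1 \<le> - real K - 1"
    by (subst AE_all_countable) simp
  then have "AE \<omega> in P. False"
  proof (rule eventually_mono)
    fix \<omega> assume *: "\<forall>K::nat. Y \<omega> 0 1 \<le> - real K - 1"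
    obtain K :: nat where "- Y \<omega> 0 1 < real K" using reals_Archimedean2 by blast
    with spec[OF *, of K] show False by linarith
  qed
  then show False by simp
qed

section \<open>Descent for a fixed number of servers\<close>

lemma eventually_pending_const: "\<forall>\<^sub>F r in at_right s. pending D r = pending D s"
proof (induction D)
  case Nil
  show ?case by (simp add: pending_def)
next
  case (Cons u D)
  have "\<forall>\<^sub>F r in at_right s. (r < u) = (s < u)"
  proof (cases "s < u")
    case True
    then show ?thesis using eventually_at_right_real[OF True] by (auto elim!: eventually_mono)
  next
    case False
    then have "\<forall>\<^sub>F r in at_right s. \<not> r < u"
      using eventually_at_right_less[of s] by (auto elim!: eventually_mono)
    with False show ?thesis by (auto elim!: eventually_mono)
  qed
  with Cons show ?case by eventually_elim (simp add: pending_def)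
qed

lemma eventually_queue_length_const:
  assumes pos: "\<forall>j. 0 < fst (snd (snd \<omega>) j)" and unb: "\<forall>t. \<exists>j. t < arrival_time \<omega> j"
  shows "\<forall>\<^sub>F r in at_right s. queue_length b \<omega> r n = queue_length b \<omega> s n"
proof -
  define A where "A = card {j. arrival_time \<omega> j \<le> s}"
  obtain a where "s < arrival_time \<omega> a" using unb by blast
  then have A: "{j. arrival_time \<omega> j \<le> s} = {..<A}"
    unfolding A_def by (rule card_arrivals[OF pos])
  then have sA: "s < arrival_time \<omega> A" by (metis lessThan_iff less_irrefl mem_Collect_eq not_le)
  have "\<forall>\<^sub>F r in at_right s. r \<in> {s<..<arrival_time \<omega> A}"
    by (rule eventually_at_right_real[OF sA])
  moreover have "\<forall>\<^sub>F r in at_right s. pending (schedule b \<omega> A n) r = pending (schedule b \<omega> A n) s"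
    by (rule eventually_pending_const)
  ultimately show ?thesis
  proof eventually_elim
    case (elim r)
    have "{j. arrival_time \<omega> j \<le> r} = {..<A}"
    proof safe
      fix j assume "arrival_time \<omega> j \<le> r"
      then have "arrival_time \<omega> j < arrival_time \<omega> A" using elim(1) by simp
      then show "j < A" using strict_mono_less[OF arrival_time_strict_mono[OF pos]] by simp
    next
      fix j assume "j < A"
      then have "arrival_time \<omega> j \<le> s" using A by blast
      then show "arrival_time \<omega> j \<le> r" using elim(1) by simp
    qed
    then show ?case using elim(2) A by (simp add: queue_length_def)
  qed
qed

lemma eventually_scaled_process_const:
  assumes "\<forall>j. 0 < fst (snd (snd \<omega>) j)" and "\<forall>t. \<exists>j. t < arrival_time \<omega> j"
  shows "\<forall>\<^sub>F r in at_right s. scaled_process N b \<omega> r 1 = scaled_process N b \<omega> s 1"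
proof -
  have "\<forall>\<^sub>F r in at_right s. \<forall>n\<in>{..<N}. queue_length b \<omega> r n = queue_length b \<omega> s n"
    by (intro eventually_ball_finite ballI eventually_queue_length_const assms) simp
  then show ?thesis
  proof eventually_elim
    case (elim r)
    then have "{n. n < N \<and> 1 \<le> queue_length b \<omega> r n} = {n. n < N \<and> 1 \<le> queue_length b \<omega> s n}"
      by auto
    then show ?case
      by (simp add: scaled_process_def scaled_occupancy_def occupancy_def)
  qed
qed

text \<open>
  This turns the infimum into a countable one and so yields measurability.
\<close>

lemma early_descent_eq_rational:
  assumes rc: "\<And>s. 0 \<le> s \<Longrightarrow> \<forall>\<^sub>F r in at_right s. x r 1 = x s 1"
  shows "early_descent K x = (INF r\<in>\<rat> \<inter> {0..}. clamp_below K (x r 1) + r)"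
proof (rule antisym)
  show "early_descent K x \<le> (INF r\<in>\<rat> \<inter> {0..}. clamp_below K (x r 1) + r)"
  proof (rule cINF_greatest)
    fix r :: real assume "r \<in> \<rat> \<inter> {0..}"
    then show "early_descent K x \<le> clamp_below K (x r 1) + r"
      by (intro early_descent_le) simp
  qed auto
  have bdd: "bdd_below ((\<lambda>r. clamp_below K (x r 1) + r) ` (\<rat> \<inter> {0..}))"
    by (rule bdd_below_mono[OF bdd_below_early_descent]) auto
  show "(INF r\<in>\<rat> \<inter> {0..}. clamp_below K (x r 1) + r) \<le> early_descent K x"
  proof (rule early_descent_ge, rule field_le_epsilon)
    fix s e :: real assume s: "0 \<le> s" and e: "0 < e"
    from rc[OF s] obtain y where y: "s < y" "\<And>r. s < r \<Longrightarrow> r < y \<Longrightarrow> x r 1 = x s 1"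
      unfolding eventually_at_right_field by blast
    obtain r where r: "r \<in> \<rat>" "s < r" "r < min y (s + e)"
      using Rats_dense_in_real[of s "min y (s + e)"] y(1) e by auto
    have "(INF r\<in>\<rat> \<inter> {0..}. clamp_below K (x r 1) + r) \<le> clamp_below K (x r 1) + r"
      using r s by (intro cINF_lower[OF bdd]) auto
    also have "\<dots> \<le> clamp_below K (x s 1) + s + e" using r y(2)[of r] by simp
    finally show "(INF r\<in>\<rat> \<inter> {0..}. clamp_below K (x r 1) + r) \<le> clamp_below K (x s 1) + s + e" .
  qed
qed

lemma borel_measurable_completion_AE:
  fixes G H :: "'w \<Rightarrow> 'b::topological_space"
  assumes H: "H \<in> borel_measurable M" and eq: "AE \<omega> in M. G \<omega> = H \<omega>"
  shows "G \<in> borel_measurable (completion M)"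
proof (rule measurableI)
  fix A :: "'b set" assume A: "A \<in> sets borel"
  obtain N where N: "{\<omega> \<in> space M. \<not> G \<omega> = H \<omega>} \<subseteq> N" "emeasure M N = 0" "N \<in> sets M"
    by (rule AE_E[OF eq])
  have split: "G -` A \<inter> space (completion M) = (H -` A \<inter> space M - N) \<union> (G -` A \<inter> space M \<inter> N)"
    using N(1) by auto
  have "H -` A \<inter> space M - N \<in> sets M"
    using measurable_sets[OF H A] N(3) by (rule sets.Diff)
  moreover have "G -` A \<inter> space M \<inter> N \<subseteq> N" by blast
  ultimately show "G -` A \<inter> space (completion M) \<in> sets (completion M)"
    unfolding split using N(2,3) by (intro sets_completionI[OF refl]) (auto simp: null_sets_def)
qed simp

lemma scaled_process_1:
  assumes "1 \<le> N"
  shows "scaled_process N b \<omega> t 1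
    = - (real (card {n. n < N \<and> queue_length b \<omega> t n = 0}) / sqrt (real N))"
proof -
  have "card {n. n < N \<and> 1 \<le> queue_length b \<omega> t n} + card {n. n < N \<and> queue_length b \<omega> t n = 0}
      = card ({n. n < N \<and> 1 \<le> queue_length b \<omega> t n} \<union> {n. n < N \<and> queue_length b \<omega> t n = 0})"
    by (intro card_Un_disjoint[symmetric]) auto
  also have "{n. n < N \<and> 1 \<le> queue_length b \<omega> t n} \<union> {n. n < N \<and> queue_length b \<omega> t n = 0} = {..<N}"
    by auto
  finally have "real (card {n. n < N \<and> 1 \<le> queue_length b \<omega> t n})
      + real (card {n. n < N \<and> queue_length b \<omega> t n = 0}) = real N"
    by (simp flip: of_nat_add)
  then show ?thesis
    by (simp add: scaled_process_def scaled_occupancy_def occupancy_def algebra_simps)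
qed

lemma measure_rescued_ge_le:
  assumes l: "0 < l" and d: "1 \<le> d" "d \<le> N" and T: "0 \<le> T" and u: "0 < u"
  shows "measure (jsq_space N l d init)
      {\<omega>. u \<le> real (card {n. n < N \<and> rescued b a T (clean N \<omega>) n})} \<le> (exp T - 1) * real a / u"
proof -
  interpret M: prob_space "jsq_space N l d init" by (rule prob_space_jsq[OF l])
  interpret measurable_sample "jsq_space N l d init" N "clean N" by (rule measurable_sample_jsq)
  let ?R = "\<lambda>\<omega>. real (card {n. n < N \<and> rescued b a T (clean N \<omega>) n})"
  note [measurable] = rescued_measurable
  have R[measurable]: "?R \<in> borel_measurable (jsq_space N l d init)" by measurable
  have "{\<omega> \<in> space (jsq_space N l d init). u \<le> ?R \<omega>} \<in> M.events" by measurable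
  then have E: "{\<omega>. u \<le> ?R \<omega>} \<in> M.events" by simp
  have "emeasure (jsq_space N l d init) {\<omega>. u \<le> ?R \<omega>}
      = (\<integral>\<^sup>+ \<omega>. indicator {\<omega>. u \<le> ?R \<omega>} \<omega> \<partial>jsq_space N l d init)"
    using E by simp
  also have "\<dots> \<le> (\<integral>\<^sup>+ \<omega>. ennreal (1 / u) * ennreal (?R \<omega>) \<partial>jsq_space N l d init)"
    using u by (intro nn_integral_mono) (auto simp: indicator_def simp flip: ennreal_mult)
  also have "\<dots> = ennreal (1 / u) * (\<integral>\<^sup>+ \<omega>. ennreal (?R \<omega>) \<partial>jsq_space N l d init)"
    by (rule nn_integral_cmult) measurable
  also have "\<dots> \<le> ennreal (1 / u) * ennreal ((exp T - 1) * real a)"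
  proof (intro mult_left_mono nn_integral_jsq_le_service[OF _ l])
    fix x0
    from AE_interarrival_pos[OF l, of N d] AE_selection[OF l d]
    show "AE task in task_space N l d. (\<integral>\<^sup>+ s0. ennreal (?R (x0, s0, task)) \<partial>service_space)
        \<le> ennreal ((exp T - 1) * real a)"
    proof eventually_elim
      case (elim task)
      have "clean N (x0, s0, task) = (x0, s0, task)" for s0
        using elim(2) by (auto simp: clean_def prod_eq_iff fun_eq_iff)
      then show ?case
        using nn_integral_rescued_le[of task N T b a x0] elim T by simp
    qed
  qed (use R in simp_all)
  also have "\<dots> = ennreal ((exp T - 1) * real a / u)"
    using u T by (simp flip: ennreal_mult)
  finally show ?thesis
    using u T by (simp add: M.emeasure_eq_measure)
qed

lemma AE_jsq_regular:
  assumes l: "0 < l" and d: "1 \<le> d" "d \<le> N"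
  shows "AE \<omega> in jsq_space N l d init. (\<forall>j. 0 < fst (snd (snd \<omega>) j))
    \<and> (\<forall>t. \<exists>j. t < arrival_time \<omega> j) \<and> (\<forall>j. sampled \<omega> j \<subseteq> {..<N} \<and> sampled \<omega> j \<noteq> {})
    \<and> clean N \<omega> = \<omega>"
proof -
  note 1 = AE_jsqI[OF l AE_interarrival_pos[OF l, of N d], where init = init]
  note 2 = AE_jsqI[OF l AE_selection[OF l d], where init = init]
  from 1 2 arrivals_unbounded[OF l, where N = N and d = d and init = init] show ?thesis
  proof eventually_elim
    case (elim \<omega>)
    then show ?case
      by (auto simp: sampled_def clean_def prod_eq_iff fun_eq_iff)
  qed
qed

text \<open>
  The deterministic core for fixed \<open>N\<close>: on the complement of six exceptional events the balance of
  \<open>few_idle_bound\<close> is violated, so the first coordinate must fall to \<open>- K - 1\<close> or below within the window.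
\<close>

lemma early_descent_if_typical:
  assumes pos: "\<forall>j. 0 < fst (snd (snd \<omega>) j)"
    and S: "\<forall>j. sampled \<omega> j \<subseteq> {..<N} \<and> sampled \<omega> j \<noteq> {}"
    and N: "1 \<le> N" and T: "0 \<le> T" and k: "(K + 1) * sqrt (real N) \<le> real k"
    and m: "1 \<le> m" "arrival_time \<omega> (m - 1) \<le> T" and a: "T < arrival_time \<omega> a"
    and long: "real (card {n. n < N \<and> T < fst (snd \<omega>) (n, 0)}) < real N * exp (- T) + u"
    and resc: "real (card {n. n < N \<and> rescued b a T \<omega> n}) < u"
    and two: "real (card {n. n < N \<and> 2 \<le> fst \<omega> n}) \<le> u"
    and miss: "miss_weight b N k \<omega> m < 2 powr (- z)"
    and z: "real k + real a + 3 * u + real N * exp (- T) - real N \<le> z"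
  shows "early_descent K (scaled_process N b \<omega>) \<le> - 1 + T"
proof -
  have "\<exists>t. 0 \<le> t \<and> t \<le> T \<and> scaled_process N b \<omega> t 1 \<le> - K - 1"
  proof (rule ccontr)
    assume neg: "\<not> ?thesis"
    have few: "\<forall>t. 0 \<le> t \<and> t \<le> T \<longrightarrow> card {n. n < N \<and> queue_length b \<omega> t n = 0} < k"
    proof (intro allI impI)
      fix t assume t: "0 \<le> t \<and> t \<le> T"
      let ?c = "real (card {n. n < N \<and> queue_length b \<omega> t n = 0})"
      have "- K - 1 < scaled_process N b \<omega> t 1"
        using neg t by (metis not_le)
      then have "- K - 1 < - (?c / sqrt (real N))"
        unfolding scaled_process_1[OF N] .
      then have "?c < (K + 1) * sqrt (real N)"
        using N by (simp add: field_simps)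
      then have "?c < real k" using k by linarith
      then show "card {n. n < N \<and> queue_length b \<omega> t n = 0} < k" by simp
    qed
    have tm: "\<forall>j<m. arrival_time \<omega> j \<le> T"
    proof (intro allI impI)
      fix j assume "j < m"
      then have "arrival_time \<omega> j \<le> arrival_time \<omega> (m - 1)"
        using strict_mono_less_eq[OF arrival_time_strict_mono[OF pos]] by simp
      with m show "arrival_time \<omega> j \<le> T" by linarith
    qed
    let ?Z = "card {j. j < m \<and> sampled \<omega> j \<inter> idle_before b N \<omega> j = {}}"
    note F = few_idle_bound[OF pos S T tm a few]
    have "2 powr (- real ?Z) = miss_weight b N k \<omega> m"
      unfolding miss_weight_eq_power[OF F(1)] by (simp add: powr_minus powr_realpow power_one_over inverse_eq_divide)
    with miss have "2 powr (- real ?Z) < 2 powr (- z)" by simp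
    then have "z < real ?Z" by simp
    moreover have "real (N + ?Z) \<le> real (k + a + card {n. n < N \<and> 2 \<le> fst \<omega> n}
        + card {n. n < N \<and> T < fst (snd \<omega>) (n, 0)} + card {n. n < N \<and> rescued b a T \<omega> n})"
      using F(2) by (rule of_nat_mono)
    ultimately show False
      using long resc two z by simp
  qed
  then obtain t where t: "0 \<le> t" "t \<le> T" "scaled_process N b \<omega> t 1 \<le> - K - 1" by blast
  have "early_descent K (scaled_process N b \<omega>) \<le> clamp_below K (scaled_process N b \<omega> t 1) + t"
    by (rule early_descent_le[OF t(1)])
  also have "clamp_below K (scaled_process N b \<omega> t 1) = - 1" using t(3) by (simp add: clamp_below_def)
  finally show ?thesis using t(2) by simp
qed

lemma integral_early_descent_le:
  fixes init :: "(nat \<Rightarrow> nat) pmf"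
  assumes l: "0 < l" and N: "1 \<le> N" and d: "1 \<le> d" "d \<le> N"
    and T: "0 \<le> T" and k: "(K + 1) * sqrt (real N) \<le> real k" and m: "1 \<le> m"
    and z: "real k + real a + 3 * u + real N * exp (- T) - real N \<le> z"
  defines "M \<equiv> jsq_space N l d init"
  shows "(\<integral>\<omega>. early_descent K (scaled_process N b \<omega>) \<partial>completion M) \<le> - 1 + T
    + (measure M {\<omega>. T < arrival_time \<omega> (m - 1)} + measure M {\<omega>. arrival_time \<omega> a \<le> T}
      + measure M {\<omega>. real N * exp (- T) + u \<le> real (card {n. n < N \<and> T < fst (snd \<omega>) (n, 0)})}
      + measure M {\<omega>. u \<le> real (card {n. n < N \<and> rescued b a T (clean N \<omega>) n})}
      + measure M {\<omega>. u < real (card {n. n < N \<and> 2 \<le> fst \<omega> n})}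
      + measure M {\<omega>. 2 powr (- z) \<le> miss_weight b N k (clean N \<omega>) m})"
proof -
  interpret M: prob_space M unfolding M_def by (rule prob_space_jsq[OF l])
  interpret measurable_sample M N "clean N" unfolding M_def by (rule measurable_sample_jsq)
  have spM: "space M = UNIV" by (simp add: M_def)
  let ?G = "\<lambda>\<omega>. early_descent K (scaled_process N b \<omega>)"
  \<comment> \<open>A measurable version of the functional.\<close>
  define H where "H \<omega> = (INF r\<in>\<rat> \<inter> {0..}. clamp_below K (scaled_process N b (clean N \<omega>) r 1) + r)" for \<omega>
  have Q: "(0::real) \<in> \<rat> \<inter> {0..}" by simp
  have bdd: "bdd_below ((\<lambda>r. clamp_below K (scaled_process N b \<omega> r 1) + r) ` (\<rat> \<inter> {0..}))" for \<omega>
    by (rule bdd_below_mono[OF bdd_below_early_descent]) auto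
  note [measurable] = queue_length_measurable rescued_measurable miss_weight_measurable
  have sm[measurable]: "(\<lambda>\<omega>. scaled_process N b (clean N \<omega>) r 1) \<in> borel_measurable M" for r
    unfolding scaled_process_1[OF N] by measurable
  have Hm: "H \<in> borel_measurable M"
    unfolding H_def
  proof (rule borel_measurable_cINF)
    show "countable (\<rat> \<inter> {0..} :: real set)" by (simp add: countable_rat)
    show "(\<lambda>\<omega>. clamp_below K (scaled_process N b (clean N \<omega>) r 1) + r) \<in> borel_measurable M" for r
      unfolding clamp_below_def by measurable
  qed (rule bdd)
  have GH: "AE \<omega> in M. ?G \<omega> = H \<omega>"
    using AE_jsq_regular[OF l d, of init] unfolding M_def[symmetric]
  proof eventually_elim
    case (elim \<omega>)
    have "?G \<omega> = (INF r\<in>\<rat> \<inter> {0..}. clamp_below K (scaled_process N b \<omega> r 1) + r)"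
      by (intro early_descent_eq_rational eventually_scaled_process_const) (use elim in blast)+
    moreover have "clean N \<omega> = \<omega>" using elim by blast
    ultimately show ?case by (simp add: H_def)
  qed
  have H01: "- 1 \<le> H \<omega>" "H \<omega> \<le> 0" for \<omega>
  proof -
    show "- 1 \<le> H \<omega>"
      unfolding H_def
    proof (rule cINF_greatest)
      fix r :: real assume "r \<in> \<rat> \<inter> {0..}"
      then show "- 1 \<le> clamp_below K (scaled_process N b (clean N \<omega>) r 1) + r"
        using clamp_below_bounds(1)[of K "scaled_process N b (clean N \<omega>) r 1"] by simp
    qed (use Q in blast)
    have "H \<omega> \<le> clamp_below K (scaled_process N b (clean N \<omega>) 0 1) + 0"
      unfolding H_def by (rule cINF_lower[OF bdd Q])
    then show "H \<omega> \<le> 0"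
      using clamp_below_bounds(2)[of K "scaled_process N b (clean N \<omega>) 0 1"] by linarith
  qed
  have Hint: "integrable M H"
  proof (rule M.integrable_const_bound[OF _ Hm])
    have "norm (H \<omega>) \<le> 1" for \<omega> using H01[of \<omega>] by simp
    then show "AE \<omega> in M. norm (H \<omega>) \<le> 1" by simp
  qed
  have at[measurable]: "(\<lambda>\<omega>. arrival_time \<omega> j) \<in> borel_measurable M" for j
    using arrival_time_measurable[of j] by (simp add: arrival_time_eq)
  have [measurable]: "(\<lambda>\<omega>. fst \<omega> n) \<in> M \<rightarrow>\<^sub>M count_space UNIV" "(\<lambda>\<omega>. fst (snd \<omega>) p) \<in> borel_measurable M" for n p
    using initial[of n] initial_service[of p] by simp_all
  define B1 where "B1 = {\<omega>. T < arrival_time \<omega> (m - 1)}"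
  define B2 where "B2 = {\<omega>. arrival_time \<omega> a \<le> T}"
  define B3 where "B3 = {\<omega> :: sample. real N * exp (- T) + u \<le> real (card {n. n < N \<and> T < fst (snd \<omega>) (n, 0)})}"
  define B4 where "B4 = {\<omega>. u \<le> real (card {n. n < N \<and> rescued b a T (clean N \<omega>) n})}"
  define B5 where "B5 = {\<omega> :: sample. u < real (card {n. n < N \<and> 2 \<le> fst \<omega> n})}"
  define B6 where "B6 = {\<omega>. 2 powr (- z) \<le> miss_weight b N k (clean N \<omega>) m}"
  have "{\<omega> \<in> space M. T < arrival_time \<omega> (m - 1)} \<in> M.events"
    "{\<omega> \<in> space M. arrival_time \<omega> a \<le> T} \<in> M.events"
    "{\<omega> \<in> space M. real N * exp (- T) + u \<le> real (card {n. n < N \<and> T < fst (snd \<omega>) (n, 0)})} \<in> M.events"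
    "{\<omega> \<in> space M. u \<le> real (card {n. n < N \<and> rescued b a T (clean N \<omega>) n})} \<in> M.events"
    "{\<omega> \<in> space M. u < real (card {n. n < N \<and> 2 \<le> fst \<omega> n})} \<in> M.events"
    "{\<omega> \<in> space M. 2 powr (- z) \<le> miss_weight b N k (clean N \<omega>) m} \<in> M.events"
    by measurable
  then have Bs: "B1 \<in> M.events" "B2 \<in> M.events" "B3 \<in> M.events" "B4 \<in> M.events" "B5 \<in> M.events" "B6 \<in> M.events"
    by (simp_all add: spM B1_def B2_def B3_def B4_def B5_def B6_def)
  define B where "B = B1 \<union> B2 \<union> B3 \<union> B4 \<union> B5 \<union> B6"
  have BM: "B \<in> M.events" unfolding B_def using Bs by auto
  have Ble: "M.prob B \<le> M.prob B1 + M.prob B2 + M.prob B3 + M.prob B4 + M.prob B5 + M.prob B6"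
    unfolding B_def using Bs
    by (intro order.trans[OF measure_Un_le] add_mono order.refl sets.Un)
  have bound: "AE \<omega> in M. H \<omega> \<le> (- 1 + T) + indicator B \<omega>"
    using AE_jsq_regular[OF l d, of init] GH unfolding M_def[symmetric]
  proof eventually_elim
    case (elim \<omega>)
    show ?case
    proof (cases "\<omega> \<in> B")
      case True
      then show ?thesis using H01(2)[of \<omega>] T by simp
    next
      case False
      have cl: "clean N \<omega> = \<omega>" using elim(1) by blast
      have reg: "\<forall>j. 0 < fst (snd (snd \<omega>) j)" "\<forall>j. sampled \<omega> j \<subseteq> {..<N} \<and> sampled \<omega> j \<noteq> {}"
        using elim(1) by blast+
      have "\<omega> \<notin> B1" "\<omega> \<notin> B2" "\<omega> \<notin> B3" "\<omega> \<notin> B4" "\<omega> \<notin> B5" "\<omega> \<notin> B6"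
        using False by (simp_all add: B_def)
      then have nb: "arrival_time \<omega> (m - 1) \<le> T" "T < arrival_time \<omega> a"
        "real (card {n. n < N \<and> T < fst (snd \<omega>) (n, 0)}) < real N * exp (- T) + u"
        "real (card {n. n < N \<and> rescued b a T \<omega> n}) < u"
        "real (card {n. n < N \<and> 2 \<le> fst \<omega> n}) \<le> u"
        "miss_weight b N k \<omega> m < 2 powr (- z)"
        unfolding B1_def B2_def B3_def B4_def B5_def B6_def mem_Collect_eq cl not_less not_le
        by simp_all
      have "?G \<omega> \<le> - 1 + T"
        by (rule early_descent_if_typical[OF reg N T k m nb z])
      then show ?thesis using False elim(2) by simp
    qed
  qed
  have "(\<integral>\<omega>. ?G \<omega> \<partial>completion M) = (\<integral>\<omega>. H \<omega> \<partial>completion M)"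
    by (rule integral_cong_AE[OF borel_measurable_completion_AE[OF Hm GH] measurable_completion[OF Hm]
        AE_completion[OF GH]])
  also have "\<dots> = (\<integral>\<omega>. H \<omega> \<partial>M)" by (rule integral_completion[OF Hm])
  also have "\<dots> \<le> (\<integral>\<omega>. (- 1 + T) + indicator B \<omega> \<partial>M)"
    using BM by (intro integral_mono_AE[OF Hint _ bound] Bochner_Integration.integrable_add)
      (simp_all add: integrable_real_indicator M.emeasure_eq_measure)
  also have "\<dots> = - 1 + T + M.prob B"
    using BM by (subst Bochner_Integration.integral_add) (simp_all add: integrable_real_indicator M.emeasure_eq_measure M.prob_space)
  finally show ?thesis
    using Ble unfolding B1_def B2_def B3_def B4_def B5_def B6_def by linarith
qed

section \<open>Asymptotics\<close>

lemma arrival_time_jsq_measurable: "(\<lambda>\<omega>. arrival_time \<omega> j) \<in> borel_measurable (jsq_space N l d init)"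
proof -
  interpret measurable_sample "jsq_space N l d init" N "clean N" by (rule measurable_sample_jsq)
  show ?thesis using arrival_time_measurable[of j] by (simp add: arrival_time_eq)
qed

lemma measure_arrival_time_off:
  assumes l: "0 < l" and c: "0 < c"
    and P: "\<And>t. P t \<Longrightarrow> c \<le> \<bar>t - real (Suc j) / l\<bar>"
  shows "measure (jsq_space N l d init) {\<omega>. P (arrival_time \<omega> j)} \<le> real (Suc j) / (l * c)\<^sup>2"
proof -
  interpret M: prob_space "jsq_space N l d init" by (rule prob_space_jsq[OF l])
  note [measurable] = arrival_time_jsq_measurable
  have "{\<omega> \<in> space (jsq_space N l d init). c \<le> \<bar>arrival_time \<omega> j - real (Suc j) / l\<bar>} \<in> M.events"
    by measurable
  then have "M.prob {\<omega>. P (arrival_time \<omega> j)} \<le> M.prob {\<omega>. c \<le> \<bar>arrival_time \<omega> j - real (Suc j) / l\<bar>}"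
    using P by (intro M.finite_measure_mono) auto
  with arrival_time_deviation[OF l c] show ?thesis by (rule order.trans[rotated])
qed

text \<open>
  Weak convergence gives convergence of distribution functions at continuity points only. These are
  dense because there are at most countably many atoms.
\<close>

lemma exists_continuity_point_near_one:
  assumes D: "real_distribution D" and e: "0 < e"
  shows "\<exists>c. isCont (cdf D) c \<and> 1 - e < cdf D c"
proof -
  interpret real_distribution D by (rule D)
  have "\<forall>\<^sub>F x in at_top. 1 - e < cdf D x"
    using cdf_lim_at_top_prob by (rule order_tendstoD) (use e in simp)
  then obtain x0 where x0: "\<And>x. x0 \<le> x \<Longrightarrow> 1 - e < cdf D x"
    by (auto simp: eventually_at_top_linorder)
  have "countable {x. measure D {x} \<noteq> 0}" by (rule countable_support)
  moreover have "uncountable {x0..x0 + 1}" by (simp add: uncountable_closed_interval)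
  ultimately have "\<not> {x0..x0 + 1} \<subseteq> {x. measure D {x} \<noteq> 0}" using countable_subset by blast
  then obtain c where "x0 \<le> c" "measure D {c} = 0" by auto
  then show ?thesis using x0 isCont_cdf by blast
qed

text \<open>
  Tightness of the second coordinate at time 0. For \<open>b = 1\<close> there are no queues of length two.
\<close>

lemma initial_queues_of_two_small:
  assumes init: "\<And>N. initial_law N b (init N)" and Y: "cadlag_process b P Y"
    and conv: "initial_convergence init b P Y" and e: "0 < e"
  shows "\<exists>C. \<forall>\<^sub>F N in sequentially.
    measure (measure_pmf (init N)) {x. C * sqrt (real N) < real (card {n. n < N \<and> 2 \<le> x n})} \<le> e"
proof (cases "enat 2 \<le> b")
  case True
  interpret P: prob_space P using Y by (simp add: cadlag_process_def)
  have m: "(\<lambda>\<omega>. Y \<omega> 0 2) \<in> borel_measurable P" using Y by (simp add: cadlag_process_def)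
  let ?D = "distr P borel (\<lambda>\<omega>. Y \<omega> 0 2)"
  let ?q = "\<lambda>N x. real (card {n. n < N \<and> 2 \<le> x n})"
  have "real_distribution ?D" using m by (rule P.real_distribution_distr)
  then obtain C where C: "isCont (cdf ?D) C" "1 - e < cdf ?D C"
    using exists_continuity_point_near_one e by blast
  have "(\<lambda>N. cdf (distr (measure_pmf (init N)) borel (\<lambda>x. scaled_occupancy N x 2)) C) \<longlonglongrightarrow> cdf ?D C"
    using conv True C(1) by (auto simp: initial_convergence_def weak_conv_m_def weak_conv_def)
  then have "\<forall>\<^sub>F N in sequentially.
      1 - e < cdf (distr (measure_pmf (init N)) borel (\<lambda>x. scaled_occupancy N x 2)) C"
    using C(2) by (rule order_tendstoD)
  moreover have "\<forall>\<^sub>F N in sequentially. 1 \<le> N" by (rule eventually_ge_at_top)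
  ultimately have "\<forall>\<^sub>F N in sequentially.
    measure (measure_pmf (init N)) {x. C * sqrt (real N) < ?q N x} \<le> e"
  proof eventually_elim
    case (elim N)
    have "cdf (distr (measure_pmf (init N)) borel (\<lambda>x. scaled_occupancy N x 2)) C
        = measure (measure_pmf (init N)) {x. scaled_occupancy N x 2 \<le> C}"
      unfolding cdf_def by (subst measure_distr) (auto intro!: arg_cong[where f = "measure _"])
    also have "{x. scaled_occupancy N x 2 \<le> C} = UNIV - {x. C * sqrt (real N) < ?q N x}"
      using elim(2) by (auto simp: scaled_occupancy_def occupancy_def field_simps)
    also have "measure (measure_pmf (init N)) \<dots>
        = 1 - measure (measure_pmf (init N)) {x. C * sqrt (real N) < ?q N x}"
      using measure_pmf.prob_compl[of "{x. C * sqrt (real N) < ?q N x}" "init N"] by simp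
    finally show ?case using elim(1) by linarith
  qed
  then show ?thesis by blast
next
  case False
  have b1: "b \<le> enat 1"
  proof (cases b)
    case (enat c)
    then show ?thesis using False by simp
  qed (use False in simp)
  have "measure (measure_pmf (init N)) {x. 0 * sqrt (real N) < real (card {n. n < N \<and> 2 \<le> x n})} = 0" for N
  proof -
    have "{n. n < N \<and> 2 \<le> x n} = {}" if "x \<in> set_pmf (init N)" for x
    proof -
      have "x n < 2" if "n < N" for n
      proof -
        have "enat (x n) \<le> enat 1"
          using init[of N] \<open>x \<in> set_pmf (init N)\<close> that b1 order.trans unfolding initial_law_def by blast
        then show ?thesis by simp
      qed
      then show ?thesis by (auto simp: not_le)
    qed
    then show ?thesis by (auto simp: measure_pmf_zero_iff disjoint_iff)
  qed
  then show ?thesis using e by (intro exI[of _ 0]) (simp add: less_imp_le)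
qed

text \<open>
  The only place where the growth of \<open>d\<close> enters: with \<open>k \<le> C * sqrt N\<close> idle servers the
  probability of sampling none of them is at least
  \<open>(1 - d / (N - k)) ^ k \<ge> exp (- 4 * d * k / N)\<close>, and \<open>d * k / N\<close> is \<open>o(ln N)\<close>.
\<close>

lemma selection_miss_probability:
  fixes C :: real
  assumes d: "(\<lambda>N. real (d N) / (sqrt (real N) * ln (real N))) \<longlonglongrightarrow> 0" and C: "1 \<le> C"
    and k: "\<And>N. 1 \<le> N \<Longrightarrow> real (k N) \<le> C * sqrt (real N)"
  shows "\<forall>\<^sub>F N in sequentially. \<forall>I. I \<subseteq> {..<N} \<longrightarrow> card I \<le> k N \<longrightarrow>
    real N powr (- 1 / 16) \<le> measure (measure_pmf (uniform_selection N (d N))) {S. S \<inter> I = {}}"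
proof -
  have "\<forall>\<^sub>F N in sequentially. real (d N) / (sqrt (real N) * ln (real N)) < 1 / (64 * C)"
    using d by (rule order_tendstoD) (use C in simp)
  moreover have "\<forall>\<^sub>F N in sequentially. C \<le> real N powr (1 / 16)"
    using filterlim_at_top[THEN iffD1, of "\<lambda>N. real N powr (1 / 16)" sequentially] by real_asymp
  moreover have "\<forall>\<^sub>F N in sequentially. sqrt (real N) * ln (real N) \<le> real N / 4" by real_asymp
  moreover have "\<forall>\<^sub>F N in sequentially. real N powr (1 / 16) * sqrt (real N) \<le> real N / 4" by real_asymp
  moreover have "\<forall>\<^sub>F N in sequentially. 3 \<le> N" by (rule eventually_ge_at_top)
  ultimately show ?thesis
  proof eventually_elim
    case (elim N)
    have N: "0 < real N" "1 \<le> N" and ln: "0 < ln (real N)" using elim(5) by auto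
    have sl: "0 < sqrt (real N) * ln (real N)" using N ln by simp
    have d1: "real (d N) \<le> sqrt (real N) * ln (real N) / (64 * C)"
      using elim(1) sl by (simp add: field_simps)
    also have "\<dots> \<le> sqrt (real N) * ln (real N)"
      using divide_left_mono[of 1 "64 * C" "sqrt (real N) * ln (real N)"] sl C by simp
    finally have d4: "real (d N) \<le> real N / 4" using elim(3) by linarith
    have "C * sqrt (real N) \<le> real N powr (1 / 16) * sqrt (real N)"
      using elim(2) by (intro mult_right_mono) simp_all
    then have k4: "real (k N) \<le> real N / 4" using k[OF N(2)] elim(4) by linarith
    have "d N + k N \<le> N" "k N < N" using d4 k4 N by linarith+
    note avoid = uniform_selection_avoids[OF this]
    let ?x = "real (d N) / real (N - k N)"
    have Nk: "real N / 2 \<le> real (N - k N)" using k4 N by (simp add: of_nat_diff)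
    have x0: "0 \<le> ?x" by simp
    have "?x \<le> real (d N) / (real N / 2)"
      using Nk N by (intro divide_left_mono mult_pos_pos) (linarith | simp)+
    then have x2: "?x \<le> 2 * real (d N) / real N" by (simp add: mult.commute)
    moreover have "2 * real (d N) / real N \<le> 1 / 2" using d4 N by (simp add: field_simps)
    ultimately have x: "?x \<le> 1 / 2" by (rule order.trans)
    have "- (2 * ?x) \<le> - ?x - 2 * ?x\<^sup>2"
      using mult_left_mono[OF x x0] by (simp add: power2_eq_square)
    also have "\<dots> \<le> ln (1 - ?x)" by (rule ln_one_minus_pos_lower_bound[OF x0 x])
    finally have "exp (- (2 * ?x)) \<le> 1 - ?x"
      using x by (simp add: ln_ge_iff)
    then have "exp (- (2 * ?x)) ^ k N \<le> (1 - ?x) ^ k N" by (intro power_mono) simp_all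
    moreover have "real N powr (- 1 / 16) \<le> exp (- (2 * ?x)) ^ k N"
    proof -
      have "real (k N) * (2 * ?x) \<le> (C * sqrt (real N)) * (2 * (2 * real (d N) / real N))"
        using k[OF N(2)] x2 C N by (intro mult_mono) simp_all
      also have "\<dots> \<le> (C * sqrt (real N)) * (2 * (2 * (sqrt (real N) * ln (real N) / (64 * C)) / real N))"
        using d1 C N by (intro mult_left_mono divide_right_mono) simp_all
      also have "\<dots> = (sqrt (real N) * sqrt (real N)) * ln (real N) / (16 * real N)"
        using C N by (simp add: field_simps)
      also have "\<dots> = ln (real N) / 16" using N by (simp add: field_simps)
      finally have "exp (- (ln (real N) / 16)) \<le> exp (real (k N) * - (2 * ?x))" by simp
      then have "exp (- (ln (real N) / 16)) \<le> exp (- (2 * ?x)) ^ k N" unfolding exp_of_nat_mult .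
      moreover have "real N powr (- 1 / 16) = exp (- (ln (real N) / 16))" using N by (simp add: powr_def)
      ultimately show ?thesis by simp
    qed
    ultimately have "real N powr (- 1 / 16) \<le> (1 - ?x) ^ k N" by linarith
    then show ?case using avoid order.trans by blast
  qed
qed

text \<open>
  The exponents leave room everywhere. With \<open>T = N powr (-1/4)\<close> the quadratic error \<open>N * T\<^sup>2\<close> is
  \<open>sqrt N\<close> and all fluctuations are of order at most \<open>sqrt N\<close>, hence below the slack \<open>N powr (5/8)\<close>; the
  number of misses is of the order \<open>N * T * N powr (-1/16) = N powr (11/16)\<close>, well above it.
\<close>

definition window :: "nat \<Rightarrow> real" where
  "window N = real N powr (- 1 / 4)"

definition slack :: "nat \<Rightarrow> real" where
  "slack N = real N powr (5 / 8)"

text \<open>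
  In this order: the length of the window, the probabilities that arrivals come too slowly and too
  fast, that too many initial services are long, that too many servers are rescued, and that too few
  arrivals miss the idle servers.
\<close>

definition error_bound :: "nat \<Rightarrow> real" where
  "error_bound N =
     window N + 4 / (real N * window N) + 2 * (real N * window N + slack N + 2) / (slack N)\<^sup>2
     + exp (- 2 * (slack N)\<^sup>2 / real N)
     + (exp (window N) - 1) * (real N * window N + slack N + 1) / slack N
     + exp (6 * slack N - (real N * window N / 2 - 1) * real N powr (- 1 / 16) / 2)"

lemma error_bound_tendsto_0: "error_bound \<longlonglongrightarrow> 0"
  unfolding error_bound_def[abs_def] window_def slack_def by real_asymp

lemma exp_minus_le_quadratic:
  fixes t :: real assumes "0 \<le> t" shows "exp (- t) \<le> 1 - t + t\<^sup>2 / 2"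
proof -
  define f :: "real \<Rightarrow> real" where "f t = 1 - t + t\<^sup>2 / 2 - exp (- t)" for t
  have "f 0 \<le> f t"
  proof (rule DERIV_nonneg_imp_nondecreasing[OF assms])
    fix x :: real
    have "(f has_real_derivative (- 1 + x + exp (- x))) (at x)"
      unfolding f_def by (auto intro!: derivative_eq_intros)
    moreover have "0 \<le> - 1 + x + exp (- x)"
      using exp_ge_add_one_self[of "- x"] by linarith
    ultimately show "\<exists>y. (f has_real_derivative y) (at x) \<and> 0 \<le> y" by blast
  qed
  then show ?thesis by (simp add: f_def)
qed

lemma two_powr_mult_power_le_exp:
  fixes z p :: real
  assumes "0 \<le> z" "0 \<le> p" "p \<le> 1" "c \<le> real m"
  shows "2 powr z * (1 - p / 2) ^ m \<le> exp (z - c * p / 2)"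
proof -
  have "ln 2 \<le> (1::real)" using ln_le_minus_one[of 2] by simp
  then have "2 powr z \<le> exp z"
    using assms(1) by (simp add: powr_def mult_left_le)
  moreover have "(1 - p / 2) ^ m \<le> exp (- (p / 2)) ^ m"
    using assms exp_ge_add_one_self[of "- (p / 2)"] by (intro power_mono) simp_all
  moreover have "exp (- (p / 2)) ^ m = exp (- (real m * p / 2))"
    by (simp flip: exp_of_nat_mult)
  moreover have "exp (- (real m * p / 2)) \<le> exp (- (c * p / 2))"
    using assms by (simp add: mult_right_mono)
  ultimately have "2 powr z \<le> exp z" "(1 - p / 2) ^ m \<le> exp (- (c * p / 2))" by linarith+
  then have "2 powr z * (1 - p / 2) ^ m \<le> exp z * exp (- (c * p / 2))"
    using assms by (intro mult_mono) simp_all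
  then show ?thesis by (simp flip: exp_add)
qed

text \<open>
  With the numbers \<open>m\<close> and \<open>a\<close> of arrivals chosen as \<open>N T / 2\<close> and \<open>N T\<close> plus slack, the window
  contains between \<open>m\<close> and \<open>a\<close> arrivals with high probability. The lower bound may be generous since it only
  affects the number of misses; the upper one enters the balance, so its excess over \<open>N T\<close> must not exceed the slack by much.
\<close>

lemma jsq_descent:
  assumes N: "1 \<le> N" and l: "9 / 10 * real N \<le> l" "l \<le> real N" and d: "1 \<le> d" "d \<le> N"
    and k: "(K + 1) * sqrt (real N) \<le> real k"
    and avoid: "\<And>I. I \<subseteq> {..<N} \<Longrightarrow> card I \<le> k \<Longrightarrow>
      real N powr (- 1 / 16) \<le> measure (measure_pmf (uniform_selection N d)) {S. S \<inter> I = {}}"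
    and two: "measure (measure_pmf init) {x. slack N < real (card {n. n < N \<and> 2 \<le> x n})} \<le> e"
    and large: "real k + sqrt (real N) / 2 + 1 \<le> 2 * slack N" "2 \<le> real N * window N"
  shows "(\<integral>\<omega>. early_descent K (scaled_process N b \<omega>) \<partial>completion (jsq_space N l d init))
    \<le> - 1 + error_bound N + e"
proof -
  let ?T = "window N" and ?u = "slack N" and ?M = "jsq_space N l d init"
  define a where "a = nat \<lceil>real N * ?T + ?u\<rceil>"
  define m where "m = nat \<lfloor>real N * ?T / 2\<rfloor>"
  have N0: "0 < real N" "1 \<le> real N" using N by simp_all
  have l0: "0 < l" using l N0 by linarith
  have T: "0 < ?T" using N0 by (simp add: window_def)
  have u: "0 < ?u" using N0 by (simp add: slack_def)
  have a: "real N * ?T + ?u \<le> real a" "real a \<le> real N * ?T + ?u + 1"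
    using T u N0 unfolding a_def by (simp_all add: add_nonneg_nonneg)
  have m: "1 \<le> m" "real N * ?T / 2 - 1 \<le> real m" "real m \<le> real N * ?T / 2"
    using large(2) unfolding m_def by (linarith | simp add: le_nat_floor)+
  have NT2: "real N * ?T\<^sup>2 = sqrt (real N)"
  proof -
    have "real N * ?T\<^sup>2 = real N powr 1 * real N powr (- 1 / 2)"
      using N0 by (simp add: window_def powr_power)
    also have "\<dots> = real N powr (1 / 2)" by (subst powr_add[symmetric]) simp
    also have "\<dots> = sqrt (real N)" by (simp add: powr_half_sqrt)
    finally show ?thesis .
  qed
  have z: "real k + real a + 3 * ?u + real N * exp (- ?T) - real N \<le> 6 * ?u"
  proof -
    have "real N * exp (- ?T) \<le> real N * (1 - ?T + ?T\<^sup>2 / 2)"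
      using T N0 by (intro mult_left_mono exp_minus_le_quadratic) simp_all
    also have "\<dots> = real N - real N * ?T + sqrt (real N) / 2"
      using NT2 by (simp add: algebra_simps)
    finally show ?thesis using a large(1) by linarith
  qed
  have B1: "measure ?M {\<omega>. ?T < arrival_time \<omega> (m - 1)} \<le> 4 / (real N * ?T)"
  proof -
    \<comment> \<open>The mean is at most \<open>5/9 * T\<close> as \<open>l \<ge> 9/10 * N\<close>, leaving a distance of more than \<open>2/5 * T\<close>.\<close>
    let ?c = "2 / 5 * ?T"
    have "real m / l \<le> (real N * ?T / 2) / (9 / 10 * real N)"
      using m l l0 N0 T by (intro frac_le) simp_all
    also have "\<dots> = 5 / 9 * ?T" using N0 by simp
    finally have mean: "real m / l \<le> 5 / 9 * ?T" .
    have Suc: "Suc (m - 1) = m" using m(1) by simp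
    have c: "0 < ?c" using T by simp
    have off: "?c \<le> \<bar>t - real (Suc (m - 1)) / l\<bar>" if "?T < t" for t
      using that mean T unfolding Suc by linarith
    have "measure ?M {\<omega>. ?T < arrival_time \<omega> (m - 1)} \<le> real m / (l * ?c)\<^sup>2"
      using measure_arrival_time_off[where P = "\<lambda>t. ?T < t", OF l0 c off, of N d init]
      unfolding Suc .
    also have "\<dots> \<le> (real N * ?T / 2) / (9 / 10 * real N * ?c)\<^sup>2"
      using m l N0 T by (intro frac_le power_mono mult_right_mono) simp_all
    also have "\<dots> = (625 / 162) / (real N * ?T)"
      using N0 T by (simp add: field_simps power2_eq_square)
    also have "\<dots> \<le> 4 / (real N * ?T)"
      using N0 T by (intro divide_right_mono) simp_all
    finally show ?thesis .
  qed
  have B2: "measure ?M {\<omega>. arrival_time \<omega> a \<le> ?T} \<le> 2 * (real N * ?T + ?u + 2) / ?u\<^sup>2"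
  proof -
    let ?c = "?u / real N"
    have "?T + ?c = (real N * ?T + ?u) / real N" using N0 by (simp add: field_simps)
    also have "\<dots> \<le> real (Suc a) / l"
      using a l l0 N0 T u by (intro frac_le) simp_all
    finally have mean: "?T + ?c \<le> real (Suc a) / l" .
    have "measure ?M {\<omega>. arrival_time \<omega> a \<le> ?T} \<le> real (Suc a) / (l * ?c)\<^sup>2"
      by (rule measure_arrival_time_off[OF l0]) (use N0 u mean in \<open>simp, linarith\<close>)
    also have "\<dots> \<le> (real N * ?T + ?u + 2) / (9 / 10 * real N * ?c)\<^sup>2"
      using a l N0 u by (intro frac_le power_mono mult_right_mono) simp_all
    also have "\<dots> = 100 / 81 * ((real N * ?T + ?u + 2) / ?u\<^sup>2)"
      using N0 u by (simp add: field_simps power2_eq_square)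
    also have "\<dots> \<le> 2 * ((real N * ?T + ?u + 2) / ?u\<^sup>2)"
      using N0 T u by (intro mult_right_mono divide_nonneg_nonneg) simp_all
    finally show ?thesis by simp
  qed
  have B3: "measure ?M {\<omega>. real N * exp (- ?T) + ?u
      \<le> real (card {n. n < N \<and> ?T < fst (snd \<omega>) (n, 0)})} \<le> exp (- 2 * ?u\<^sup>2 / real N)"
    using T u N by (intro long_services_deviation l0) simp_all
  have B4: "measure ?M {\<omega>. ?u \<le> real (card {n. n < N \<and> rescued b a ?T (clean N \<omega>) n})}
      \<le> (exp ?T - 1) * (real N * ?T + ?u + 1) / ?u"
  proof -
    have "measure ?M {\<omega>. ?u \<le> real (card {n. n < N \<and> rescued b a ?T (clean N \<omega>) n})}
        \<le> (exp ?T - 1) * real a / ?u"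
      using T u by (intro measure_rescued_ge_le l0 d) simp_all
    also have "\<dots> \<le> (exp ?T - 1) * (real N * ?T + ?u + 1) / ?u"
      using a T u by (intro divide_right_mono mult_left_mono) simp_all
    finally show ?thesis .
  qed
  have B5: "measure ?M {\<omega>. ?u < real (card {n. n < N \<and> 2 \<le> fst \<omega> n})} \<le> e"
    using two measure_jsq_initial[OF l0, of N d init "\<lambda>x. ?u < real (card {n. n < N \<and> 2 \<le> x n})"]
    by simp
  have B6: "measure ?M {\<omega>. 2 powr (- (6 * ?u)) \<le> miss_weight b N k (clean N \<omega>) m}
      \<le> exp (6 * ?u - (real N * ?T / 2 - 1) * real N powr (- 1 / 16) / 2)"
  proof -
    have p1: "real N powr (- 1 / 16) \<le> 1" using powr_mono[of "- 1 / 16" 0 "real N"] N0 by simp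
    have "measure ?M {\<omega>. 2 powr (- (6 * ?u)) \<le> miss_weight b N k (clean N \<omega>) m}
        \<le> 2 powr (6 * ?u) * (1 - real N powr (- 1 / 16) / 2) ^ m"
      by (rule measure_few_misses_le[OF l0 avoid p1])
    also have "\<dots> \<le> exp (6 * ?u - (real N * ?T / 2 - 1) * real N powr (- 1 / 16) / 2)"
      using u m p1 by (intro two_powr_mult_power_le_exp) simp_all
    finally show ?thesis .
  qed
  show ?thesis
    using integral_early_descent_le[OF l0 N d less_imp_le[OF T] k m(1) z, of init b] B1 B2 B3 B4 B5 B6
    unfolding error_bound_def by linarith
qed

theorem theorem2p5:
  fixes b :: enat
    and lam :: "nat \<Rightarrow> real"
    and d :: "nat \<Rightarrow> nat"
    and \<beta> :: real
    and init init_jsq :: "nat \<Rightarrow> (nat \<Rightarrow> nat) pmf"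
    and P :: "'v measure"
    and Y :: "'v \<Rightarrow> real \<Rightarrow> nat \<Rightarrow> real"
  assumes b: "1 \<le> b"
    and lam: "\<And>N. 1 \<le> N \<Longrightarrow> 0 < lam N"
    and d: "\<And>N. 1 \<le> N \<Longrightarrow> 1 \<le> d N \<and> d N \<le> N"
    and beta: "0 < \<beta>" "(\<lambda>N. (real N - lam N) / sqrt (real N)) \<longlonglongrightarrow> \<beta>"
    and init: "\<And>N. initial_law N b (init N)"
    and Y: "cadlag_process b P Y"
    and init_conv: "initial_convergence init b P Y"
    and init_jsq: "\<And>N. initial_law N b (init_jsq N)"
    and init_jsq_conv: "initial_convergence init_jsq b P Y"
    and jsq_limit: "jsq_diffusion_limit b lam \<beta> init_jsq P Y"
    and d_small: "(\<lambda>N. real (d N) / (sqrt (real N) * ln (real N))) \<longlonglongrightarrow> 0"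
  shows "\<not> weakly_converges_J1 (\<lambda>N. jsq_space N (lam N) (d N) (init N)) (\<lambda>N. scaled_process N b) P Y"
proof (rule not_weakly_converges_J1_if_descent)
  show "prob_space P" using Y by (simp add: cadlag_process_def)
  show "Y \<omega> \<in> cadlag" if "\<omega> \<in> space P" for \<omega> using Y that by (simp add: cadlag_process_def)
  fix K \<eta> :: real assume \<eta>: "0 < \<eta>"
  \<comment> \<open>The additional 1 absorbs the rounding in \<open>k\<close>.\<close>
  define C where "C = \<bar>K + 1\<bar> + 1"
  define k where "k N = nat \<lceil>\<bar>K + 1\<bar> * sqrt (real N)\<rceil>" for N
  have k_ge: "(K + 1) * sqrt (real N) \<le> real (k N)" for N
  proof -
    have "(K + 1) * sqrt (real N) \<le> \<bar>K + 1\<bar> * sqrt (real N)" by (intro mult_right_mono) simp_all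
    also have "\<dots> \<le> real (k N)" unfolding k_def by (rule real_nat_ceiling_ge)
    finally show ?thesis .
  qed
  have k_le: "real (k N) \<le> C * sqrt (real N)" if N: "1 \<le> N" for N
  proof -
    have "real (k N) \<le> \<bar>K + 1\<bar> * sqrt (real N) + 1"
      unfolding k_def using of_int_ceiling_le_add_one[of "\<bar>K + 1\<bar> * sqrt (real N)"] by simp
    moreover have "1 \<le> sqrt (real N)" using N by simp
    ultimately show ?thesis unfolding C_def distrib_right by linarith
  qed
  have C1: "1 \<le> C" by (simp add: C_def)
  obtain C' where C': "\<forall>\<^sub>F N in sequentially. measure (measure_pmf (init N))
      {x. C' * sqrt (real N) < real (card {n. n < N \<and> 2 \<le> x n})} \<le> \<eta> / 2"
    using initial_queues_of_two_small[OF init Y init_conv, of "\<eta> / 2"] \<eta> by auto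
  have large: "filterlim (\<lambda>N. real N powr (1 / 16)) at_top sequentially" by real_asymp
  have "\<forall>\<^sub>F N in sequentially. 0 < (real N - lam N) / sqrt (real N)"
    using beta(2) by (rule order_tendstoD) (rule beta(1))
  moreover have "\<forall>\<^sub>F N in sequentially. (real N - lam N) / sqrt (real N) < \<beta> + 1"
    using beta(2) by (rule order_tendstoD) simp
  \<comment> \<open>Dominating all constants by a small power of \<open>N\<close> leaves only parameter-free comparisons.\<close>
  moreover have "\<forall>\<^sub>F N in sequentially. \<beta> + 1 \<le> real N powr (1 / 16)"
    using large by (simp add: filterlim_at_top)
  moreover have "\<forall>\<^sub>F N in sequentially. C \<le> real N powr (1 / 16)"
    using large by (simp add: filterlim_at_top)
  moreover have "\<forall>\<^sub>F N in sequentially. C' \<le> real N powr (1 / 16)"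
    using large by (simp add: filterlim_at_top)
  moreover have "\<forall>\<^sub>F N in sequentially. real N powr (1 / 16) * sqrt (real N) \<le> real N / 10"
    by real_asymp
  moreover have "\<forall>\<^sub>F N in sequentially. real N powr (1 / 16) * sqrt (real N) \<le> slack N"
    unfolding slack_def by real_asymp
  moreover have "\<forall>\<^sub>F N in sequentially. sqrt (real N) / 2 + 1 \<le> slack N"
    unfolding slack_def by real_asymp
  moreover have "\<forall>\<^sub>F N in sequentially. 2 \<le> real N * window N"
    unfolding window_def by real_asymp
  moreover have "\<forall>\<^sub>F N in sequentially. error_bound N < \<eta> / 2"
    using error_bound_tendsto_0 by (rule order_tendstoD) (use \<eta> in simp)
  moreover have "\<forall>\<^sub>F N in sequentially. \<forall>I. I \<subseteq> {..<N} \<longrightarrow> card I \<le> k N \<longrightarrow>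
      real N powr (- 1 / 16) \<le> measure (measure_pmf (uniform_selection N (d N))) {S. S \<inter> I = {}}"
    by (rule selection_miss_probability[OF d_small C1]) (rule k_le)
  moreover note C' eventually_ge_at_top[of "1 :: nat"]
  ultimately show "\<forall>\<^sub>F N in sequentially.
      (\<integral>\<omega>. early_descent K (scaled_process N b \<omega>) \<partial>completion (jsq_space N (lam N) (d N) (init N)))
        \<le> - 1 + \<eta>"
  proof eventually_elim
    case (elim N)
    have N: "1 \<le> N" and s: "0 < sqrt (real N)" using elim(13) by simp_all
    have bound: "c * sqrt (real N) \<le> real N powr (1 / 16) * sqrt (real N)"
      if "c \<le> real N powr (1 / 16)" for c
      using that by (intro mult_right_mono) simp_all
    have "lam N \<le> real N" using elim(1) s by (simp add: zero_less_divide_iff)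
    moreover have "9 / 10 * real N \<le> lam N"
    proof -
      have "real N - lam N < (\<beta> + 1) * sqrt (real N)" using elim(2) s by (simp add: divide_less_eq)
      then show ?thesis using bound[OF elim(3)] elim(6) by linarith
    qed
    moreover have "measure (measure_pmf (init N)) {x. slack N < real (card {n. n < N \<and> 2 \<le> x n})} \<le> \<eta> / 2"
    proof -
      have "measure (measure_pmf (init N)) {x. slack N < real (card {n. n < N \<and> 2 \<le> x n})}
          \<le> measure (measure_pmf (init N)) {x. C' * sqrt (real N) < real (card {n. n < N \<and> 2 \<le> x n})}"
        by (intro measure_pmf.finite_measure_mono) (use bound[OF elim(5)] elim(7) in auto)
      with elim(12) show ?thesis by linarith
    qed
    moreover have "real (k N) + sqrt (real N) / 2 + 1 \<le> 2 * slack N"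
      using k_le[OF N] bound[OF elim(4)] elim(7,8) by linarith
    ultimately have "(\<integral>\<omega>. early_descent K (scaled_process N b \<omega>) \<partial>completion (jsq_space N (lam N) (d N) (init N)))
        \<le> - 1 + error_bound N + \<eta> / 2"
      using d[OF N] elim(9,11) by (intro jsq_descent[OF N _ _ _ _ k_ge[of N]]) simp_all
    with elim(10) show ?case by linarith
  qed
qed

end
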